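(* Let $\Omega\subset\mathbb{R}^d$ be any open set, $s\in[0,1]$, $p\in(1,\infty)$ and $p'=p/(p-1)$. Let $K\subset\Lambda^{s,p}_0(\Omega)$ be a non-empty closed convex set. Let $\boldsymbol{a}=\boldsymbol{a}(x,\xi):\mathbb{R}^d\times\mathbb{R}^d\to\mathbb{R}^d$ and $b=b(x,r):\mathbb{R}^d\times\mathbb{R}\to\mathbb{R}$ be Carathéodory functions which are monotone with respect to $\xi$ and $r$, respectively, i.e. $(\boldsymbol{a}(x,\xi)-\boldsymbol{a}(x,\eta))\cdot(\xi-\eta)\geq0$ and $(b(x,r)-b(x,\rho))(r-\rho)\geq0$, and satisfy $$|\boldsymbol{a}(x,\xi)|\leq\gamma_1(x)+C_1|\xi|^{p-1},\qquad |b(x,r)|\leq\gamma_2(x)+C_2'|r|^{p-1},$$ $$\boldsymbol{a}(x,\xi)\cdot\xi+b(x,r)r\geq\alpha|\xi|^p+\beta|r|^p-k(x),$$ for all $r,\rho\in\mathbb{R}$, $\xi,\eta\in\mathbb{R}^d$ and a.e. $x\in\mathbb{R}^d$, where $C_1,C_2'>0$, $\alpha>0$, $\beta>0$ are constants, $\gamma_1,\gamma_2\in L^{p'}(\mathbb{R}^d)$ and $k\in L^1(\mathbb{R}^d)$. Then there exists $u\in K$ such that $$\int_{\mathbb{R}^d}\boldsymbol{a}(x,D^su)\cdot D^s(v-u)\,dx+\int_\Omega b(x,u)(v-u)\,dx\geq0\qquad\forall v\in K.$$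
   Context: Fractional gradient. For $r\in(0,1)$ and $\varphi\in C_c^\infty(\mathbb{R}^d)$ let $I_r\varphi(x)=\frac{\mu_{d,1-r}}{d-r}\int_{\mathbb{R}^d}\frac{\varphi(y)}{|x-y|^{d-r}}\,dy$ be the Riesz potential, where $\mu_{d,s}=\frac{2^s\Gamma((d+s+1)/2)}{\pi^{d/2}\Gamma((1-s)/2)}$. For $s\in(0,1)$, $D^s\varphi=D(I_{1-s}\varphi)$, where $D$ is the classical gradient; $D^1=D$; and $D^0=-R$, where $R$ is the vector-valued Riesz transform, $R_j\varphi(x)=\frac{\Gamma((d+1)/2)}{\pi^{(d+1)/2}}\,\mathrm{p.v.}\!\int_{\mathbb{R}^d}\frac{x_j-y_j}{|x-y|^{d+1}}\varphi(y)\,dy$. For $\Phi\in C^\infty_c(\mathbb{R}^d;\mathbb{R}^d)$, $D^s\cdot\Phi=\sum_{j=1}^d (D^s\Phi_j)_j$. For $0\le s<1$ and $u\in L^p(\mathbb{R}^d)$, the weak $s$-fractional gradient $D^su$ is the function $\Gamma\in L^1_{\mathrm{loc}}(\mathbb{R}^d;\mathbb{R}^d)$ (if it exists) such that $\int u\,D^s\cdot\Phi\,dx=-\int\Gamma\cdot\Phi\,dx$ for all $\Phi\in C_c^\infty(\mathbb{R}^d;\mathbb{R}^d)$. Spaces. $\Lambda^{s,p}(\mathbb{R}^d)=\{u\in L^p(\mathbb{R}^d): D^su\in L^p(\mathbb{R}^d;\mathbb{R}^d)\}$ with norm $(\|u\|^p_{L^p(\mathbb{R}^d)}+\|D^su\|^p_{L^p(\mathbb{R}^d;\mathbb{R}^d)})^{1/p}$;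 $\Lambda^{1,p}(\mathbb{R}^d)=W^{1,p}(\mathbb{R}^d)$ and $\Lambda^{0,p}(\mathbb{R}^d)=L^p(\mathbb{R}^d)$ with equivalent norms. For $\Omega\subset\mathbb{R}^d$ open, $\Lambda^{s,p}_0(\Omega)$ is the closure of $C^\infty_c(\Omega)$ in $\Lambda^{s,p}(\mathbb{R}^d)$, with the same norm; its elements vanish a.e. outside $\Omega$, and $\Lambda^{0,p}_0(\Omega)=\{u\in L^p(\mathbb{R}^d):u=0\text{ a.e. in }\mathbb{R}^d\setminus\Omega\}$. Carathéodory: measurable in $x$ for fixed remaining variable and continuous in the remaining variable for a.e. $x$. *)

theory Defs
  imports "HOL-Analysis.Analysis"
begin

text \<open>
  Functions on \<open>\<real>\<^sup>d\<close> are total functions on \<^typ>\<open>real^'n\<close> with \<open>d = CARD('n)\<close>. Elements of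
  \<open>L\<^sup>p\<close> are represented by functions rather than by classes modulo a.e. equality, so the norms
  below are seminorms and the weak gradient is determined up to null sets. All integrals are
  Bochner integrals with respect to the complete measure \<^const>\<open>lebesgue\<close>: for a
  Caratheodory function \<open>f\<close> continuous in \<open>\<xi>\<close> only for almost every \<open>x\<close>, the composition
  \<open>\<lambda>x. f x (g x)\<close> need not be Borel measurable.
\<close>


subsection \<open>Test functions\<close>

definition gradient :: "(real^'n \<Rightarrow> real) \<Rightarrow> real^'n \<Rightarrow> real^'n" where
  "gradient f x = (\<chi> j. frechet_derivative f (at x) (axis j 1))"

primrec C_k :: "nat \<Rightarrow> (real^'n \<Rightarrow> real) \<Rightarrow> bool" where
  "C_k 0 f \<longleftrightarrow> continuous_on UNIV f"
| "C_k (Suc k) f \<longleftrightarrow> (\<forall>x. f differentiable (at x)) \<and> (\<forall>j. C_k k (\<lambda>x. gradient f x $ j))"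

definition test_fun :: "(real^'n) set \<Rightarrow> (real^'n \<Rightarrow> real) set" where
  "test_fun \<Omega> = {\<phi>. (\<forall>k. C_k k \<phi>) \<and>
     compact (closure {x. \<phi> x \<noteq> 0}) \<and> closure {x. \<phi> x \<noteq> 0} \<subseteq> \<Omega>}"

definition test_field :: "(real^'n) set \<Rightarrow> (real^'n \<Rightarrow> real^'n) set" where
  "test_field \<Omega> = {\<Phi>. \<forall>j. (\<lambda>x. \<Phi> x $ j) \<in> test_fun \<Omega>}"


subsection \<open>The fractional gradient of test functions\<close>

definition riesz_const :: "real \<Rightarrow> real \<Rightarrow> real" where
  "riesz_const d s =
     2 powr s * Gamma ((d + s + 1) / 2) / (pi powr (d / 2) * Gamma ((1 - s) / 2))"

text \<open>Meant for \<open>0 < r < 1\<close>, so that \<open>d - r > 0\<close>. The value \<open>0\<close> of the integrand at \<open>y = x\<close>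
  (division by zero) is irrelevant for the integral.\<close>

definition riesz_potential :: "real \<Rightarrow> (real^'n \<Rightarrow> real) \<Rightarrow> real^'n \<Rightarrow> real" where
  "riesz_potential r \<phi> x =
     riesz_const (real CARD('n)) (1 - r) / (real CARD('n) - r) *
     (LINT y|lebesgue. \<phi> y / norm (x - y) powr (real CARD('n) - r))"

definition riesz_transform :: "(real^'n \<Rightarrow> real) \<Rightarrow> real^'n \<Rightarrow> real^'n" where
  "riesz_transform \<phi> x = (\<chi> j.
     Gamma ((real CARD('n) + 1) / 2) / pi powr ((real CARD('n) + 1) / 2) *
     Lim (at_right 0) (\<lambda>\<epsilon>.
       LINT y:{y. norm (x - y) > \<epsilon>}|lebesgue.
         (x $ j - y $ j) / norm (x - y) ^ (CARD('n) + 1) * \<phi> y))"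

definition frac_gradient :: "real \<Rightarrow> (real^'n \<Rightarrow> real) \<Rightarrow> real^'n \<Rightarrow> real^'n" where
  "frac_gradient s \<phi> =
     (if s = 1 then gradient \<phi>
      else if s = 0 then (\<lambda>x. - riesz_transform \<phi> x)
      else gradient (riesz_potential (1 - s) \<phi>))"

definition frac_div :: "real \<Rightarrow> (real^'n \<Rightarrow> real^'n) \<Rightarrow> real^'n \<Rightarrow> real" where
  "frac_div s \<Phi> x = (\<Sum>j\<in>UNIV. frac_gradient s (\<lambda>y. \<Phi> y $ j) x $ j)"


subsection \<open>Lebesgue spaces\<close>

definition Lp_space :: "real \<Rightarrow> (real^'n \<Rightarrow> 'b::euclidean_space) set" where
  "Lp_space p = {f \<in> borel_measurable lebesgue. integrable lebesgue (\<lambda>x. norm (f x) powr p)}"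

definition Lp_norm :: "real \<Rightarrow> (real^'n \<Rightarrow> 'b::euclidean_space) \<Rightarrow> real" where
  "Lp_norm p f = (LINT x|lebesgue. norm (f x) powr p) powr (1 / p)"

definition L1_loc :: "(real^'n \<Rightarrow> 'b::euclidean_space) set" where
  "L1_loc = {f \<in> borel_measurable lebesgue. \<forall>C. compact C \<longrightarrow> set_integrable lebesgue C f}"


subsection \<open>The weak fractional gradient\<close>

text \<open>For \<open>s = 1\<close> this is the usual weak gradient. For \<open>u\<close> in \<open>L\<^sup>p\<close>, \<open>1 < p < \<infinity>\<close>, the left-hand
  integrand is always integrable because \<open>frac_div s \<Phi>\<close> lies in \<open>L\<^sup>q\<close> for every \<open>1 < q < \<infinity>\<close>.\<close>

definition is_weak_frac_gradient ::
    "real \<Rightarrow> (real^'n \<Rightarrow> real) \<Rightarrow> (real^'n \<Rightarrow> real^'n) \<Rightarrow> bool" where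
  "is_weak_frac_gradient s u G \<longleftrightarrow>
     G \<in> L1_loc \<and>
     (\<forall>\<Phi>\<in>test_field UNIV.
        (LINT x|lebesgue. u x * frac_div s \<Phi> x) = - (LINT x|lebesgue. G x \<bullet> \<Phi> x))"

definition weak_frac_gradient :: "real \<Rightarrow> (real^'n \<Rightarrow> real) \<Rightarrow> real^'n \<Rightarrow> real^'n" where
  "weak_frac_gradient s u = (SOME G. is_weak_frac_gradient s u G)"


subsection \<open>The spaces \<open>\<Lambda>\<^sup>s\<^sup>,\<^sup>p\<close>\<close>

text \<open>At \<open>s = 1\<close> this is \<open>W\<^sup>1\<^sup>,\<^sup>p\<close>, and at \<open>s = 0\<close> it is \<open>L\<^sup>p\<close> up to equivalence of norms.\<close>

definition Lambda :: "real \<Rightarrow> real \<Rightarrow> (real^'n \<Rightarrow> real) set" where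
  "Lambda s p = {u \<in> Lp_space p. \<exists>G. is_weak_frac_gradient s u G \<and> G \<in> Lp_space p}"

definition Lambda_norm :: "real \<Rightarrow> real \<Rightarrow> (real^'n \<Rightarrow> real) \<Rightarrow> real" where
  "Lambda_norm s p u =
     (Lp_norm p u powr p + Lp_norm p (weak_frac_gradient s u) powr p) powr (1 / p)"

text \<open>Closure in \<open>\<Lambda>\<^sup>s\<^sup>,\<^sup>p(\<real>\<^sup>d)\<close>, meant for \<open>A \<subseteq> Lambda s p\<close>.\<close>

definition Lambda_closure ::
    "real \<Rightarrow> real \<Rightarrow> (real^'n \<Rightarrow> real) set \<Rightarrow> (real^'n \<Rightarrow> real) set" where
  "Lambda_closure s p A =
     {u \<in> Lambda s p. \<forall>e>0. \<exists>v\<in>A. Lambda_norm s p (\<lambda>x. u x - v x) < e}"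

definition Lambda0 :: "real \<Rightarrow> real \<Rightarrow> (real^'n) set \<Rightarrow> (real^'n \<Rightarrow> real) set" where
  "Lambda0 s p \<Omega> = Lambda_closure s p (test_fun \<Omega>)"

text \<open>\<open>Lambda0 s p \<Omega>\<close> is itself closed, so closedness in it and in \<open>Lambda s p\<close> agree. A set closed
  in this sense contains with a function all functions a.e. equal to it, i.e. it is a union of
  classes modulo a.e. equality.\<close>

definition Lambda_closed :: "real \<Rightarrow> real \<Rightarrow> (real^'n \<Rightarrow> real) set \<Rightarrow> bool" where
  "Lambda_closed s p K \<longleftrightarrow> Lambda_closure s p K \<subseteq> K"

text \<open>The library's \<^const>\<open>convex\<close> is not available here, since functions are not an instance of
  \<^class>\<open>real_vector\<close>.\<close>

definition convex_funs :: "(real^'n \<Rightarrow> real) set \<Rightarrow> bool" where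
  "convex_funs K \<longleftrightarrow>
     (\<forall>u\<in>K. \<forall>v\<in>K. \<forall>t\<in>{0..1}. (\<lambda>x. (1 - t) * u x + t * v x) \<in> K)"


subsection \<open>Caratheodory functions\<close>

definition caratheodory ::
    "(real^'n \<Rightarrow> 'b::euclidean_space \<Rightarrow> 'c::euclidean_space) \<Rightarrow> bool" where
  "caratheodory f \<longleftrightarrow>
     (\<forall>\<xi>. (\<lambda>x. f x \<xi>) \<in> borel_measurable lebesgue) \<and>
     (AE x in lebesgue. continuous_on UNIV (f x))"

end

theory Submission
  imports Defs
begin

text \<open>
  The theorem is Minty's method applied to the graph of the weak fractional gradient. The pairs
  \<open>w = (u, D\<^sup>su)\<close> with \<open>u \<in> K\<close> form a non-empty closed convex subset of \<open>L\<^sup>p(\<real>\<^sup>d; \<real> \<times> \<real>\<^sup>d)\<close>, and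
  \<open>F x (r, \<xi>) = (b x r, a x \<xi>)\<close> is a monotone, coercive Caratheodory integrand of growth
  \<open>p - 1\<close> in \<open>(r, \<xi>)\<close>. Since elements of \<open>K\<close> vanish almost everywhere outside \<open>\<Omega>\<close>, the assertion
  is the variational inequality \<open>\<integral> F x (w x) \<bullet> (z x - w x) \<ge> 0\<close> for all \<open>z\<close> in the graph. Two
  things have to be shown: such an inequality is solvable in \<open>L\<^sup>p\<close> over any non-empty closed convex
  set (\<open>variational_inequality\<close>), and the graph is convex and closed
  (\<open>gradient_graph_convex\<close>, \<open>gradient_graph_closed\<close>).

  For the first part, a solution over a bounded convex set is a point common to the sets
  \<open>{w. \<integral> F x (z x) \<bullet> (z x - w x) \<ge> 0}\<close>, which are closed and convex. Finitely many of them meet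
  (\<open>minty_finite\<close>): on the simplex spanned by \<open>z\<^sub>1, \<dots>, z\<^sub>n\<close> this is a statement about a matrix \<open>M\<close> for
  which \<open>M + M\<^sup>T\<close> has nonnegative entries, proved by minimising a function over the simplex
  (\<open>exists_simplex_nonneg\<close>). All of them meet by weak compactness; here this takes the form of
  an intersection property of bounded closed convex sets, which follows directly from uniform
  convexity and completeness of \<open>L\<^sup>p\<close>, because elements of almost minimal norm form Cauchy
  sequences (\<open>Lp_finite_intersection_property\<close>). Coercivity bounds every solution over
  \<open>K \<inter> {norm \<le> R}\<close> independently of \<open>R\<close>, so that for large \<open>R\<close> the constraint on the norm is
  inactive.

  For the second part, the identity defining the weak gradient has to be linear in \<open>u\<close> and stable
  under \<open>L\<^sup>p\<close> limits. Both hold as soon as the fractional divergence of a test field lies in the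
  dual space \<open>L\<^sup>q\<close>, \<open>q = p / (p - 1)\<close>, which may be arbitrarily close to \<open>L\<^sup>1\<close>. The fractional
  gradient of a test function is shown to be bounded and \<open>O(|x|\<^sup>-\<^sup>d)\<close> at infinity
  (\<open>frac_gradient_bounded_decay\<close>), which gives \<open>L\<^sup>q\<close> for all \<open>q > 1\<close>. For \<open>0 < s < 1\<close> the gradient
  of the Riesz potential is computed by differentiating the test function, and its decay by
  differentiating the kernel; for \<open>s = 0\<close> the principal value is rewritten as an absolutely
  convergent integral by symmetrisation. Finally, the norm of \<open>\<Lambda>\<^sup>s\<^sup>,\<^sup>p\<close> involves a weak gradient
  chosen arbitrarily, so weak gradients must be unique almost everywhere; this is the fundamental
  lemma of the calculus of variations (\<open>AE_zero_if_test_field_integrals_zero\<close>).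
\<close>

section \<open>Elementary facts on Lebesgue spaces\<close>

text \<open>The modular \<open>\<parallel>f\<parallel>\<^sub>p\<^sup>p\<close>. Working with it instead of the norm replaces the inequalities of
  Hoelder and Minkowski by pointwise convexity estimates that are integrated directly.\<close>

definition Lp_mod :: "real \<Rightarrow> (real^'n \<Rightarrow> 'b::euclidean_space) \<Rightarrow> real" where
  "Lp_mod p f = (LINT x|lebesgue. norm (f x) powr p)"

lemma norm_add_powr_le:
  fixes a b :: "'b::real_normed_vector"
  assumes "0 \<le> p"
  shows "norm (a + b) powr p \<le> 2 powr p * (norm a powr p + norm b powr p)"
proof -
  have "norm (a + b) powr p \<le> (2 * max (norm a) (norm b)) powr p"
    using assms norm_triangle_ineq[of a b] by (intro powr_mono2) auto
  also have "\<dots> = 2 powr p * max (norm a) (norm b) powr p"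
    by (simp add: powr_mult)
  also have "\<dots> \<le> 2 powr p * (norm a powr p + norm b powr p)"
    by (intro mult_left_mono) (auto simp: max_def)
  finally show ?thesis .
qed

lemma Lp_spaceI:
  assumes "f \<in> borel_measurable lebesgue" "integrable lebesgue h"
    "AE x in lebesgue. norm (f x) powr p \<le> h x"
  shows "f \<in> Lp_space p"
proof -
  have [measurable]: "f \<in> borel_measurable lebesgue" by fact
  have "integrable lebesgue (\<lambda>x. norm (f x) powr p)"
    by (rule Bochner_Integration.integrable_bound[OF assms(2)]) (use assms(3) in \<open>auto elim!: eventually_mono\<close>)
  then show ?thesis using assms(1) by (simp add: Lp_space_def)
qed

lemma Lp_spaceD:
  assumes "f \<in> Lp_space p"
  shows "f \<in> borel_measurable lebesgue" "integrable lebesgue (\<lambda>x. norm (f x) powr p)"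
  using assms by (auto simp: Lp_space_def)

lemma Lp_space_scaleR:
  assumes "f \<in> Lp_space p"
  shows "(\<lambda>x. c *\<^sub>R f x) \<in> Lp_space p"
proof -
  note [measurable] = Lp_spaceD(1)[OF assms]
  show ?thesis
    by (rule Lp_spaceI[where h="\<lambda>x. \<bar>c\<bar> powr p * norm (f x) powr p"])
      (auto simp: powr_mult intro: Lp_spaceD[OF assms])
qed

lemma Lp_space_add:
  assumes "f \<in> Lp_space p" "g \<in> Lp_space p" "0 \<le> p"
  shows "(\<lambda>x. f x + g x) \<in> Lp_space p"
proof -
  note [measurable] = Lp_spaceD(1)[OF assms(1)] Lp_spaceD(1)[OF assms(2)]
  show ?thesis
    by (rule Lp_spaceI[where h="\<lambda>x. 2 powr p * (norm (f x) powr p + norm (g x) powr p)"])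
      (auto intro!: norm_add_powr_le Lp_spaceD assms)
qed

lemma Lp_space_diff:
  assumes "f \<in> Lp_space p" "g \<in> Lp_space p" "0 \<le> p"
  shows "(\<lambda>x. f x - g x) \<in> Lp_space p"
  using Lp_space_add[OF assms(1) Lp_space_scaleR[OF assms(2), of "-1"] assms(3)] by simp

lemma Lp_space_zero: "(\<lambda>x. 0) \<in> Lp_space p"
  by (auto simp: Lp_space_def)

lemma Lp_mod_nonneg: "0 \<le> Lp_mod p f"
  by (simp add: Lp_mod_def)

lemma Lp_mod_add_le:
  assumes "f \<in> Lp_space p" "g \<in> Lp_space p" "0 \<le> p"
  shows "Lp_mod p (\<lambda>x. f x + g x) \<le> 2 powr p * (Lp_mod p f + Lp_mod p g)"
proof -
  have "Lp_mod p (\<lambda>x. f x + g x) \<le> (LINT x|lebesgue. 2 powr p * (norm (f x) powr p + norm (g x) powr p))"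
    unfolding Lp_mod_def
    by (intro integral_mono Lp_spaceD(2)[OF Lp_space_add] assms norm_add_powr_le)
      (auto intro!: Lp_spaceD assms)
  then show ?thesis
    using Lp_spaceD(2)[OF assms(1)] Lp_spaceD(2)[OF assms(2)] by (simp add: Lp_mod_def)
qed

lemma Lp_mod_minus_commute: "Lp_mod p (\<lambda>x. f x - g x) = Lp_mod p (\<lambda>x. g x - f x)"
  by (simp add: Lp_mod_def norm_minus_commute)

lemma Lp_mod_triangle:
  assumes "f \<in> Lp_space p" "g \<in> Lp_space p" "h \<in> Lp_space p" "0 \<le> p"
  shows "Lp_mod p (\<lambda>x. f x - h x) \<le> 2 powr p * (Lp_mod p (\<lambda>x. f x - g x) + Lp_mod p (\<lambda>x. g x - h x))"
  using Lp_mod_add_le[OF Lp_space_diff[OF assms(1,2,4)] Lp_space_diff[OF assms(2,3,4)] assms(4)] by simp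

text \<open>A form of Young's inequality: according to whether \<open>w \<le> \<epsilon> * h powr (1 / (p - 1))\<close> or not, the product is
  absorbed by the first or by the second term. The arbitrary weight \<open>\<epsilon>\<close> makes it a substitute for
  Hoelder's inequality in limits.\<close>

lemma young_eps:
  fixes h w \<epsilon> p :: real
  assumes "0 \<le> h" "0 \<le> w" "0 < \<epsilon>" "1 < p"
  shows "h * w \<le> \<epsilon> * h powr (p / (p - 1)) + \<epsilon> powr (1 - p) * w powr p"
proof (cases "w \<le> \<epsilon> * h powr (1 / (p - 1))")
  case True
  have "h * w \<le> h * (\<epsilon> * h powr (1 / (p - 1)))"
    using True assms by (intro mult_left_mono) auto
  also have "\<dots> = \<epsilon> * h powr (1 + 1 / (p - 1))"
    using assms powr_mult_base[of h "1 / (p-1)"] by simp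
  also have "1 + 1 / (p - 1) = p / (p - 1)" using assms by (simp add: field_simps)
  finally show ?thesis using assms by (simp add: add_increasing2)
next
  case False
  have "h powr (1 / (p - 1)) \<le> w / \<epsilon>" using False assms by (simp add: field_simps)
  then have "(h powr (1 / (p - 1))) powr (p - 1) \<le> (w / \<epsilon>) powr (p - 1)"
    using assms by (intro powr_mono2) auto
  then have "h \<le> (w / \<epsilon>) powr (p - 1)" using assms by (simp add: powr_powr)
  then have "h * w \<le> (w / \<epsilon>) powr (p - 1) * w" using assms by (intro mult_right_mono) auto
  also have "\<dots> = \<epsilon> powr (1 - p) * (w * w powr (p - 1))"
    using assms by (simp add: powr_divide powr_diff powr_minus field_simps)
  also have "\<dots> = \<epsilon> powr (1 - p) * w powr p" using assms by (simp add: powr_mult_base)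
  finally show ?thesis using assms by (simp add: add_increasing)
qed

lemma inner_young_eps:
  fixes h w :: "'b::real_inner"
  assumes "0 < \<epsilon>" "1 < p"
  shows "\<bar>h \<bullet> w\<bar> \<le> \<epsilon> * norm h powr (p / (p - 1)) + \<epsilon> powr (1 - p) * norm w powr p"
  using young_eps[of "norm h" "norm w" \<epsilon> p] assms Cauchy_Schwarz_ineq2[of h w] by simp

lemma integrable_inner_Lp:
  assumes "1 < p" "h \<in> Lp_space (p / (p - 1))" "w \<in> Lp_space p"
  shows "integrable lebesgue (\<lambda>x. h x \<bullet> w x)"
proof -
  note [measurable] = Lp_spaceD(1)[OF assms(2)] Lp_spaceD(1)[OF assms(3)]
  show ?thesis
  proof (rule Bochner_Integration.integrable_bound)
    show "integrable lebesgue (\<lambda>x. norm (h x) powr (p / (p - 1)) + norm (w x) powr p)"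
      by (intro Bochner_Integration.integrable_add Lp_spaceD(2) assms)
    show "AE x in lebesgue. norm (h x \<bullet> w x) \<le> norm (norm (h x) powr (p / (p - 1)) + norm (w x) powr p)"
      using inner_young_eps[of 1 p] assms(1) by (intro AE_I2) simp
  qed measurable
qed

lemma abs_integral_inner_Lp:
  assumes "1 < p" "h \<in> Lp_space (p / (p - 1))" "w \<in> Lp_space p" "0 < \<epsilon>"
  shows "\<bar>LINT x|lebesgue. h x \<bullet> w x\<bar> \<le> \<epsilon> * Lp_mod (p / (p - 1)) h + \<epsilon> powr (1 - p) * Lp_mod p w"
proof -
  have "\<bar>LINT x|lebesgue. h x \<bullet> w x\<bar> \<le> (LINT x|lebesgue. \<bar>h x \<bullet> w x\<bar>)"
    by simp
  also have "\<dots> \<le> (LINT x|lebesgue. \<epsilon> * norm (h x) powr (p / (p - 1)) + \<epsilon> powr (1 - p) * norm (w x) powr p)"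
    by (intro integral_mono inner_young_eps assms)
      (auto intro!: integrable_inner_Lp[OF assms(1-3)] Lp_spaceD assms)
  also have "\<dots> = \<epsilon> * Lp_mod (p / (p - 1)) h + \<epsilon> powr (1 - p) * Lp_mod p w"
    using Lp_spaceD(2)[OF assms(2)] Lp_spaceD(2)[OF assms(3)] by (simp add: Lp_mod_def)
  finally show ?thesis .
qed

text \<open>Continuity on \<open>L\<^sup>p\<close> of the functionals given by elements of the dual space.\<close>

lemma tendsto_integral_inner_Lp:
  assumes "1 < p" "h \<in> Lp_space (p / (p - 1))" "\<And>n. w n \<in> Lp_space p" "v \<in> Lp_space p"
    and lim: "(\<lambda>n. Lp_mod p (\<lambda>x. w n x - v x)) \<longlonglongrightarrow> 0"
  shows "(\<lambda>n. LINT x|lebesgue. h x \<bullet> w n x) \<longlonglongrightarrow> (LINT x|lebesgue. h x \<bullet> v x)"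
proof (rule LIMSEQ_I)
  fix e :: real assume e: "0 < e"
  \<comment> \<open>The first term of Young's inequality is then less than \<open>e / 2\<close>; the second one tends to zero.\<close>
  define \<epsilon> where "\<epsilon> = e / (2 * (Lp_mod (p / (p - 1)) h + 1))"
  have \<epsilon>: "0 < \<epsilon>" using e Lp_mod_nonneg[of "p / (p - 1)" h] by (simp add: \<epsilon>_def)
  have \<epsilon>2: "\<epsilon> * Lp_mod (p / (p - 1)) h < e / 2"
  proof -
    have "\<epsilon> * Lp_mod (p / (p - 1)) h < \<epsilon> * (Lp_mod (p / (p - 1)) h + 1)"
      using \<epsilon> by simp
    also have "\<dots> = e / 2" using Lp_mod_nonneg[of "p / (p - 1)" h] by (auto simp: \<epsilon>_def field_simps)
    finally show ?thesis .
  qed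
  have "0 < e / 2 / \<epsilon> powr (1 - p)" using e \<epsilon> by simp
  from LIMSEQ_D[OF lim this] obtain N where
    N: "\<And>n. n \<ge> N \<Longrightarrow> Lp_mod p (\<lambda>x. w n x - v x) < e / 2 / \<epsilon> powr (1 - p)"
    unfolding diff_0_right real_norm_def abs_of_nonneg[OF Lp_mod_nonneg] by blast
  show "\<exists>N. \<forall>n\<ge>N. norm ((LINT x|lebesgue. h x \<bullet> w n x) - (LINT x|lebesgue. h x \<bullet> v x)) < e"
  proof (intro exI allI impI)
    fix n assume n: "N \<le> n"
    have "(LINT x|lebesgue. h x \<bullet> w n x) - (LINT x|lebesgue. h x \<bullet> v x)
        = (LINT x|lebesgue. h x \<bullet> (w n x - v x))"
      by (simp add: inner_diff_right integrable_inner_Lp[OF assms(1,2)] assms)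
    also have "\<bar>\<dots>\<bar> \<le> \<epsilon> * Lp_mod (p / (p - 1)) h + \<epsilon> powr (1 - p) * Lp_mod p (\<lambda>x. w n x - v x)"
      by (intro abs_integral_inner_Lp assms Lp_space_diff \<epsilon>) (use assms(1) in auto)
    also have "\<dots> < e"
      using \<epsilon>2 N[OF n] \<epsilon> by (simp add: field_simps)
    finally show "norm ((LINT x|lebesgue. h x \<bullet> w n x) - (LINT x|lebesgue. h x \<bullet> v x)) < e"
      by simp
  qed
qed

section \<open>Uniform convexity and completeness\<close>


lemma powr_MVT:
  fixes a b p :: real
  assumes "0 \<le> a" "a < b" "0 < p"
  obtains z where "a < z" "z < b" "b powr p - a powr p = (b - a) * (p * z powr (p - 1))"
proof -
  have der: "((\<lambda>x. x powr p) has_real_derivative (p * x powr (p - 1))) (at x)" if "0 < x" for x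
    using has_real_derivative_powr[OF that, of p] .
  have "continuous_on {a..b} (\<lambda>x. x powr p)"
    using assms by (intro continuous_on_powr') (auto intro!: continuous_intros)
  moreover have "(\<lambda>x. x powr p) differentiable (at x)" if "a < x" for x
    using der[of x] that assms by (auto simp: real_differentiable_def)
  ultimately obtain l z where z: "a < z" "z < b" "DERIV (\<lambda>x. x powr p) z :> l"
      "b powr p - a powr p = (b - a) * l"
    using MVT[of a b "\<lambda>x. x powr p"] assms by blast
  moreover have "l = p * z powr (p - 1)"
    using DERIV_unique[OF z(3) der] z assms by simp
  ultimately show ?thesis using that by blast
qed

text \<open>The mean value theorem on each half of the interval, together with the strict monotonicity of
  the derivative of \<open>x\<^sup>p\<close>.\<close>

lemma powr_midpoint_less:
  fixes s t :: real
  assumes "1 < p" "0 \<le> s" "s < t"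
  shows "((s + t) / 2) powr p < (s powr p + t powr p) / 2"
proof -
  let ?m = "(s + t) / 2"
  obtain y where y: "s < y" "y < ?m" "?m powr p - s powr p = (?m - s) * (p * y powr (p - 1))"
    by (rule powr_MVT[of s ?m p]) (use assms in auto)
  obtain z where z: "?m < z" "z < t" "t powr p - ?m powr p = (t - ?m) * (p * z powr (p - 1))"
    by (rule powr_MVT[of ?m t p]) (use assms in auto)
  have "y powr (p - 1) < z powr (p - 1)"
    using y z assms by (intro powr_less_mono2) auto
  then have "(t - s) / 2 * (p * y powr (p - 1)) < (t - s) / 2 * (p * z powr (p - 1))"
    using assms by (intro mult_strict_left_mono) auto
  moreover have "?m - s = (t - s) / 2" "t - ?m = (t - s) / 2" by (auto simp: field_simps)
  ultimately have "?m powr p - s powr p < t powr p - ?m powr p" using y(3) z(3) by metis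
  then show ?thesis by (simp add: less_divide_eq_numeral1)
qed

text \<open>If the norms agree, the parallelogram identity gives strictness; otherwise the strict convexity
  of \<open>x\<^sup>p\<close> does.\<close>

lemma norm_powr_midpoint_less:
  fixes a b :: "'b::euclidean_space"
  assumes "1 < p" "a \<noteq> b"
  shows "norm ((1/2) *\<^sub>R (a + b)) powr p < (norm a powr p + norm b powr p) / 2"
proof (cases "norm a = norm b")
  case True
  have "(norm (a + b))\<^sup>2 + (norm (a - b))\<^sup>2 = 2 * (norm a)\<^sup>2 + 2 * (norm b)\<^sup>2"
    by (simp add: power2_norm_eq_inner inner_simps inner_commute)
  moreover have "0 < (norm (a - b))\<^sup>2" using assms(2) by (metis norm_eq_zero right_minus_eq zero_less_power2)
  ultimately have "(norm (a + b))\<^sup>2 < 2 * (norm a)\<^sup>2 + 2 * (norm b)\<^sup>2" by linarith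
  then have "(norm (a + b))\<^sup>2 < (2 * norm a)\<^sup>2" by (simp add: power_mult_distrib True)
  then have "norm (a + b) < 2 * norm a" by (rule power_less_imp_less_base) simp
  then have "norm ((1/2) *\<^sub>R (a + b)) powr p < norm a powr p"
    using assms by (intro powr_less_mono2) auto
  then show ?thesis using True by simp
next
  case False
  have "norm ((1/2) *\<^sub>R (a + b)) powr p \<le> ((norm a + norm b) / 2) powr p"
    using assms norm_triangle_ineq[of a b] by (intro powr_mono2) auto
  also have "\<dots> < (norm a powr p + norm b powr p) / 2"
    using False powr_midpoint_less[of p "norm a" "norm b"] powr_midpoint_less[of p "norm b" "norm a"] assms
    by (cases "norm a < norm b") (auto simp: add.commute)
  finally show ?thesis .
qed

lemma norm_powr_midpoint_le:
  fixes a b :: "'b::euclidean_space"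
  assumes "1 < p"
  shows "norm ((1/2) *\<^sub>R (a + b)) powr p \<le> (norm a powr p + norm b powr p) / 2"
  using norm_powr_midpoint_less[OF assms, of a b]
  by (cases "a = b") (auto simp: scaleR_2[symmetric])

text \<open>By homogeneity it suffices to consider \<open>|a|\<^sup>p + |b|\<^sup>p = 1\<close>, where strict convexity becomes
  uniform by compactness.\<close>

lemma norm_powr_uniform_convex:
  assumes "1 < p" "0 < \<epsilon>"
  obtains C :: real where "0 < C" "\<And>a b::'b::euclidean_space.
    norm (a - b) powr p \<le> \<epsilon> * (norm a powr p + norm b powr p)
      + C * ((norm a powr p + norm b powr p) / 2 - norm ((1/2) *\<^sub>R (a + b)) powr p)"
proof -
  define T where "T = (\<lambda>z::'b \<times> 'b. norm (fst z) powr p + norm (snd z) powr p)"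
  define gap where "gap = (\<lambda>z::'b \<times> 'b. T z / 2 - norm ((1/2) *\<^sub>R (fst z + snd z)) powr p)"
  define S where "S = {z. T z = 1} \<inter> {z. \<epsilon> \<le> norm (fst z - snd z) powr p}"
  have p0: "0 < p" using assms by simp
  have cont: "continuous_on UNIV T" "continuous_on UNIV gap"
    "continuous_on UNIV (\<lambda>z::'b\<times>'b. norm (fst z - snd z) powr p)"
    unfolding gap_def T_def using p0 by (auto intro!: continuous_intros continuous_on_powr')
  have Tscale: "T (c *\<^sub>R z) = c powr p * T z" "gap (c *\<^sub>R z) = c powr p * gap z"
     "norm (fst (c *\<^sub>R z) - snd (c *\<^sub>R z)) powr p = c powr p * norm (fst z - snd z) powr p" if "0 < c" for c z
  proof -
    have *: "norm (c *\<^sub>R x) powr p = c powr p * norm x powr p" for x :: 'b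
      using that by (simp add: powr_mult)
    show 1: "T (c *\<^sub>R z) = c powr p * T z" by (simp only: T_def fst_scaleR snd_scaleR * distrib_left)
    show "gap (c *\<^sub>R z) = c powr p * gap z"
      unfolding gap_def 1
      using *[of "(1/2) *\<^sub>R (fst z + snd z)"]
      by (simp add: algebra_simps scaleR_left_commute)
    show "norm (fst (c *\<^sub>R z) - snd (c *\<^sub>R z)) powr p = c powr p * norm (fst z - snd z) powr p"
      using *[of "fst z - snd z"] by (simp add: scaleR_diff_right)
  qed
  have "closed S" unfolding S_def
    by (intro closed_Int closed_Collect_eq closed_Collect_le cont continuous_on_const)
  moreover have "bounded S"
  proof -
    have "norm z \<le> 2" if "z \<in> S" for z
    proof -
      have "norm (fst z) powr p \<le> 1 powr p" "norm (snd z) powr p \<le> 1 powr p"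
        using that powr_ge_zero[of "norm (fst z)" p] powr_ge_zero[of "norm (snd z)" p]
        unfolding S_def T_def powr_one_eq_one Int_iff mem_Collect_eq by linarith+
      then have "norm (fst z) \<le> 1" "norm (snd z) \<le> 1"
        using powr_less_mono2[OF p0, of 1] by (auto simp: not_less[symmetric])
      then show ?thesis using norm_Pair_le[of "fst z" "snd z"] by simp
    qed
    then show ?thesis unfolding bounded_iff by blast
  qed
  ultimately have "compact S" by (simp add: compact_eq_bounded_closed)
  have gap_pos: "0 < gap z" if "z \<in> S" for z
  proof -
    have "fst z \<noteq> snd z" using that assms by (auto simp: S_def)
    from norm_powr_midpoint_less[OF assms(1) this] show ?thesis by (simp add: gap_def T_def)
  qed
  have "\<exists>\<delta>>0. \<forall>z\<in>S. \<delta> \<le> gap z"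
  proof (cases "S = {}")
    case True then show ?thesis by (intro exI[of _ 1]) auto
  next
    case False
    obtain z0 where "z0 \<in> S" "\<forall>z\<in>S. gap z0 \<le> gap z"
      using continuous_attains_inf[OF \<open>compact S\<close> False continuous_on_subset[OF cont(2)]] by auto
    then show ?thesis using gap_pos by blast
  qed
  then obtain \<delta> where \<delta>: "0 < \<delta>" "\<And>z. z \<in> S \<Longrightarrow> \<delta> \<le> gap z" by auto
  show ?thesis
  proof (rule that[of "2 powr p / \<delta>"])
    show "0 < 2 powr p / \<delta>" using \<delta> by simp
    fix a b :: 'b
    let ?z = "(a, b)"
    have gap0: "0 \<le> gap ?z" using norm_powr_midpoint_le[OF assms(1), of a b] by (simp add: gap_def T_def)
    have T0: "0 \<le> T ?z" by (simp add: T_def)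
    have "norm (a - b) powr p \<le> \<epsilon> * T ?z + 2 powr p / \<delta> * gap ?z"
    proof (cases "norm (a - b) powr p \<le> \<epsilon> * T ?z")
      case True then show ?thesis using gap0 \<delta> by (simp add: add_increasing2)
    next
      case False
      have "T ?z \<noteq> 0"
      proof
        assume "T ?z = 0"
        then have "a = 0" "b = 0" using add_nonneg_eq_0_iff[of "norm a powr p" "norm b powr p"] by (simp_all add: T_def)
        then show False using False by (simp add: T_def)
      qed
      then have Tpos: "0 < T ?z" using T0 by simp
      \<comment> \<open>The scaling that normalises \<open>T\<close> to \<open>1\<close>.\<close>
      define c where "c = (1 / T ?z) powr (1 / p)"
      have c: "0 < c" "c powr p * T ?z = 1" using Tpos p0 by (simp_all add: c_def powr_powr)
      have "c *\<^sub>R ?z \<in> S"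
        unfolding S_def mem_Collect_eq Int_iff Tscale[OF c(1)]
      proof
        have "\<epsilon> * T ?z \<le> norm (a - b) powr p" using False by simp
        then have "c powr p * (\<epsilon> * T ?z) \<le> c powr p * norm (a - b) powr p" by (intro mult_left_mono) auto
        also have "c powr p * (\<epsilon> * T ?z) = \<epsilon>" using c(2) by (simp add: algebra_simps)
        finally show "\<epsilon> \<le> c powr p * norm (fst ?z - snd ?z) powr p" by simp
      qed (rule c(2))
      from \<delta>(2)[OF this] have "\<delta> \<le> c powr p * gap ?z" by (simp only: Tscale[OF c(1)])
      then have "\<delta> * T ?z \<le> (c powr p * gap ?z) * T ?z" using T0 by (rule mult_right_mono)
      also have "\<dots> = (c powr p * T ?z) * gap ?z" by (rule mult.assoc[THEN trans, OF trans[OF arg_cong[OF mult.commute, of "(*) _"] mult.assoc[symmetric]]])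
      also have "\<dots> = gap ?z" by (simp only: c(2) mult_1)
      finally have 1: "T ?z \<le> gap ?z / \<delta>" using \<delta> by (simp add: field_simps)
      have "norm (a - b) powr p \<le> 2 powr p * T ?z"
        using norm_add_powr_le[of p a "-b"] p0 by (simp add: T_def)
      also have "\<dots> \<le> 2 powr p * (gap ?z / \<delta>)" by (intro mult_left_mono 1) auto
      finally show ?thesis using assms T0 by (simp add: add_increasing)
    qed
    then show "norm (a - b) powr p \<le> \<epsilon> * (norm a powr p + norm b powr p)
      + 2 powr p / \<delta> * ((norm a powr p + norm b powr p) / 2 - norm ((1/2) *\<^sub>R (a + b)) powr p)"
      by (simp add: T_def gap_def)
  qed
qed

text \<open>Two functions whose modulars are close to \<open>D\<close> are close to each other if their midpoint does
  not have a smaller modular.\<close>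

lemma Lp_uniform_convex:
  assumes "1 < p" "0 \<le> D" "0 < e"
  obtains \<eta> :: real where "0 < \<eta>"
    "\<And>u v :: real^'n \<Rightarrow> 'b::euclidean_space. \<lbrakk>u \<in> Lp_space p; v \<in> Lp_space p; Lp_mod p u \<le> D + \<eta>;
       Lp_mod p v \<le> D + \<eta>; D - \<eta> \<le> Lp_mod p (\<lambda>x. (1/2) *\<^sub>R (u x + v x))\<rbrakk>
      \<Longrightarrow> Lp_mod p (\<lambda>x. u x - v x) \<le> e"
proof -
  \<comment> \<open>Each of the two terms of the pointwise estimate contributes at most \<open>e / 2\<close>.\<close>
  define \<epsilon> where "\<epsilon> = e / (4 * (D + 1))"
  have \<epsilon>: "0 < \<epsilon>" using assms by (simp add: \<epsilon>_def)
  obtain C where C: "0 < C" "\<And>a b::'b. norm (a - b) powr p \<le> \<epsilon> * (norm a powr p + norm b powr p)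
      + C * ((norm a powr p + norm b powr p) / 2 - norm ((1/2) *\<^sub>R (a + b)) powr p)"
    using norm_powr_uniform_convex[OF assms(1) \<epsilon>] by blast
  define \<eta> where "\<eta> = min 1 (e / (4 * C))"
  have \<eta>: "0 < \<eta>" "\<eta> \<le> 1" "C * (2 * \<eta>) \<le> e / 2" using assms C(1) by (auto simp: \<eta>_def min_def field_simps)
  show ?thesis
  proof (rule that[OF \<eta>(1)])
    fix u v :: "real^'n \<Rightarrow> 'b"
    let ?m = "\<lambda>x. (1/2) *\<^sub>R (u x + v x)"
    assume uv: "u \<in> Lp_space p" "v \<in> Lp_space p" and
      bd: "Lp_mod p u \<le> D + \<eta>" "Lp_mod p v \<le> D + \<eta>" "D - \<eta> \<le> Lp_mod p ?m"
    have m: "?m \<in> Lp_space p" using uv assms by (intro Lp_space_scaleR Lp_space_add) auto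
    note int = Lp_spaceD(2)[OF uv(1)] Lp_spaceD(2)[OF uv(2)] Lp_spaceD(2)[OF m]
    have "Lp_mod p (\<lambda>x. u x - v x) \<le> (LINT x|lebesgue. \<epsilon> * (norm (u x) powr p + norm (v x) powr p)
      + C * ((norm (u x) powr p + norm (v x) powr p) / 2 - norm (?m x) powr p))"
      unfolding Lp_mod_def using assms uv
      by (intro integral_mono C(2) Lp_spaceD(2)[OF Lp_space_diff] Bochner_Integration.integrable_add
        integrable_mult_right Bochner_Integration.integrable_diff integrable_divide int) auto
    also have "\<dots> = \<epsilon> * (Lp_mod p u + Lp_mod p v) + C * ((Lp_mod p u + Lp_mod p v) / 2 - Lp_mod p ?m)"
      unfolding Lp_mod_def using int by simp
    also have "\<dots> \<le> \<epsilon> * (2 * (D + 1)) + C * (2 * \<eta>)"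
    proof -
      have "Lp_mod p u + Lp_mod p v \<le> 2 * (D + 1)"
        "(Lp_mod p u + Lp_mod p v) / 2 - Lp_mod p ?m \<le> 2 * \<eta>"
        using bd \<eta>(2) by (auto simp: field_simps)
      then show ?thesis using \<epsilon> C(1) by (intro add_mono mult_left_mono) auto
    qed
    also have "\<dots> \<le> e / 2 + e / 2"
      using \<eta>(3) assms(2) by (intro add_mono) (auto simp: \<epsilon>_def field_simps)
    finally show "Lp_mod p (\<lambda>x. u x - v x) \<le> e" by simp
  qed
qed

lemma Lp_mod_eq_nn_integral:
  assumes "f \<in> Lp_space p"
  shows "(\<integral>\<^sup>+x. ennreal (norm (f x) powr p) \<partial>lebesgue) = ennreal (Lp_mod p f)"
  unfolding Lp_mod_def by (rule nn_integral_eq_integral) (use Lp_spaceD[OF assms] in auto)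

text \<open>The sum over \<open>k\<close> of \<open>(2\<^sup>k |w\<^sub>k\<^sub>+\<^sub>1 - w\<^sub>k|)\<^sup>p\<close> has finite integral. Hence almost everywhere its terms
  are bounded, and the increments are dominated by a geometric series.\<close>

lemma Lp_AE_convergent_of_fast_Cauchy:
  fixes w :: "nat \<Rightarrow> real^'n \<Rightarrow> 'b::euclidean_space"
  assumes "1 < p" and w: "\<And>n. w n \<in> Lp_space p"
    and fast: "\<And>k. Lp_mod p (\<lambda>x. w (Suc k) x - w k x) \<le> ((1/4) ^ k) powr p"
  shows "AE x in lebesgue. convergent (\<lambda>k. w k x)"
proof -
  note [measurable] = Lp_spaceD(1)[OF w]
  define d where "d = (\<lambda>k x. w (Suc k) x - w k x)"
  have d: "d k \<in> Lp_space p" for k unfolding d_def using assms by (intro Lp_space_diff) auto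
  note [measurable] = Lp_spaceD(1)[OF d]
  have p0: "0 < p" using assms by simp
  define q where "q = (1/2::real) powr p"
  have q: "0 < q" "q < 1" unfolding q_def using p0 powr_less_mono2[of p "1/2" 1] by auto
  have qk: "(2 ^ k) powr p * ((1/4::real) ^ k) powr p = q ^ k" for k
  proof -
    have "(2 ^ k) powr p * ((1/4::real) ^ k) powr p = ((1/2) ^ k) powr p"
      by (simp add: powr_mult[symmetric] power_mult_distrib[symmetric])
    also have "\<dots> = q ^ k"
      by (simp add: q_def powr_realpow[symmetric] powr_powr mult.commute)
    finally show ?thesis .
  qed
  have "(\<integral>\<^sup>+x. (\<Sum>k. ennreal ((2 ^ k * norm (d k x)) powr p)) \<partial>lebesgue)
      = (\<Sum>k. (\<integral>\<^sup>+x. ennreal ((2 ^ k * norm (d k x)) powr p) \<partial>lebesgue))"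
    by (rule nn_integral_suminf) measurable
  also have "\<dots> \<le> (\<Sum>k. ennreal (q ^ k))"
  proof (rule suminf_le)
    fix k
    have "(\<integral>\<^sup>+x. ennreal ((2 ^ k * norm (d k x)) powr p) \<partial>lebesgue)
        = ennreal ((2 ^ k) powr p) * (\<integral>\<^sup>+x. ennreal (norm (d k x) powr p) \<partial>lebesgue)"
      by (subst nn_integral_cmult[symmetric]) (simp_all add: powr_mult ennreal_mult)
    also have "\<dots> = ennreal ((2 ^ k) powr p * Lp_mod p (d k))"
      by (simp add: Lp_mod_eq_nn_integral[OF d] ennreal_mult')
    also have "\<dots> \<le> ennreal ((2 ^ k) powr p * ((1/4) ^ k) powr p)"
      using fast[of k] by (intro ennreal_leI mult_left_mono) (auto simp: d_def)
    also have "\<dots> = ennreal (q ^ k)" by (simp only: qk)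
    finally show "(\<integral>\<^sup>+x. ennreal ((2 ^ k * norm (d k x)) powr p) \<partial>lebesgue) \<le> ennreal (q ^ k)" .
  qed auto
  also have "\<dots> < \<infinity>"
  proof -
    have "(\<lambda>k. q ^ k) sums (1 / (1 - q))" using q by (intro geometric_sums) simp
    then have "(\<Sum>k. ennreal (q ^ k)) = ennreal (1 / (1 - q))"
      using q(1) by (intro suminf_ennreal_eq zero_le_power less_imp_le)
    then show ?thesis by (simp only: ennreal_less_top infinity_ennreal_def)
  qed
  finally have "(\<integral>\<^sup>+x. (\<Sum>k. ennreal ((2 ^ k * norm (d k x)) powr p)) \<partial>lebesgue) \<noteq> \<infinity>" by simp
  then have "AE x in lebesgue. (\<Sum>k. ennreal ((2 ^ k * norm (d k x)) powr p)) \<noteq> \<infinity>"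
    by (intro nn_integral_PInf_AE) auto
  then show ?thesis
  proof (rule eventually_mono)
    fix x assume fin: "(\<Sum>k. ennreal ((2 ^ k * norm (d k x)) powr p)) \<noteq> \<infinity>"
    define B where "B = enn2real (\<Sum>k. ennreal ((2 ^ k * norm (d k x)) powr p))"
    have "norm (d k x) \<le> B powr (1/p) * (1/2) ^ k" for k
    proof -
      have "(\<Sum>k\<in>{k}. ennreal ((2 ^ k * norm (d k x)) powr p)) \<le> (\<Sum>k. ennreal ((2 ^ k * norm (d k x)) powr p))"
        by (rule sum_le_suminf) (rule summableI, rule finite.intros, rule finite.intros, rule zero_le)
      also have "\<dots> = ennreal B" unfolding B_def
        using fin by (intro ennreal_enn2real[symmetric]) (simp only: infinity_ennreal_def less_top)
      finally have "ennreal ((2 ^ k * norm (d k x)) powr p) \<le> ennreal B" by simp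
      moreover have "0 \<le> B" unfolding B_def by (rule enn2real_nonneg)
      ultimately have "(2 ^ k * norm (d k x)) powr p \<le> B" by (simp only: ennreal_le_iff)
      then have "((2 ^ k * norm (d k x)) powr p) powr (1/p) \<le> B powr (1/p)"
        using p0 by (intro powr_mono2) auto
      then have *: "2 ^ k * norm (d k x) \<le> B powr (1/p)" using p0 unfolding powr_powr by simp
      have "norm (d k x) = (1/2)^k * (2 ^ k * norm (d k x))" by (simp add: power_divide)
      also have "\<dots> \<le> (1/2)^k * B powr (1/p)" by (intro mult_left_mono *) simp
      finally show ?thesis by (simp add: mult.commute)
    qed
    moreover have "summable (\<lambda>k. B powr (1/p) * (1/2::real) ^ k)"
      by (intro summable_mult summable_geometric) simp
    ultimately have "summable (\<lambda>k. d k x)"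
      by (rule summable_comparison_test'[where N=0, rotated])
    then have "convergent (\<lambda>n. \<Sum>k<n. d k x)" by (simp add: summable_iff_convergent)
    moreover have "(\<Sum>k<n. d k x) = w n x - w 0 x" for n
      unfolding d_def by (rule sum_lessThan_telescope)
    ultimately have "convergent (\<lambda>n. w n x - w 0 x)" by simp
    from convergent_add[OF this convergent_const[of "w 0 x"]]
    show "convergent (\<lambda>k. w k x)" by simp
  qed
qed

text \<open>A rapidly convergent subsequence has a pointwise limit, and Fatou's lemma turns the Cauchy
  property into convergence to that limit.\<close>

lemma Lp_complete:
  fixes w :: "nat \<Rightarrow> real^'n \<Rightarrow> 'b::euclidean_space"
  assumes p: "1 < p" and w: "\<And>n. w n \<in> Lp_space p"
    and cauchy: "\<And>e. 0 < e \<Longrightarrow> \<exists>N. \<forall>m\<ge>N. \<forall>n\<ge>N. Lp_mod p (\<lambda>x. w m x - w n x) \<le> e"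
  obtains v where "v \<in> Lp_space p" "(\<lambda>n. Lp_mod p (\<lambda>x. w n x - v x)) \<longlonglongrightarrow> 0"
proof -
  note [measurable] = Lp_spaceD(1)[OF w]
  have "\<exists>N. \<forall>k. \<forall>m\<ge>N k. \<forall>n\<ge>N k. Lp_mod p (\<lambda>x. w m x - w n x) \<le> ((1/4) ^ k) powr p"
    by (intro choice allI cauchy) simp
  then obtain N where N: "\<And>k m n. m \<ge> N k \<Longrightarrow> n \<ge> N k \<Longrightarrow> Lp_mod p (\<lambda>x. w m x - w n x) \<le> ((1/4) ^ k) powr p"
    by blast
  \<comment> \<open>Both \<open>r k\<close> and \<open>r (Suc k)\<close> are at least \<open>N k\<close>, and \<open>r\<close> tends to infinity.\<close>
  define r where "r k = k + (\<Sum>i\<le>k. N i)" for k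
  have rN: "N k \<le> r k" "N k \<le> r (Suc k)" for k
    using member_le_sum[of k "{..k}" N] by (auto simp: r_def)
  define v where "v x = lim (\<lambda>k. w (r k) x)" for x
  have [measurable]: "v \<in> borel_measurable lebesgue"
    unfolding v_def by (rule borel_measurable_lim_metric) simp
  have "AE x in lebesgue. convergent (\<lambda>k. w (r k) x)"
    using p w N rN by (intro Lp_AE_convergent_of_fast_Cauchy[of p "\<lambda>k. w (r k)"]) auto
  then have lim: "AE x in lebesgue. (\<lambda>k. w (r k) x) \<longlonglongrightarrow> v x"
    by eventually_elim (simp add: v_def convergent_LIMSEQ_iff)
  have fatou: "(\<integral>\<^sup>+x. ennreal (norm (w n x - v x) powr p) \<partial>lebesgue) \<le> ennreal e"
    if e: "0 < e" and M: "\<And>m n. m \<ge> M \<Longrightarrow> n \<ge> M \<Longrightarrow> Lp_mod p (\<lambda>x. w m x - w n x) \<le> e" and n: "n \<ge> M" for e M n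
  proof -
    have "(\<integral>\<^sup>+x. ennreal (norm (w n x - v x) powr p) \<partial>lebesgue)
        = (\<integral>\<^sup>+x. liminf (\<lambda>k. ennreal (norm (w n x - w (r k) x) powr p)) \<partial>lebesgue)"
    proof (intro nn_integral_cong_AE, use lim in eventually_elim)
      fix x assume "(\<lambda>k. w (r k) x) \<longlonglongrightarrow> v x"
      then have "(\<lambda>k. ennreal (norm (w n x - w (r k) x) powr p)) \<longlonglongrightarrow> ennreal (norm (w n x - v x) powr p)"
        using p by (intro tendsto_ennrealI tendsto_powr' tendsto_intros) auto
      then show "ennreal (norm (w n x - v x) powr p) = liminf (\<lambda>k. ennreal (norm (w n x - w (r k) x) powr p))"
        by (rule lim_imp_Liminf[symmetric, rotated]) simp
    qed
    also have "\<dots> \<le> liminf (\<lambda>k. \<integral>\<^sup>+x. ennreal (norm (w n x - w (r k) x) powr p) \<partial>lebesgue)"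
      by (rule nn_integral_liminf) measurable
    also have "\<dots> \<le> liminf (\<lambda>k. ennreal e)"
    proof (intro Liminf_mono)
      have "(\<integral>\<^sup>+x. ennreal (norm (w n x - w (r k) x) powr p) \<partial>lebesgue) \<le> ennreal e" if "k \<ge> M" for k
        using M[of n "r k"] that n p
        by (subst Lp_mod_eq_nn_integral) (auto intro!: Lp_space_diff w ennreal_leI simp: r_def)
      then show "\<forall>\<^sub>F k in sequentially. (\<integral>\<^sup>+x. ennreal (norm (w n x - w (r k) x) powr p) \<partial>lebesgue) \<le> ennreal e"
        by (auto simp: eventually_sequentially)
    qed
    finally show ?thesis by (simp add: Liminf_const)
  qed
  have diff: "(\<lambda>x. w n x - v x) \<in> Lp_space p \<and> Lp_mod p (\<lambda>x. w n x - v x) \<le> e"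
    if e: "0 < e" and M: "\<And>m n. m \<ge> M \<Longrightarrow> n \<ge> M \<Longrightarrow> Lp_mod p (\<lambda>x. w m x - w n x) \<le> e" and n: "n \<ge> M" for e M n
  proof -
    have fin: "(\<integral>\<^sup>+x. ennreal (norm (w n x - v x) powr p) \<partial>lebesgue) \<le> ennreal e" by (rule fatou) fact+
    have L: "(\<lambda>x. w n x - v x) \<in> Lp_space p"
      using fin by (auto simp: Lp_space_def intro!: integrableI_bounded le_less_trans[OF fin])
    have "ennreal (Lp_mod p (\<lambda>x. w n x - v x)) \<le> ennreal e" using fin by (simp only: Lp_mod_eq_nn_integral[OF L])
    then show ?thesis using L e by simp
  qed
  show ?thesis
  proof (rule that[of v])
    obtain M where "\<forall>m\<ge>M. \<forall>n\<ge>M. Lp_mod p (\<lambda>x. w m x - w n x) \<le> 1" using cauchy[of 1] by auto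
    then have "(\<lambda>x. w M x - v x) \<in> Lp_space p" using diff[of 1 M M] by auto
    from Lp_space_diff[OF w[of M] this] show "v \<in> Lp_space p" using p by simp
    show "(\<lambda>n. Lp_mod p (\<lambda>x. w n x - v x)) \<longlonglongrightarrow> 0"
    proof (rule LIMSEQ_I)
      fix e :: real assume e: "0 < e"
      then obtain M where "\<forall>m\<ge>M. \<forall>n\<ge>M. Lp_mod p (\<lambda>x. w m x - w n x) \<le> e/2" using cauchy[of "e/2"] by auto
      then have "\<And>n. n \<ge> M \<Longrightarrow> Lp_mod p (\<lambda>x. w n x - v x) \<le> e/2" using diff[of "e/2" M] e by auto
      then show "\<exists>no. \<forall>n\<ge>no. norm (Lp_mod p (\<lambda>x. w n x - v x) - 0) < e"
        using e unfolding diff_0_right real_norm_def abs_of_nonneg[OF Lp_mod_nonneg]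
        by (intro exI[of _ M]) force
    qed
  qed
qed

section \<open>Monotone variational inequalities in Lebesgue spaces\<close>

text \<open>The simplex lives in a function space, so that its dimension may depend on the finite set
  \<open>I\<close>; compactness comes from the product topology.\<close>

lemma compact_simplex:
  fixes I :: "'i set"
  assumes "finite I"
  shows "compact {l :: 'i \<Rightarrow> real. (\<forall>i. l i \<in> (if i \<in> I then {0..1} else {0})) \<and> sum l I = 1}"
proof -
  let ?P = "PiE UNIV (\<lambda>i. if i \<in> I then {0..1::real} else {0})"
  have "compactin (product_topology (\<lambda>_::'i. euclidean) UNIV) ?P"
    by (subst compactin_PiE) auto
  then have "compact ?P" by (simp add: euclidean_product_topology)
  moreover have "closed {l :: 'i \<Rightarrow> real. sum l I = 1}"
    by (intro closed_Collect_eq continuous_on_sum continuous_on_const continuous_on_product_coordinates)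
  ultimately have "compact (?P \<inter> {l. sum l I = 1})" by (rule compact_Int_closed)
  moreover have "?P \<inter> {l. sum l I = 1}
      = {l. (\<forall>i. l i \<in> (if i \<in> I then {0..1} else {0})) \<and> sum l I = 1}"
    by (auto simp: PiE_def Pi_def extensional_def)
  ultimately show ?thesis by simp
qed

lemma power2_min_add_le:
  fixes a b :: real
  shows "(min 0 (a + b))\<^sup>2 \<le> (min 0 a + b)\<^sup>2"
proof (cases "a + b < 0 \<and> 0 \<le> a")
  case True
  then have "\<bar>a + b\<bar> \<le> \<bar>b\<bar>" by auto
  then have "(a + b)\<^sup>2 \<le> b\<^sup>2" by (simp only: abs_le_square_iff)
  then show ?thesis using True by auto
next
  case False then show ?thesis by (auto simp: min_def)
qed

text \<open>Minimise over the simplex the sum \<open>f\<close> of the squared negative parts of \<open>M l\<close>. If the vector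
  \<open>w\<close> of negative parts at a minimum \<open>l\<close> were non-zero, moving from \<open>l\<close> towards \<open>\<mu> = w / \<Sum>w\<close>
  could not decrease \<open>f\<close>. The sign of the derivative in this direction says
  \<open>w\<^sup>T M w \<le> - (\<Sum>w) |w|\<^sup>2 < 0\<close>, whereas \<open>w\<^sup>T M w \<ge> 0\<close> by the assumption on \<open>M + M\<^sup>T\<close>.\<close>

lemma exists_simplex_nonneg:
  fixes M :: "'i \<Rightarrow> 'i \<Rightarrow> real"
  assumes "finite I" "I \<noteq> {}" and M: "\<And>i j. i \<in> I \<Longrightarrow> j \<in> I \<Longrightarrow> 0 \<le> M i j + M j i"
  shows "\<exists>l. (\<forall>i\<in>I. 0 \<le> l i) \<and> sum l I = 1 \<and> (\<forall>i\<in>I. 0 \<le> (\<Sum>j\<in>I. M i j * l j))"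
proof -
  define P where "P = {l :: 'i \<Rightarrow> real. (\<forall>i. l i \<in> (if i \<in> I then {0..1} else {0})) \<and> sum l I = 1}"
  have PI: "l \<in> P" if "\<And>i. i \<in> I \<Longrightarrow> 0 \<le> l i" "\<And>i. i \<notin> I \<Longrightarrow> l i = 0" "sum l I = 1" for l
    using that member_le_sum[of _ I l] assms(1) by (auto simp: P_def)
  have PD: "0 \<le> l i" "i \<notin> I \<Longrightarrow> l i = 0" "sum l I = 1" if "l \<in> P" for l i
    using that by (auto simp: P_def split: if_splits)
  define r where "r i l = (\<Sum>j\<in>I. M i j * l j)" for i and l :: "'i \<Rightarrow> real"
  define f where "f l = (\<Sum>i\<in>I. (min 0 (r i l))\<^sup>2)" for l
  obtain i0 where i0: "i0 \<in> I" using assms by auto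
  have "(\<lambda>i. if i = i0 then 1 else 0) \<in> P"
    using i0 assms(1) by (intro PI) auto
  then have "P \<noteq> {}" by auto
  moreover have "compact P" unfolding P_def by (rule compact_simplex[OF assms(1)])
  moreover have "continuous_on P f" unfolding f_def r_def
    by (intro continuous_intros continuous_on_subset[OF continuous_on_product_coordinates]) auto
  ultimately obtain l where l: "l \<in> P" "\<And>l'. l' \<in> P \<Longrightarrow> f l \<le> f l'"
    using continuous_attains_inf[of P f] by auto
  define w where "w i = (if i \<in> I then - min 0 (r i l) else 0)" for i
  have w0: "0 \<le> w i" for i by (simp add: w_def)
  have "sum w I = 0"
  proof (rule ccontr)
    assume "sum w I \<noteq> 0"
    then have W: "0 < sum w I" using w0 by (simp add: sum_nonneg less_le)
    define \<mu> where "\<mu> i = w i / sum w I" for i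
    have \<mu>: "0 \<le> \<mu> i" "i \<notin> I \<Longrightarrow> \<mu> i = 0" "sum \<mu> I = 1" for i
      using W w0 by (auto simp: \<mu>_def sum_divide_distrib[symmetric] w_def[of i] sum_nonneg)
    define b where "b i = r i \<mu> - r i l" for i
    \<comment> \<open>Minimality of \<open>l\<close> along the segment to \<open>\<mu>\<close>, divided by the parameter \<open>t\<close>.\<close>
    have key: "0 \<le> 2 * (\<Sum>i\<in>I. min 0 (r i l) * b i) + t * (\<Sum>i\<in>I. (b i)\<^sup>2)" if t: "0 < t" "t \<le> 1" for t
    proof -
      let ?l = "\<lambda>i. (1 - t) * l i + t * \<mu> i"
      have "?l \<in> P"
        using t PD[OF l(1)] \<mu> by (intro PI) (auto simp: sum.distrib sum_distrib_left[symmetric])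
      then have "f l \<le> f ?l" by (rule l)
      also have "\<dots> = (\<Sum>i\<in>I. (min 0 (r i l + t * b i))\<^sup>2)"
        unfolding f_def r_def b_def
        by (intro sum.cong refl arg_cong[where f="\<lambda>x. (min 0 x)\<^sup>2"])
          (simp add: algebra_simps sum.distrib sum_subtractf sum_distrib_left)
      also have "\<dots> \<le> (\<Sum>i\<in>I. (min 0 (r i l) + t * b i)\<^sup>2)"
        by (intro sum_mono power2_min_add_le)
      also have "\<dots> = f l + t * (2 * (\<Sum>i\<in>I. min 0 (r i l) * b i) + t * (\<Sum>i\<in>I. (b i)\<^sup>2))"
        unfolding f_def
        by (simp add: power2_sum sum.distrib sum_distrib_left power_mult_distrib algebra_simps power2_eq_square)
      finally have "0 \<le> t * (2 * (\<Sum>i\<in>I. min 0 (r i l) * b i) + t * (\<Sum>i\<in>I. (b i)\<^sup>2))" by simp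
      then show ?thesis using t by (simp add: zero_le_mult_iff)
    qed
    have nn: "0 \<le> (\<Sum>i\<in>I. min 0 (r i l) * b i)"
    proof (rule ccontr)
      let ?c = "- (\<Sum>i\<in>I. min 0 (r i l) * b i)" and ?B = "\<Sum>i\<in>I. (b i)\<^sup>2"
      assume "\<not> ?thesis"
      then have c: "0 < ?c" by simp
      have B: "0 \<le> ?B" by (intro sum_nonneg) simp
      \<comment> \<open>Small enough for the quadratic term not to compensate the linear one.\<close>
      define t where "t = min 1 (?c / (?B + 1))"
      have "0 < ?c / (?B + 1)" using c B by (intro divide_pos_pos) linarith+
      then have t: "0 < t" "t \<le> 1" by (simp_all add: t_def)
      have "t * ?B \<le> ?c / (?B + 1) * ?B" using B by (intro mult_right_mono) (auto simp: t_def)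
      also have "\<dots> \<le> ?c" using c B by (simp add: field_simps)
      finally show False using key[OF t] c by linarith
    qed
    have "(\<Sum>i\<in>I. min 0 (r i l) * b i) = (\<Sum>i\<in>I. - (w i * r i \<mu>) - (w i)\<^sup>2)"
      by (intro sum.cong refl) (auto simp: w_def b_def min_def power2_eq_square algebra_simps)
    also have "\<dots> = - (\<Sum>i\<in>I. w i * r i \<mu>) - (\<Sum>i\<in>I. (w i)\<^sup>2)"
      by (simp add: sum_subtractf sum_negf)
    finally have le: "(\<Sum>i\<in>I. w i * r i \<mu>) + (\<Sum>i\<in>I. (w i)\<^sup>2) \<le> 0" using nn by simp
    have "(\<Sum>i\<in>I. w i * r i \<mu>) = (\<Sum>i\<in>I. \<Sum>j\<in>I. w i * M i j * w j) / sum w I"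
      by (simp add: r_def \<mu>_def sum_divide_distrib sum_distrib_left mult.assoc)
    moreover have "0 \<le> (\<Sum>i\<in>I. \<Sum>j\<in>I. w i * M i j * w j)"
    proof -
      have sw: "(\<Sum>i\<in>I. \<Sum>j\<in>I. w i * M i j * w j) = (\<Sum>i\<in>I. \<Sum>j\<in>I. w j * M j i * w i)"
        by (rule sum.swap)
      have "2 * (\<Sum>i\<in>I. \<Sum>j\<in>I. w i * M i j * w j)
          = (\<Sum>i\<in>I. \<Sum>j\<in>I. w i * M i j * w j) + (\<Sum>i\<in>I. \<Sum>j\<in>I. w j * M j i * w i)"
        using sw by linarith
      also have "\<dots> = (\<Sum>i\<in>I. \<Sum>j\<in>I. w i * w j * (M i j + M j i))"
        by (simp add: sum.distrib algebra_simps)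
      also have "\<dots> \<ge> 0" by (intro sum_nonneg mult_nonneg_nonneg w0 M)
      finally show ?thesis by simp
    qed
    ultimately have "(\<Sum>i\<in>I. (w i)\<^sup>2) \<le> 0" using le W by (smt (verit) divide_nonneg_pos)
    then have "\<forall>i\<in>I. w i = 0" using assms(1) sum_nonneg_eq_0_iff[of I "\<lambda>i. (w i)\<^sup>2"]
      by (metis (no_types, lifting) antisym sum_nonneg zero_eq_power2 zero_le_power2)
    then show False using W by simp
  qed
  then have "\<forall>i\<in>I. w i = 0" using w0 assms(1) by (simp add: sum_nonneg_eq_0_iff)
  then have "0 \<le> r i l" if "i \<in> I" for i using that by (force simp: w_def min_def split: if_splits)
  then show ?thesis using PD[OF l(1)] by (intro exI[of _ l]) (auto simp: r_def)
qed

definition convex_on_maps :: "(real^'n \<Rightarrow> 'b::euclidean_space) set \<Rightarrow> bool" where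
  "convex_on_maps K \<longleftrightarrow>
     (\<forall>u\<in>K. \<forall>v\<in>K. \<forall>t\<in>{0..1}. (\<lambda>x. (1 - t) *\<^sub>R u x + t *\<^sub>R v x) \<in> K)"

definition Lp_closed :: "real \<Rightarrow> (real^'n \<Rightarrow> 'b::euclidean_space) set \<Rightarrow> bool" where
  "Lp_closed p K \<longleftrightarrow> (\<forall>w v. (\<forall>n. w n \<in> K) \<longrightarrow> v \<in> Lp_space p \<longrightarrow>
     (\<lambda>n. Lp_mod p (\<lambda>x. w n x - v x)) \<longlonglongrightarrow> 0 \<longrightarrow> v \<in> K)"

lemma convex_on_mapsD:
  "convex_on_maps K \<Longrightarrow> u \<in> K \<Longrightarrow> v \<in> K \<Longrightarrow> 0 \<le> t \<Longrightarrow> t \<le> 1 \<Longrightarrow> (\<lambda>x. (1 - t) *\<^sub>R u x + t *\<^sub>R v x) \<in> K"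
  by (auto simp: convex_on_maps_def)

lemma Lp_closedD:
  "Lp_closed p K \<Longrightarrow> (\<And>n. w n \<in> K) \<Longrightarrow> v \<in> Lp_space p \<Longrightarrow>
     (\<lambda>n. Lp_mod p (\<lambda>x. w n x - v x)) \<longlonglongrightarrow> 0 \<Longrightarrow> v \<in> K"
  by (auto simp: Lp_closed_def)

lemma convex_on_maps_midpoint:
  assumes "convex_on_maps K" "u \<in> K" "v \<in> K"
  shows "(\<lambda>x. (1/2) *\<^sub>R (u x + v x)) \<in> K"
  using convex_on_mapsD[OF assms, of "1/2"] by (simp add: scaleR_add_right)

lemma convex_on_maps_sum:
  assumes "convex_on_maps K" "finite I"
  shows "\<lbrakk>\<And>i. i \<in> I \<Longrightarrow> w i \<in> K; \<And>i. i \<in> I \<Longrightarrow> 0 \<le> l i; sum l I = 1\<rbrakk> \<Longrightarrow> (\<lambda>x. \<Sum>i\<in>I. l i *\<^sub>R w i x) \<in> K"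
  using assms(2)
proof (induction I arbitrary: l rule: finite_induct)
  case empty then show ?case by simp
next
  case (insert a I)
  show ?case
  proof (cases "l a = 1")
    case True
    then have "sum l I = 0" using insert by simp
    then have "\<forall>i\<in>I. l i = 0" using insert by (subst (asm) sum_nonneg_eq_0_iff) auto
    then show ?thesis using insert True by simp
  next
    case False
    have s: "sum l I = 1 - l a" using insert by simp
    moreover have "0 \<le> sum l I" using insert by (intro sum_nonneg) auto
    ultimately have la: "l a < 1" using False by simp
    have "(\<lambda>x. \<Sum>i\<in>I. (l i / (1 - l a)) *\<^sub>R w i x) \<in> K"
      using insert.prems la s by (intro insert.IH) (auto simp: sum_divide_distrib[symmetric])
    from convex_on_mapsD[OF assms(1) this insert.prems(1)[of a], of "l a"]
    have "(\<lambda>x. (1 - l a) *\<^sub>R (\<Sum>i\<in>I. (l i / (1 - l a)) *\<^sub>R w i x) + l a *\<^sub>R w a x) \<in> K"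
      using insert.prems la by auto
    moreover have "(1 - l a) *\<^sub>R (\<Sum>i\<in>I. (l i / (1 - l a)) *\<^sub>R w i x) = (\<Sum>i\<in>I. l i *\<^sub>R w i x)" for x
      using la by (simp add: scaleR_sum_right)
    ultimately show ?thesis using insert.hyps by (simp add: add.commute)
  qed
qed

text \<open>This replaces the weak compactness of bounded closed convex sets. Let \<open>D\<close> be the supremum of the
  minimal modulars \<open>d S\<close> of the finite intersections \<open>C S\<close>. Along an increasing sequence of finite
  sets \<open>T n\<close> with \<open>d (T n)\<close> tending to \<open>D\<close>, points \<open>z n \<in> C (T n)\<close> of modular close to \<open>D\<close> are
  Cauchy by uniform convexity, since their midpoints stay in the intersections. Adding one more set
  \<open>A i\<close> to all finite intersections yields almost minimal points close to \<open>z n\<close>, so the limit also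
  belongs to \<open>A i\<close>.\<close>

lemma Lp_finite_intersection_property:
  fixes K :: "(real^'n \<Rightarrow> 'b::euclidean_space) set" and A :: "'i \<Rightarrow> (real^'n \<Rightarrow> 'b) set"
  assumes p: "1 < p" and KL: "K \<subseteq> Lp_space p" and bdd: "\<And>u. u \<in> K \<Longrightarrow> Lp_mod p u \<le> B"
    and K: "convex_on_maps K" "Lp_closed p K"
    and A: "\<And>i. i \<in> I \<Longrightarrow> convex_on_maps (A i)" "\<And>i. i \<in> I \<Longrightarrow> Lp_closed p (A i)"
    and fip: "\<And>S. finite S \<Longrightarrow> S \<subseteq> I \<Longrightarrow> \<exists>u\<in>K. \<forall>i\<in>S. u \<in> A i"
  obtains z where "z \<in> K" "\<And>i. i \<in> I \<Longrightarrow> z \<in> A i"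
proof -
  define C where "C S = {u \<in> K. \<forall>i\<in>S. u \<in> A i}" for S
  define \<F> where "\<F> = {S. finite S \<and> S \<subseteq> I}"
  have CL: "u \<in> Lp_space p" if "u \<in> C S" for u S using that KL by (auto simp: C_def)
  have Cne: "C S \<noteq> {}" if "S \<in> \<F>" for S using fip[of S] that by (auto simp: C_def \<F>_def)
  define d where "d S = (INF u\<in>C S. Lp_mod p u)" for S
  have bb: "bdd_below (Lp_mod p ` C S)" for S
    using Lp_mod_nonneg by (intro bdd_belowI2[where m=0]) auto
  have d_le: "d S \<le> Lp_mod p u" if "u \<in> C S" for u S
    unfolding d_def by (rule cINF_lower[OF bb that])
  have dB: "d S \<le> B" if "S \<in> \<F>" for S
  proof -
    obtain u where "u \<in> C S" using Cne \<open>S \<in> \<F>\<close> by auto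
    then show ?thesis using d_le[of u S] bdd[of u] by (auto simp: C_def)
  qed
  have \<F>ne: "{} \<in> \<F>" by (simp add: \<F>_def)
  have d0: "0 \<le> d S" if "S \<in> \<F>" for S
    unfolding d_def by (rule cINF_greatest) (use Cne[OF that] Lp_mod_nonneg in auto)
  define D where "D = (SUP S\<in>\<F>. d S)"
  have ba: "bdd_above (d ` \<F>)" using dB by (intro bdd_aboveI2) auto
  have dD: "d S \<le> D" if "S \<in> \<F>" for S unfolding D_def by (rule cSUP_upper[OF that ba])
  have D0: "0 \<le> D" using d0[OF \<F>ne] dD[OF \<F>ne] by simp
  have approx: "\<exists>u\<in>C S. Lp_mod p u \<le> D + e" if "S \<in> \<F>" "0 < e" for S e
  proof -
    have "(INF u\<in>C S. Lp_mod p u) < D + e" using dD[OF that(1)] that(2) by (simp add: d_def)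
    then show ?thesis using cINF_less_iff[OF Cne[OF that(1)] bb] by (auto intro: less_imp_le)
  qed
  have "\<exists>S\<in>\<F>. D - 1 / real (Suc n) < d S" for n
    using less_cSUP_iff[of \<F> d "D - 1 / real (Suc n)"] \<F>ne ba by (auto simp: D_def)
  then obtain S where S: "\<And>n. S n \<in> \<F>" "\<And>n. D - 1 / real (Suc n) < d (S n)" by metis
  define T where "T n = (\<Union>k\<le>n. S k)" for n
  have T: "T n \<in> \<F>" for n using S(1) by (auto simp: T_def \<F>_def)
  have ST: "S k \<subseteq> T n" if "k \<le> n" for k n using that by (auto simp: T_def)
  have Canti: "C S' \<subseteq> C S''" if "S'' \<subseteq> S'" for S' S'' using that by (auto simp: C_def)
  \<comment> \<open>Elements of \<open>C (S N)\<close> of almost minimal modular are close, as their midpoint lies in \<open>C (S N)\<close>.\<close>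
  have close: "\<exists>N. \<forall>x\<in>C (S N). \<forall>y\<in>C (S N). Lp_mod p x \<le> D + 1 / real (Suc N) \<longrightarrow>
      Lp_mod p y \<le> D + 1 / real (Suc N) \<longrightarrow> Lp_mod p (\<lambda>t. x t - y t) \<le> e" if "0 < e" for e
  proof -
    obtain \<eta> :: real where \<eta>: "0 < \<eta>"
      "\<And>u v :: real^'n \<Rightarrow> 'b. \<lbrakk>u \<in> Lp_space p; v \<in> Lp_space p; Lp_mod p u \<le> D + \<eta>;
       Lp_mod p v \<le> D + \<eta>; D - \<eta> \<le> Lp_mod p (\<lambda>x. (1/2) *\<^sub>R (u x + v x))\<rbrakk>
      \<Longrightarrow> Lp_mod p (\<lambda>x. u x - v x) \<le> e"
      by (rule Lp_uniform_convex[OF p D0 \<open>0 < e\<close>]) blast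
    obtain N where N: "1 / real (Suc N) < \<eta>" using \<eta>(1) nat_approx_posE by blast
    show ?thesis
    proof (intro exI[of _ N] ballI impI)
      fix x y assume xy: "x \<in> C (S N)" "y \<in> C (S N)"
        "Lp_mod p x \<le> D + 1 / real (Suc N)" "Lp_mod p y \<le> D + 1 / real (Suc N)"
      have SI: "S N \<subseteq> I" using S(1)[of N] by (auto simp: \<F>_def)
      have "(\<lambda>t. (1/2) *\<^sub>R (x t + y t)) \<in> C (S N)"
        using xy(1,2) SI K(1) A(1) by (auto simp: C_def intro!: convex_on_maps_midpoint)
      from d_le[OF this] have "D - \<eta> \<le> Lp_mod p (\<lambda>t. (1/2) *\<^sub>R (x t + y t))"
        using S(2)[of N] N by linarith
      moreover have "Lp_mod p x \<le> D + \<eta>" "Lp_mod p y \<le> D + \<eta>" using xy N by linarith+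
      ultimately show "Lp_mod p (\<lambda>t. x t - y t) \<le> e"
        using \<eta>(2)[OF CL[OF xy(1)] CL[OF xy(2)]] by blast
    qed
  qed
  have suc_le: "1 / real (Suc n) \<le> 1 / real (Suc N)" if "N \<le> n" for n N
    using that by (intro divide_left_mono) auto
  have "\<exists>u\<in>C (T n). Lp_mod p u \<le> D + 1 / real (Suc n)" for n using T by (intro approx) auto
  then obtain z where z: "\<And>n. z n \<in> C (T n)" "\<And>n. Lp_mod p (z n) \<le> D + 1 / real (Suc n)" by metis
  have zS: "z n \<in> C (S N)" "Lp_mod p (z n) \<le> D + 1 / real (Suc N)" if "N \<le> n" for n N
    using z(1)[of n] Canti[OF ST[OF that]] z(2)[of n] suc_le[OF that] by auto
  obtain v where v: "v \<in> Lp_space p" "(\<lambda>n. Lp_mod p (\<lambda>x. z n x - v x)) \<longlonglongrightarrow> 0"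
  proof (rule Lp_complete[OF p CL[OF z(1)]])
    fix e :: real assume "0 < e"
    from close[OF this] zS show "\<exists>N. \<forall>m\<ge>N. \<forall>n\<ge>N. Lp_mod p (\<lambda>x. z m x - z n x) \<le> e" by meson
  qed
  have "v \<in> K" using z(1) by (intro Lp_closedD[OF K(2) _ v]) (auto simp: C_def)
  moreover have "v \<in> A i" if i: "i \<in> I" for i
  proof -
    have "\<exists>u\<in>C (insert i (T n)). Lp_mod p u \<le> D + 1 / real (Suc n)" for n
      using T[of n] i by (intro approx) (auto simp: \<F>_def)
    then obtain y where y: "\<And>n. y n \<in> C (insert i (T n))" "\<And>n. Lp_mod p (y n) \<le> D + 1 / real (Suc n)" by metis
    have yS: "y n \<in> C (S N)" "Lp_mod p (y n) \<le> D + 1 / real (Suc N)" if "N \<le> n" for n N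
      using y(1)[of n] Canti[of "S N" "insert i (T n)"] ST[OF that] y(2)[of n] suc_le[OF that] by auto
    have yz: "(\<lambda>n. Lp_mod p (\<lambda>x. y n x - z n x)) \<longlonglongrightarrow> 0"
    proof (rule LIMSEQ_I)
      fix e :: real assume e: "0 < e"
      obtain N where N: "\<forall>x\<in>C (S N). \<forall>y\<in>C (S N). Lp_mod p x \<le> D + 1 / real (Suc N) \<longrightarrow>
          Lp_mod p y \<le> D + 1 / real (Suc N) \<longrightarrow> Lp_mod p (\<lambda>t. x t - y t) \<le> e / 2"
        using close[OF half_gt_zero[OF e]] by (rule exE)
      have "Lp_mod p (\<lambda>x. y n x - z n x) < e" if "N \<le> n" for n
        using N[rule_format, OF yS(1) zS(1) yS(2) zS(2), OF that that that that] e by linarith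
      then show "\<exists>N. \<forall>n\<ge>N. norm (Lp_mod p (\<lambda>x. y n x - z n x) - 0) < e"
        unfolding diff_0_right real_norm_def abs_of_nonneg[OF Lp_mod_nonneg] by blast
    qed
    have "(\<lambda>n. 2 powr p * (Lp_mod p (\<lambda>x. y n x - z n x) + Lp_mod p (\<lambda>x. z n x - v x))) \<longlonglongrightarrow> 2 powr p * (0 + 0)"
      by (intro tendsto_intros yz v)
    then have lim: "(\<lambda>n. 2 powr p * (Lp_mod p (\<lambda>x. y n x - z n x) + Lp_mod p (\<lambda>x. z n x - v x))) \<longlonglongrightarrow> 0" by simp
    have tri: "Lp_mod p (\<lambda>x. y n x - v x) \<le> 2 powr p * (Lp_mod p (\<lambda>x. y n x - z n x) + Lp_mod p (\<lambda>x. z n x - v x))" for n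
      by (rule Lp_mod_triangle[OF CL[OF y(1)] CL[OF z(1)] v(1)]) (use p in linarith)
    have "(\<lambda>n. Lp_mod p (\<lambda>x. y n x - v x)) \<longlonglongrightarrow> 0"
      by (rule tendsto_sandwich[OF always_eventually always_eventually tendsto_const[of 0] lim])
        (rule allI, rule Lp_mod_nonneg, rule allI, rule tri)
    then show "v \<in> A i"
      using y(1) by (intro Lp_closedD[OF A(2)[OF i] _ v(1)]) (auto simp: C_def)
  qed
  ultimately show ?thesis by (rule that)
qed

lemma norm_powr_convex_comb:
  fixes a b :: "'b::real_normed_vector"
  assumes "1 \<le> p" "0 \<le> t" "t \<le> 1"
  shows "norm ((1 - t) *\<^sub>R a + t *\<^sub>R b) powr p \<le> (1 - t) * norm a powr p + t * norm b powr p"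
proof -
  have le: "t powr p \<le> t" if "0 \<le> t" "t \<le> 1" for t :: real
    using that assms(1) by (cases "t = 0") (auto intro: powr_le_one_le)
  have real: "((1 - t) * x + t * y) powr p \<le> (1 - t) * x powr p + t * y powr p" if "0 \<le> x" "0 \<le> y" for x y :: real
  proof (cases "x = 0 \<or> y = 0")
    case True
    then show ?thesis
      using le[of t] le[of "1 - t"] assms that by (auto simp: powr_mult intro!: mult_right_mono)
  next
    case False
    then show ?thesis
      using convex_onD[OF powr_convex[OF assms(1)], of t x y] assms that by auto
  qed
  have "norm ((1 - t) *\<^sub>R a + t *\<^sub>R b) powr p \<le> ((1 - t) * norm a + t * norm b) powr p"
    using assms norm_triangle_ineq[of "(1 - t) *\<^sub>R a" "t *\<^sub>R b"] by (intro powr_mono2) auto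
  also have "\<dots> \<le> (1 - t) * norm a powr p + t * norm b powr p" by (rule real) auto
  finally show ?thesis .
qed

lemma Lp_space_convex_comb:
  assumes "u \<in> Lp_space p" "v \<in> Lp_space p" "0 \<le> p"
  shows "(\<lambda>x. (1 - t) *\<^sub>R u x + t *\<^sub>R v x) \<in> Lp_space p"
  by (intro Lp_space_add Lp_space_scaleR assms)

lemma Lp_mod_convex_comb:
  assumes "u \<in> Lp_space p" "v \<in> Lp_space p" "1 \<le> p" "0 \<le> t" "t \<le> 1"
  shows "Lp_mod p (\<lambda>x. (1 - t) *\<^sub>R u x + t *\<^sub>R v x) \<le> (1 - t) * Lp_mod p u + t * Lp_mod p v"
proof -
  have "Lp_mod p (\<lambda>x. (1 - t) *\<^sub>R u x + t *\<^sub>R v x) \<le> (LINT x|lebesgue. (1 - t) * norm (u x) powr p + t * norm (v x) powr p)"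
    unfolding Lp_mod_def
    by (intro integral_mono norm_powr_convex_comb Lp_spaceD(2)[OF Lp_space_convex_comb] Bochner_Integration.integrable_add
        integrable_mult_right Lp_spaceD(2) assms) (use assms in auto)
  also have "\<dots> = (1 - t) * Lp_mod p u + t * Lp_mod p v"
    using Lp_spaceD(2)[OF assms(1)] Lp_spaceD(2)[OF assms(2)] by (simp add: Lp_mod_def)
  finally show ?thesis .
qed

lemma Lp_mod_scaleR: "Lp_mod p (\<lambda>x. c *\<^sub>R f x) = \<bar>c\<bar> powr p * Lp_mod p f"
  by (simp add: Lp_mod_def powr_mult)

text \<open>Lower semicontinuity of the modular: write \<open>v\<close> as the convex combination of \<open>w\<^sub>n / (1 - t)\<close> and
  \<open>(v - w\<^sub>n) / t\<close>, and let first \<open>n\<close> tend to infinity and then \<open>t\<close> to zero.\<close>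

lemma Lp_closed_Lp_mod_le:
  assumes p: "1 < p"
  shows "Lp_closed p {u \<in> Lp_space p. Lp_mod p u \<le> R}"
  unfolding Lp_closed_def
proof (intro allI impI)
  fix w :: "nat \<Rightarrow> real^'n \<Rightarrow> 'b::euclidean_space" and v
  assume w: "\<forall>n. w n \<in> {u \<in> Lp_space p. Lp_mod p u \<le> R}" and v: "v \<in> Lp_space p"
    and lim: "(\<lambda>n. Lp_mod p (\<lambda>x. w n x - v x)) \<longlonglongrightarrow> 0"
  have 1: "Lp_mod p v \<le> (1 - t) powr (1 - p) * R" if t: "0 < t" "t < 1" for t
  proof -
    have "Lp_mod p v \<le> (1 - t) powr (1 - p) * R + t powr (1 - p) * Lp_mod p (\<lambda>x. w n x - v x)" for n
    proof -
      let ?a = "\<lambda>x. (1 / (1 - t)) *\<^sub>R w n x" and ?b = "\<lambda>x. (1 / t) *\<^sub>R (v x - w n x)"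
      have wn: "w n \<in> Lp_space p" "Lp_mod p (w n) \<le> R" using w by auto
      have "Lp_mod p (\<lambda>x. (1 - t) *\<^sub>R ?a x + t *\<^sub>R ?b x) \<le> (1 - t) * Lp_mod p ?a + t * Lp_mod p ?b"
        using wn v p t by (intro Lp_mod_convex_comb Lp_space_scaleR Lp_space_diff) auto
      moreover have "(\<lambda>x. (1 - t) *\<^sub>R ?a x + t *\<^sub>R ?b x) = v" using t by auto
      moreover have "(1 - t) * Lp_mod p ?a = (1 - t) powr (1 - p) * Lp_mod p (w n)"
        unfolding Lp_mod_scaleR using t by (simp add: powr_divide powr_diff field_simps)
      moreover have "t * Lp_mod p ?b = t powr (1 - p) * Lp_mod p (\<lambda>x. w n x - v x)"
        unfolding Lp_mod_scaleR using t by (simp add: powr_divide powr_diff field_simps Lp_mod_minus_commute)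
      moreover have "(1 - t) powr (1 - p) * Lp_mod p (w n) \<le> (1 - t) powr (1 - p) * R"
        using wn(2) by (intro mult_left_mono) auto
      ultimately show ?thesis by simp
    qed
    moreover have "(\<lambda>n. (1 - t) powr (1 - p) * R + t powr (1 - p) * Lp_mod p (\<lambda>x. w n x - v x))
        \<longlonglongrightarrow> (1 - t) powr (1 - p) * R + t powr (1 - p) * 0"
      by (intro tendsto_intros lim)
    ultimately have "Lp_mod p v \<le> (1 - t) powr (1 - p) * R + t powr (1 - p) * 0"
      by (intro LIMSEQ_le_const) auto
    then show ?thesis by simp
  qed
  have "Lp_mod p v \<le> (1 - 0) powr (1 - p) * R"
  proof (rule tendsto_lowerbound)
    show "((\<lambda>t. (1 - t) powr (1 - p) * R) \<longlongrightarrow> (1 - 0) powr (1 - p) * R) (at_right 0)"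
      by (intro tendsto_intros) auto
    show "\<forall>\<^sub>F t in at_right 0. Lp_mod p v \<le> (1 - t) powr (1 - p) * R"
      using 1 by (auto simp: eventually_at_right[of 0 1] intro!: exI[of _ 1])
  qed auto
  then show "v \<in> {u \<in> Lp_space p. Lp_mod p u \<le> R}" using v by simp
qed

text \<open>The superposition operator of a Caratheodory integrand; the property enters through the measurability
  of compositions and the continuity in the second variable.\<close>

locale monotone_Lp_operator =
  fixes p C \<alpha> :: real and F :: "real^'n \<Rightarrow> 'b::euclidean_space \<Rightarrow> 'b" and g k :: "real^'n \<Rightarrow> real"
  assumes p: "1 < p" and C: "0 < C" and \<alpha>: "0 < \<alpha>"
    and meas: "\<And>w. w \<in> borel_measurable lebesgue \<Longrightarrow> (\<lambda>x. F x (w x)) \<in> borel_measurable lebesgue"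
    and cont: "AE x in lebesgue. continuous_on UNIV (F x)"
    and mono: "AE x in lebesgue. \<forall>\<xi> \<eta>. 0 \<le> (F x \<xi> - F x \<eta>) \<bullet> (\<xi> - \<eta>)"
    and g: "g \<in> Lp_space (p / (p - 1))"
    and growth: "AE x in lebesgue. \<forall>\<xi>. norm (F x \<xi>) \<le> g x + C * norm \<xi> powr (p - 1)"
    and k: "integrable lebesgue k"
    and coercive: "AE x in lebesgue. \<forall>\<xi>. \<alpha> * norm \<xi> powr p - k x \<le> F x \<xi> \<bullet> \<xi>"
begin

abbreviation "q \<equiv> p / (p - 1)"

lemma q: "1 < q" using p by (simp add: field_simps)

lemma growth_powr_le: "(\<bar>r\<bar> + C * norm \<xi> powr (p - 1)) powr q \<le> 2 powr q * (\<bar>r\<bar> powr q + C powr q * norm \<xi> powr p)"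
  using norm_add_powr_le[of q "\<bar>r\<bar>" "C * norm \<xi> powr (p - 1)"] q p C
  by (simp add: powr_mult powr_powr)

lemma growth_Lp:
  fixes w :: "real^'n \<Rightarrow> 'c::euclidean_space"
  assumes "w \<in> Lp_space p"
  shows "(\<lambda>x. \<bar>g x\<bar> + C * norm (w x) powr (p - 1)) \<in> Lp_space q"
proof (rule Lp_spaceI)
  note [measurable] = Lp_spaceD(1)[OF assms] Lp_spaceD(1)[OF g]
  show "(\<lambda>x. \<bar>g x\<bar> + C * norm (w x) powr (p - 1)) \<in> borel_measurable lebesgue" by measurable
  show "integrable lebesgue (\<lambda>x. 2 powr q * (\<bar>g x\<bar> powr q + C powr q * norm (w x) powr p))"
    using Lp_spaceD(2)[OF assms] Lp_spaceD(2)[OF g] by simp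
  show "AE x in lebesgue. norm (\<bar>g x\<bar> + C * norm (w x) powr (p - 1)) powr q \<le> 2 powr q * (\<bar>g x\<bar> powr q + C powr q * norm (w x) powr p)"
    using C by (intro AE_I2) (simp add: growth_powr_le)
qed

lemma F_powr_le: "AE x in lebesgue. \<forall>\<xi>. norm (F x \<xi>) powr q \<le> 2 powr q * (\<bar>g x\<bar> powr q + C powr q * norm \<xi> powr p)"
  using growth
proof (eventually_elim, intro allI)
  fix x \<xi> assume "\<forall>\<xi>. norm (F x \<xi>) \<le> g x + C * norm \<xi> powr (p - 1)"
  then have "norm (F x \<xi>) \<le> \<bar>g x\<bar> + C * norm \<xi> powr (p - 1)" by (smt (verit))
  then have "norm (F x \<xi>) powr q \<le> (\<bar>g x\<bar> + C * norm \<xi> powr (p - 1)) powr q"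
    using q by (intro powr_mono2) auto
  also note growth_powr_le
  finally show "norm (F x \<xi>) powr q \<le> 2 powr q * (\<bar>g x\<bar> powr q + C powr q * norm \<xi> powr p)" .
qed

lemma F_Lp:
  assumes "w \<in> Lp_space p"
  shows "(\<lambda>x. F x (w x)) \<in> Lp_space q"
proof (rule Lp_spaceI)
  show "(\<lambda>x. F x (w x)) \<in> borel_measurable lebesgue" by (rule meas[OF Lp_spaceD(1)[OF assms]])
  show "integrable lebesgue (\<lambda>x. 2 powr q * (\<bar>g x\<bar> powr q + C powr q * norm (w x) powr p))"
    using Lp_spaceD(2)[OF assms] Lp_spaceD(2)[OF g] by simp
  show "AE x in lebesgue. norm (F x (w x)) powr q \<le> 2 powr q * (\<bar>g x\<bar> powr q + C powr q * norm (w x) powr p)"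
    using F_powr_le by eventually_elim simp
qed

lemma F_mod_le:
  assumes "w \<in> Lp_space p"
  shows "Lp_mod q (\<lambda>x. F x (w x)) \<le> 2 powr q * (Lp_mod q g + C powr q * Lp_mod p w)"
proof -
  have "Lp_mod q (\<lambda>x. F x (w x)) \<le> (LINT x|lebesgue. 2 powr q * (\<bar>g x\<bar> powr q + C powr q * norm (w x) powr p))"
    unfolding Lp_mod_def
    by (rule integral_mono_AE) (use Lp_spaceD(2)[OF assms] Lp_spaceD(2)[OF g] Lp_spaceD(2)[OF F_Lp[OF assms]] F_powr_le in auto)
  also have "\<dots> = 2 powr q * (Lp_mod q g + C powr q * Lp_mod p w)"
    using Lp_spaceD(2)[OF assms] Lp_spaceD(2)[OF g] by (simp add: Lp_mod_def)
  finally show ?thesis .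
qed

lemma integrable_F:
  assumes "w \<in> Lp_space p" "h \<in> Lp_space p"
  shows "integrable lebesgue (\<lambda>x. F x (w x) \<bullet> h x)"
  by (rule integrable_inner_Lp[OF p F_Lp[OF assms(1)] assms(2)])

lemma integral_mono_F:
  assumes "u \<in> Lp_space p" "v \<in> Lp_space p"
  shows "0 \<le> (LINT x|lebesgue. F x (u x) \<bullet> (u x - v x)) + (LINT x|lebesgue. F x (v x) \<bullet> (v x - u x))"
proof -
  have d: "(\<lambda>x. u x - v x) \<in> Lp_space p" "(\<lambda>x. v x - u x) \<in> Lp_space p"
    using assms p by (auto intro: Lp_space_diff)
  have "(LINT x|lebesgue. F x (u x) \<bullet> (u x - v x)) + (LINT x|lebesgue. F x (v x) \<bullet> (v x - u x))
     = (LINT x|lebesgue. (F x (u x) - F x (v x)) \<bullet> (u x - v x))"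
    using integrable_F[OF assms(1) d(1)] integrable_F[OF assms(2) d(2)]
    by (subst Bochner_Integration.integral_add[symmetric]) (auto simp: inner_simps algebra_simps intro!: Bochner_Integration.integral_cong)
  also have "\<dots> \<ge> 0"
    by (rule integral_nonneg_AE) (use mono in eventually_elim, auto)
  finally show ?thesis .
qed

text \<open>In the convex hull of \<open>S\<close> the inequalities become linear in the barycentric coordinates, with a
  matrix whose symmetric part has nonnegative entries by monotonicity.\<close>

lemma minty_finite:
  assumes K: "K \<subseteq> Lp_space p" "convex_on_maps K" and S: "finite S" "S \<subseteq> K" "S \<noteq> {}"
  shows "\<exists>u\<in>K. \<forall>v\<in>S. 0 \<le> (LINT x|lebesgue. F x (v x) \<bullet> (v x - u x))"
proof -
  define M where "M v w = (LINT x|lebesgue. F x (v x) \<bullet> (v x - w x))" for v w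
  have L: "v \<in> Lp_space p" if "v \<in> S" for v using that S K by auto
  have "0 \<le> M v w + M w v" if "v \<in> S" "w \<in> S" for v w
    unfolding M_def using that by (intro integral_mono_F L)
  then have "\<exists>l. (\<forall>v\<in>S. 0 \<le> l v) \<and> sum l S = 1 \<and> (\<forall>v\<in>S. 0 \<le> (\<Sum>w\<in>S. M v w * l w))"
    by (intro exists_simplex_nonneg S)
  then obtain l where l: "\<forall>v\<in>S. 0 \<le> l v" "sum l S = 1" "\<forall>v\<in>S. 0 \<le> (\<Sum>w\<in>S. M v w * l w)"
    by blast
  let ?u = "\<lambda>x. \<Sum>w\<in>S. l w *\<^sub>R w x"
  have uK: "?u \<in> K" using l S by (intro convex_on_maps_sum K(2)) auto
  have "0 \<le> (LINT x|lebesgue. F x (v x) \<bullet> (v x - ?u x))" if v: "v \<in> S" for v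
  proof -
    have eq: "v x - ?u x = (\<Sum>w\<in>S. l w *\<^sub>R (v x - w x))" for x
      using l(2) by (simp add: scaleR_diff_right sum_subtractf scaleR_sum_left[symmetric])
    have "(LINT x|lebesgue. F x (v x) \<bullet> (v x - ?u x)) = (LINT x|lebesgue. (\<Sum>w\<in>S. l w * (F x (v x) \<bullet> (v x - w x))))"
      unfolding eq by (simp add: inner_sum_right)
    also have "\<dots> = (\<Sum>w\<in>S. M v w * l w)"
      unfolding M_def using p L v
      by (subst Bochner_Integration.integral_sum) (auto intro!: integrable_mult_right integrable_F Lp_space_diff simp: mult.commute)
    finally show ?thesis using l(3) v by simp
  qed
  with uK show ?thesis by (intro bexI[OF _ uK] ballI)
qed

lemma minty_bounded:
  assumes K: "K \<subseteq> Lp_space p" "convex_on_maps K" "Lp_closed p K" "K \<noteq> {}"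
    and bdd: "\<And>u. u \<in> K \<Longrightarrow> Lp_mod p u \<le> R"
  obtains u where "u \<in> K" "\<And>v. v \<in> K \<Longrightarrow> 0 \<le> (LINT x|lebesgue. F x (v x) \<bullet> (v x - u x))"
proof -
  define A where "A v = {u \<in> Lp_space p. 0 \<le> (LINT x|lebesgue. F x (v x) \<bullet> (v x - u x))}" for v
  \<comment> \<open>A half-space: the condition on \<open>u\<close> is affine.\<close>
  have A_alt: "A v = {u \<in> Lp_space p. (LINT x|lebesgue. F x (v x) \<bullet> u x) \<le> (LINT x|lebesgue. F x (v x) \<bullet> v x)}"
    if "v \<in> K" for v
    using that K(1) integrable_F[of v] by (auto simp: A_def inner_diff_right subset_iff)
  have 1: "convex_on_maps (A v)" if v: "v \<in> K" for v
    unfolding convex_on_maps_def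
  proof (intro ballI)
    fix u w and t :: real assume uw: "u \<in> A v" "w \<in> A v" and t: "t \<in> {0..1}"
    have L: "u \<in> Lp_space p" "w \<in> Lp_space p" "v \<in> Lp_space p" using uw v K by (auto simp: A_def)
    let ?I = "\<lambda>u. LINT x|lebesgue. F x (v x) \<bullet> u x"
    have "?I (\<lambda>x. (1 - t) *\<^sub>R u x + t *\<^sub>R w x) = (1 - t) * ?I u + t * ?I w"
      using integrable_F[OF L(3)] L by (simp add: inner_add_right)
    also have "\<dots> \<le> (1 - t) * ?I v + t * ?I v"
      using uw t unfolding A_alt[OF v] by (intro add_mono mult_left_mono) auto
    finally show "(\<lambda>x. (1 - t) *\<^sub>R u x + t *\<^sub>R w x) \<in> A v"
      unfolding A_alt[OF v] using L p by (auto intro!: Lp_space_convex_comb) (simp add: algebra_simps)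
  qed
  have 2: "Lp_closed p (A v)" if v: "v \<in> K" for v
    unfolding Lp_closed_def
  proof (intro allI impI)
    fix w and u :: "real^'n \<Rightarrow> 'b" assume w: "\<forall>n. w n \<in> A v" and u: "u \<in> Lp_space p"
      and lim: "(\<lambda>n. Lp_mod p (\<lambda>x. w n x - u x)) \<longlonglongrightarrow> 0"
    have "(\<lambda>n. LINT x|lebesgue. F x (v x) \<bullet> w n x) \<longlonglongrightarrow> (LINT x|lebesgue. F x (v x) \<bullet> u x)"
      using w v K(1) by (intro tendsto_integral_inner_Lp[OF p _ _ u lim] F_Lp) (auto simp: A_def)
    then have "(LINT x|lebesgue. F x (v x) \<bullet> u x) \<le> (LINT x|lebesgue. F x (v x) \<bullet> v x)"
      by (rule LIMSEQ_le_const2) (use w A_alt[OF v] in auto)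
    then show "u \<in> A v" unfolding A_alt[OF v] using u by simp
  qed
  have 3: "\<exists>u\<in>K. \<forall>v\<in>S. u \<in> A v" if "finite S" "S \<subseteq> K" for S
  proof (cases "S = {}")
    case True then show ?thesis using K(4) by auto
  next
    case False
    then show ?thesis using minty_finite[OF K(1,2) that False] K(1) by (auto simp: A_def subset_iff)
  qed
  obtain z where "z \<in> K" "\<And>v. v \<in> K \<Longrightarrow> z \<in> A v"
    by (rule Lp_finite_intersection_property[where p=p and K=K and B=R and A=A and I=K])
      (use p K bdd 1 2 3 in auto)
  then show ?thesis by (intro that[of z]) (auto simp: A_def)
qed

text \<open>Minty's trick: insert \<open>(1 - t) u + t v\<close>, divide by \<open>t\<close>, and let \<open>t\<close> tend to zero by
  dominated convergence.\<close>

lemma minty: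
  assumes K: "K \<subseteq> Lp_space p" "convex_on_maps K" and u: "u \<in> K" "\<And>v. v \<in> K \<Longrightarrow> 0 \<le> (LINT x|lebesgue. F x (v x) \<bullet> (v x - u x))"
    and v: "v \<in> K"
  shows "0 \<le> (LINT x|lebesgue. F x (u x) \<bullet> (v x - u x))"
proof -
  have L: "u \<in> Lp_space p" "v \<in> Lp_space p" using u v K by auto
  note [measurable] = Lp_spaceD(1)[OF L(1)] Lp_spaceD(1)[OF L(2)] meas
  define t where "t n = 1 / real (Suc n)" for n
  have t: "0 < t n" "t n \<le> 1" for n by (auto simp: t_def)
  define w where "w n x = (1 - t n) *\<^sub>R u x + t n *\<^sub>R v x" for n x
  have wL: "w n \<in> Lp_space p" for n
    unfolding w_def[abs_def] using L p by (intro Lp_space_convex_comb) auto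
  have dL: "(\<lambda>x. v x - u x) \<in> Lp_space p" using L p by (intro Lp_space_diff) auto
  have nn: "0 \<le> (LINT x|lebesgue. F x (w n x) \<bullet> (v x - u x))" for n
  proof -
    have "w n \<in> K" unfolding w_def[abs_def] using t[of n] by (intro convex_on_mapsD[OF K(2) u(1) v]) auto
    from u(2)[OF this] have "0 \<le> (LINT x|lebesgue. F x (w n x) \<bullet> (w n x - u x))" .
    also have "\<dots> = (LINT x|lebesgue. t n * (F x (w n x) \<bullet> (v x - u x)))"
      by (intro Bochner_Integration.integral_cong refl) (simp add: w_def inner_simps algebra_simps)
    also have "\<dots> = t n * (LINT x|lebesgue. F x (w n x) \<bullet> (v x - u x))" by simp
    finally show ?thesis using t[of n] by (simp add: zero_le_mult_iff)
  qed
  let ?s = "\<lambda>x. norm (u x) + norm (v x)"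
  have sL: "?s \<in> Lp_space p"
  proof -
    have "(\<lambda>x. norm (u x)) \<in> Lp_space p" "(\<lambda>x. norm (v x)) \<in> Lp_space p"
      using L by (auto simp: Lp_space_def)
    then show ?thesis using p by (intro Lp_space_add) auto
  qed
  have dom: "integrable lebesgue (\<lambda>x. (\<bar>g x\<bar> + C * norm (?s x) powr (p - 1)) \<bullet> norm (v x - u x))"
    using growth_Lp[OF sL] dL by (intro integrable_inner_Lp[OF p]) (auto simp: Lp_space_def)
  have "(\<lambda>n. LINT x|lebesgue. F x (w n x) \<bullet> (v x - u x)) \<longlonglongrightarrow> (LINT x|lebesgue. F x (u x) \<bullet> (v x - u x))"
  proof (rule integral_dominated_convergence[OF _ _ dom])
    show "AE x in lebesgue. (\<lambda>n. F x (w n x) \<bullet> (v x - u x)) \<longlonglongrightarrow> F x (u x) \<bullet> (v x - u x)"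
      using cont
    proof eventually_elim
      fix x assume "continuous_on UNIV (F x)"
      then have c: "isCont (F x) (u x)" by (simp add: continuous_on_eq_continuous_at)
      have "t \<longlonglongrightarrow> 0" unfolding t_def[abs_def] by (rule LIMSEQ_inverse_real_of_nat[unfolded inverse_eq_divide])
      then have "(\<lambda>n. w n x) \<longlonglongrightarrow> (1 - 0) *\<^sub>R u x + 0 *\<^sub>R v x"
        unfolding w_def by (intro tendsto_intros)
      then have "(\<lambda>n. w n x) \<longlonglongrightarrow> u x" by simp
      from isCont_tendsto_compose[OF c this]
      show "(\<lambda>n. F x (w n x) \<bullet> (v x - u x)) \<longlonglongrightarrow> F x (u x) \<bullet> (v x - u x)" by (intro tendsto_intros)
    qed
    fix n
    show "AE x in lebesgue. norm (F x (w n x) \<bullet> (v x - u x)) \<le> (\<bar>g x\<bar> + C * norm (?s x) powr (p - 1)) \<bullet> norm (v x - u x)"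
      using growth
    proof eventually_elim
      fix x assume gr: "\<forall>\<xi>. norm (F x \<xi>) \<le> g x + C * norm \<xi> powr (p - 1)"
      have "norm (w n x) \<le> (1 - t n) * norm (u x) + t n * norm (v x)"
        using t[of n] norm_triangle_ineq[of "(1 - t n) *\<^sub>R u x" "t n *\<^sub>R v x"] by (simp add: w_def)
      also have "\<dots> \<le> 1 * norm (u x) + 1 * norm (v x)"
        using t[of n] by (intro add_mono mult_right_mono) auto
      finally have "norm (w n x) powr (p - 1) \<le> norm (?s x) powr (p - 1)"
        using p by (intro powr_mono2) auto
      then have "C * norm (w n x) powr (p - 1) \<le> C * norm (?s x) powr (p - 1)"
        using C by (intro mult_left_mono) auto
      then have "norm (F x (w n x)) \<le> \<bar>g x\<bar> + C * norm (?s x) powr (p - 1)"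
        using gr[rule_format, of "w n x"] abs_ge_self[of "g x"] by linarith
      then have "norm (F x (w n x)) * norm (v x - u x) \<le> (\<bar>g x\<bar> + C * norm (?s x) powr (p - 1)) * norm (v x - u x)"
        by (intro mult_right_mono) auto
      then show "norm (F x (w n x) \<bullet> (v x - u x)) \<le> (\<bar>g x\<bar> + C * norm (?s x) powr (p - 1)) \<bullet> norm (v x - u x)"
        using Cauchy_Schwarz_ineq2[of "F x (w n x)" "v x - u x"] by (simp only: real_norm_def inner_real_def)
    qed
  qed (use integrable_F[OF L(1) dL] integrable_F[OF wL dL] in \<open>auto intro: borel_measurable_integrable\<close>)
  then show ?thesis by (rule LIMSEQ_le_const) (use nn in auto)
qed

text \<open>Testing with the fixed function \<open>v\<close>, coercivity bounds \<open>\<alpha> \<parallel>u\<parallel>\<^sup>p\<close> by \<open>\<integral> F u \<bullet> v + \<integral> k\<close>. By Young's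
  inequality and the growth condition, the first integral is at most \<open>\<alpha> \<parallel>u\<parallel>\<^sup>p / 2\<close> plus a constant
  that depends on \<open>v\<close> but not on \<open>u\<close>.\<close>

lemma a_priori_bound:
  assumes v: "v \<in> Lp_space p"
  obtains R where "\<And>u. u \<in> Lp_space p \<Longrightarrow> 0 \<le> (LINT x|lebesgue. F x (u x) \<bullet> (v x - u x)) \<Longrightarrow> Lp_mod p u \<le> R"
proof -
  \<comment> \<open>The weight for which Young's inequality leaves half of the coercivity.\<close>
  define \<epsilon> where "\<epsilon> = \<alpha> / (2 * (2 powr q * C powr q))"
  have \<epsilon>: "0 < \<epsilon>" "\<epsilon> * (2 powr q * C powr q) = \<alpha> / 2" using \<alpha> C by (auto simp: \<epsilon>_def)
  show ?thesis
  proof (rule that[of "2 / \<alpha> * ((LINT x|lebesgue. k x) + \<epsilon> * 2 powr q * Lp_mod q g + \<epsilon> powr (1 - p) * Lp_mod p v)"])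
    fix u assume u: "u \<in> Lp_space p" and nn: "0 \<le> (LINT x|lebesgue. F x (u x) \<bullet> (v x - u x))"
    have "\<alpha> * Lp_mod p u - (LINT x|lebesgue. k x) = (LINT x|lebesgue. \<alpha> * norm (u x) powr p - k x)"
      using Lp_spaceD(2)[OF u] k by (simp add: Lp_mod_def)
    also have "\<dots> \<le> (LINT x|lebesgue. F x (u x) \<bullet> u x)"
      by (rule integral_mono_AE) (use Lp_spaceD(2)[OF u] k integrable_F[OF u u] coercive in auto)
    also have "\<dots> \<le> (LINT x|lebesgue. F x (u x) \<bullet> v x)"
      using nn integrable_F[OF u] u v by (simp add: inner_diff_right)
    also have "\<dots> \<le> \<epsilon> * Lp_mod q (\<lambda>x. F x (u x)) + \<epsilon> powr (1 - p) * Lp_mod p v"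
      using abs_integral_inner_Lp[OF p F_Lp[OF u] v \<epsilon>(1)] by linarith
    also have "\<dots> \<le> \<epsilon> * (2 powr q * (Lp_mod q g + C powr q * Lp_mod p u)) + \<epsilon> powr (1 - p) * Lp_mod p v"
      using \<epsilon>(1) by (intro add_mono mult_left_mono F_mod_le u) auto
    also have "\<dots> = \<epsilon> * 2 powr q * Lp_mod q g + (\<epsilon> * (2 powr q * C powr q)) * Lp_mod p u + \<epsilon> powr (1 - p) * Lp_mod p v"
      by (simp add: algebra_simps)
    finally have "\<alpha> / 2 * Lp_mod p u \<le> (LINT x|lebesgue. k x) + \<epsilon> * 2 powr q * Lp_mod q g + \<epsilon> powr (1 - p) * Lp_mod p v"
      unfolding \<epsilon>(2) by (simp add: field_simps)
    then show "Lp_mod p u \<le> 2 / \<alpha> * ((LINT x|lebesgue. k x) + \<epsilon> * 2 powr q * Lp_mod q g + \<epsilon> powr (1 - p) * Lp_mod p v)"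
      using \<alpha> by (simp add: field_simps)
  qed
qed

text \<open>Solve the problem on the part of \<open>K\<close> with modular at most \<open>R\<close>. By the a priori bound the solution
  has a strictly smaller modular if \<open>R\<close> is large, so that one can move from it a little in the
  direction of any \<open>v \<in> K\<close>.\<close>

lemma variational_inequality:
  assumes K: "K \<subseteq> Lp_space p" "convex_on_maps K" "Lp_closed p K" "K \<noteq> {}"
  shows "\<exists>u\<in>K. \<forall>v\<in>K. 0 \<le> (LINT x|lebesgue. F x (u x) \<bullet> (v x - u x))"
proof -
  obtain v0 where v0: "v0 \<in> K" using K by auto
  obtain R0 where R0: "\<And>u. u \<in> Lp_space p \<Longrightarrow> 0 \<le> (LINT x|lebesgue. F x (u x) \<bullet> (v0 x - u x)) \<Longrightarrow> Lp_mod p u \<le> R0"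
    using a_priori_bound[of v0] v0 K by auto
  \<comment> \<open>Admits \<open>v0\<close> and leaves room above the a priori bound \<open>R0\<close>.\<close>
  define R where "R = max (R0 + 1) (Lp_mod p v0)"
  define KR where "KR = {u \<in> K. Lp_mod p u \<le> R}"
  have KR: "KR \<subseteq> Lp_space p" "v0 \<in> KR" using K v0 by (auto simp: KR_def R_def)
  have cv: "convex_on_maps KR" unfolding convex_on_maps_def
  proof (intro ballI)
    fix u v and t :: real assume uv: "u \<in> KR" "v \<in> KR" and t: "t \<in> {0..1}"
    have "Lp_mod p (\<lambda>x. (1 - t) *\<^sub>R u x + t *\<^sub>R v x) \<le> (1 - t) * Lp_mod p u + t * Lp_mod p v"
      using uv t KR p by (intro Lp_mod_convex_comb) auto
    also have "\<dots> \<le> (1 - t) * R + t * R"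
      using uv t by (intro add_mono mult_left_mono) (auto simp: KR_def)
    finally show "(\<lambda>x. (1 - t) *\<^sub>R u x + t *\<^sub>R v x) \<in> KR"
      using uv t convex_on_mapsD[OF K(2), of u v t] by (auto simp: KR_def algebra_simps)
  qed
  have cl: "Lp_closed p KR" unfolding Lp_closed_def
  proof (intro allI impI)
    fix w and v :: "real^'n \<Rightarrow> 'b" assume w: "\<forall>n. w n \<in> KR" and v: "v \<in> Lp_space p"
      and lim: "(\<lambda>n. Lp_mod p (\<lambda>x. w n x - v x)) \<longlonglongrightarrow> 0"
    have "v \<in> K" using w by (intro Lp_closedD[OF K(3) _ v lim]) (auto simp: KR_def)
    moreover have "v \<in> {u \<in> Lp_space p. Lp_mod p u \<le> R}"
      using w KR by (intro Lp_closedD[OF Lp_closed_Lp_mod_le[OF p] _ v lim]) (auto simp: KR_def)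
    ultimately show "v \<in> KR" by (simp add: KR_def)
  qed
  obtain u where u: "u \<in> KR" and m: "\<And>v. v \<in> KR \<Longrightarrow> 0 \<le> (LINT x|lebesgue. F x (v x) \<bullet> (v x - u x))"
    by (rule minty_bounded[OF KR(1) cv cl, of R]) (use KR in \<open>auto simp: KR_def\<close>)
  have vi: "0 \<le> (LINT x|lebesgue. F x (u x) \<bullet> (v x - u x))" if "v \<in> KR" for v
    by (rule minty[OF KR(1) cv u m that])
  have uR0: "Lp_mod p u \<le> R0" using R0[of u] vi[OF KR(2)] u KR by auto
  have uK: "u \<in> K" using u by (simp add: KR_def)
  show ?thesis
  proof (intro bexI[OF _ uK] ballI)
    fix v assume v: "v \<in> K"
    \<comment> \<open>A step for which convexity keeps the modular of \<open>?w\<close> below \<open>R0 + 1\<close>.\<close>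
    define t where "t = 1 / (Lp_mod p v + 1)"
    have t: "0 < t" "t \<le> 1" "t * Lp_mod p v \<le> 1" using Lp_mod_nonneg[of p v] by (auto simp: t_def)
    let ?w = "\<lambda>x. (1 - t) *\<^sub>R u x + t *\<^sub>R v x"
    have "Lp_mod p ?w \<le> (1 - t) * Lp_mod p u + t * Lp_mod p v"
      using uK v K t p by (intro Lp_mod_convex_comb) auto
    also have "\<dots> \<le> 1 * Lp_mod p u + 1"
      using t Lp_mod_nonneg[of p u] by (intro add_mono mult_right_mono) auto
    also have "\<dots> \<le> R" using uR0 by (simp add: R_def)
    finally have "?w \<in> KR" using convex_on_mapsD[OF K(2) uK v, of t] t by (simp add: KR_def)
    from vi[OF this] have "0 \<le> (LINT x|lebesgue. F x (u x) \<bullet> (?w x - u x))" .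
    also have "\<dots> = (LINT x|lebesgue. t * (F x (u x) \<bullet> (v x - u x)))"
      by (intro Bochner_Integration.integral_cong refl) (simp add: inner_simps algebra_simps)
    also have "\<dots> = t * (LINT x|lebesgue. F x (u x) \<bullet> (v x - u x))" by simp
    finally show "0 \<le> (LINT x|lebesgue. F x (u x) \<bullet> (v x - u x))" using t by (simp add: zero_le_mult_iff)
  qed
qed

end

section \<open>Test functions\<close>

lemma gradient_nth:
  assumes "(f has_derivative f') (at x)"
  shows "gradient f x $ j = f' (axis j 1)"
  using frechet_derivative_at[OF assms] by (simp add: gradient_def)

lemma has_derivative_gradient:
  assumes "f differentiable (at x)"
  shows "(f has_derivative (\<lambda>h. gradient f x \<bullet> h)) (at x)"
proof -
  obtain f' where f': "(f has_derivative f') (at x)" using assms by (auto simp: differentiable_def)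
  interpret bounded_linear f' by (rule has_derivative_bounded_linear[OF f'])
  have "f' h = gradient f x \<bullet> h" for h
  proof -
    have "f' h = f' (\<Sum>j\<in>UNIV. h $ j *\<^sub>R axis j 1)"
      by (simp add: scalar_mult_eq_scaleR[symmetric] basis_expansion)
    also have "\<dots> = (\<Sum>j\<in>UNIV. h $ j * f' (axis j 1))" by (simp add: sum scaleR)
    also have "\<dots> = gradient f x \<bullet> h"
      by (simp add: inner_vec_def gradient_nth[OF f'] mult.commute)
    finally show ?thesis .
  qed
  then have "f' = (\<lambda>h. gradient f x \<bullet> h)" by (rule ext)
  then show ?thesis using f' by simp
qed

lemma C_k_SucD: "C_k (Suc k) f \<Longrightarrow> C_k k f"
proof (induction k arbitrary: f)
  case 0
  then show ?case by (auto intro!: continuous_at_imp_continuous_on differentiable_imp_continuous_within)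
next
  case (Suc k)
  from Suc.prems have d: "\<forall>x. f differentiable (at x)" and g: "\<forall>j. C_k (Suc k) (\<lambda>x. gradient f x $ j)"
    unfolding C_k.simps(2)[of "Suc k"] by blast+
  have "\<forall>j. C_k k (\<lambda>x. gradient f x $ j)" using Suc.IH g by blast
  then show ?case unfolding C_k.simps(2)[of k] using d by blast
qed

lemma C_k_continuous: "C_k k f \<Longrightarrow> continuous_on UNIV f"
  by (induction k) (auto dest: C_k_SucD simp del: C_k.simps(2))

lemma C_k_const: "C_k k (\<lambda>x::real^'n. c)"
proof (induction k arbitrary: c)
  case (Suc k)
  have "gradient (\<lambda>x. c) x $ j = 0" for x :: "real^'n" and j
    by (rule gradient_nth[OF has_derivative_const])
  then show ?case using Suc[of 0] by simp
qed simp

lemma C_k_add: "C_k k f \<Longrightarrow> C_k k g \<Longrightarrow> C_k k (\<lambda>x. f x + g x)"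
proof (induction k arbitrary: f g)
  case 0 then show ?case by (auto intro: continuous_on_add)
next
  case (Suc k)
  have d: "f differentiable (at x)" "g differentiable (at x)" for x using Suc.prems by simp_all
  have "gradient (\<lambda>x. f x + g x) x $ j = gradient f x $ j + gradient g x $ j" for x j
    using gradient_nth[OF has_derivative_add[OF has_derivative_gradient[OF d(1)] has_derivative_gradient[OF d(2)]], of x j]
    by (simp add: inner_axis)
  then show ?case using Suc d by simp
qed

lemma C_k_mult: "C_k k f \<Longrightarrow> C_k k g \<Longrightarrow> C_k k (\<lambda>x. f x * g x)"
proof (induction k arbitrary: f g)
  case 0 then show ?case by (auto intro: continuous_on_mult)
next
  case (Suc k)
  have d: "f differentiable (at x)" "g differentiable (at x)" for x using Suc.prems by simp_all
  have "gradient (\<lambda>x. f x * g x) x $ j = f x * gradient g x $ j + gradient f x $ j * g x" for x j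
    using gradient_nth[OF has_derivative_mult[OF has_derivative_gradient[OF d(1)] has_derivative_gradient[OF d(2)]], of x j]
    by (simp add: inner_axis)
  moreover have "C_k k (\<lambda>x. f x * gradient g x $ j + gradient f x $ j * g x)" for j
    using Suc.prems C_k_SucD[OF Suc.prems(1)] C_k_SucD[OF Suc.prems(2)]
    by (intro C_k_add Suc.IH) auto
  ultimately show ?case using d by simp
qed

lemma C_k_prod: "finite A \<Longrightarrow> (\<And>i. i \<in> A \<Longrightarrow> C_k k (f i)) \<Longrightarrow> C_k k (\<lambda>x. \<Prod>i\<in>A. f i x)"
  by (induction A rule: finite_induct) (auto intro: C_k_const C_k_mult)

text \<open>The derivatives of \<open>exp (-1 / t)\<close>, extended by zero to \<open>t \<le> 0\<close>, are all of this form, and the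
  family is closed under differentiation.\<close>

definition flat :: "real poly \<Rightarrow> real \<Rightarrow> real" where
  "flat P t = (if 0 < t then poly P (1 / t) * exp (- (1 / t)) else 0)"

lemma flat_tendsto_0: "(flat P \<longlongrightarrow> 0) (at_right 0)"
proof -
  have "((\<lambda>y. \<Sum>i\<le>degree P. coeff P i * (y ^ i / exp y)) \<longlongrightarrow> (\<Sum>i\<le>degree P. coeff P i * 0)) at_top"
    by (intro tendsto_intros tendsto_power_div_exp_0)
  then have "((\<lambda>y. poly P y * exp (- y)) \<longlongrightarrow> 0) at_top"
    by (simp add: poly_altdef sum_distrib_right exp_minus divide_inverse mult.assoc)
  then have "((\<lambda>t. poly P (inverse t) * exp (- inverse t)) \<longlongrightarrow> 0) (at_right 0)"
    by (rule filterlim_compose[OF _ filterlim_inverse_at_top_right])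
  then show ?thesis
    by (rule Lim_transform_eventually)
      (auto simp: flat_def inverse_eq_divide eventually_at_right_less[THEN eventually_mono])
qed

lemma flat_has_derivative:
  "(flat P has_real_derivative flat (monom 1 2 * (P - pderiv P)) t) (at t)"
proof -
  consider "t < 0" | "t = 0" | "0 < t" by linarith
  then show ?thesis
  proof cases
    case 1
    have "((\<lambda>_. 0) has_real_derivative 0) (at t)" by simp
    then have "(flat P has_real_derivative 0) (at t)"
      by (rule has_field_derivative_transform_within_open[where S="{..<0}"]) (use 1 in \<open>auto simp: flat_def\<close>)
    then show ?thesis using 1 by (simp add: flat_def)
  next
    case 2
    \<comment> \<open>Division by \<open>h\<close> multiplies the polynomial in \<open>1 / h\<close> by the variable.\<close>
    have "((\<lambda>h. flat P h / h) \<longlongrightarrow> 0) (at_right 0)"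
    proof (rule Lim_transform_eventually[OF flat_tendsto_0[of "pCons 0 P"]])
      show "\<forall>\<^sub>F h in at_right 0. flat (pCons 0 P) h = flat P h / h"
        using eventually_at_right_less by eventually_elim (simp add: flat_def)
    qed
    moreover have "((\<lambda>h. flat P h / h) \<longlongrightarrow> 0) (at_left 0)"
    proof (rule Lim_transform_eventually[OF tendsto_const[of 0]])
      show "\<forall>\<^sub>F h in at_left 0. 0 = flat P h / h"
        by (auto simp: eventually_at_filter flat_def)
    qed
    ultimately have "((\<lambda>h. flat P h / h) \<longlongrightarrow> 0) (at 0)" by (intro filterlim_split_at)
    then show ?thesis using 2 by (simp add: DERIV_def flat_def)
  next
    case 3
    have "((\<lambda>t. poly P (1 / t) * exp (- (1 / t))) has_real_derivative
        poly (monom 1 2 * (P - pderiv P)) (1 / t) * exp (- (1 / t))) (at t)"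
      using 3 by (auto intro!: derivative_eq_intros DERIV_chain2[OF poly_DERIV]
          simp: poly_monom field_simps power2_eq_square)
    then have "(flat P has_real_derivative poly (monom 1 2 * (P - pderiv P)) (1 / t) * exp (- (1 / t))) (at t)"
      by (rule has_field_derivative_transform_within_open[where S="{0<..}"]) (use 3 in \<open>auto simp: flat_def\<close>)
    then show ?thesis using 3 by (simp add: flat_def)
  qed
qed

lemma C_k_flat: "C_k k (\<lambda>x::real^'n. flat P (c * x $ j + d))"
proof (induction k arbitrary: P)
  case 0
  have "continuous_on UNIV (flat P)"
    using flat_has_derivative by (intro continuous_at_imp_continuous_on ballI) (blast intro: DERIV_isCont)
  then show ?case
    unfolding C_k.simps by (rule continuous_on_compose2) (auto intro!: continuous_intros)
next
  case (Suc k)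
  define Q where "Q = monom 1 2 * (P - pderiv P)"
  have der: "((\<lambda>x::real^'n. flat P (c * x $ j + d)) has_derivative (\<lambda>h. flat Q (c * x $ j + d) * (c * h $ j))) (at x)" for x
  proof -
    have "((\<lambda>x::real^'n. c * x $ j + d) has_derivative (\<lambda>h. c * h $ j)) (at x)"
      by (auto intro!: derivative_eq_intros bounded_linear_imp_has_derivative[OF bounded_linear_vec_nth])
    moreover have "(flat P has_derivative (*) (flat Q (c * x $ j + d))) (at (c * x $ j + d))"
      using flat_has_derivative[of P "c * x $ j + d"] by (simp add: has_field_derivative_def Q_def)
    ultimately show ?thesis by (rule has_derivative_compose[where g="flat P", unfolded comp_def])
  qed
  have "gradient (\<lambda>x::real^'n. flat P (c * x $ j + d)) x $ i = flat Q (c * x $ j + d) * (if i = j then c else 0)" for x i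
    by (subst gradient_nth[OF der]) (simp add: axis_def)
  moreover have "C_k k (\<lambda>x::real^'n. flat Q (c * x $ j + d) * (if i = j then c else 0))" for i
    by (intro C_k_mult Suc.IH C_k_const)
  moreover have "(\<lambda>x::real^'n. flat P (c * x $ j + d)) differentiable (at x)" for x
    using der[of x] unfolding differentiable_def by blast
  ultimately show ?case by simp
qed

text \<open>A smooth function that is positive exactly on the open box. As \<open>n\<close> grows, the factors tend to
  \<open>1\<close> in the box, because \<open>flat 1 (n t) = exp (- 1 / (n t))\<close> tends to \<open>1\<close> for \<open>t > 0\<close>.\<close>

definition box_bump :: "nat \<Rightarrow> real^'n \<Rightarrow> real^'n \<Rightarrow> real^'n \<Rightarrow> real" where
  "box_bump n a b x = (\<Prod>j\<in>UNIV. flat 1 (real (Suc n) * (x $ j - a $ j)) * flat 1 (real (Suc n) * (b $ j - x $ j)))"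

lemma flat_1: "0 \<le> flat 1 t" "flat 1 t \<le> 1" "flat 1 t \<noteq> 0 \<longleftrightarrow> 0 < t"
  by (auto simp: flat_def)

lemma box_bump_bounds: "0 \<le> box_bump n a b x" "box_bump n a b x \<le> 1"
  unfolding box_bump_def
  by (auto intro!: prod_nonneg prod_le_1 mult_nonneg_nonneg flat_1 mult_le_one)

lemma box_bump_support: "box_bump n a b x \<noteq> 0 \<longleftrightarrow> x \<in> box a b"
  by (auto simp: box_bump_def flat_1(3) mem_box_cart zero_less_mult_iff)

lemma box_bump_test_fun:
  fixes a b :: "real^'n"
  shows "box_bump n a b \<in> test_fun UNIV"
proof -
  have "C_k k (box_bump n a b)" for k
  proof -
    have 1: "C_k k (\<lambda>x::real^'n. flat 1 (real (Suc n) * (x $ j - a $ j)))" for j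
      using C_k_flat[of k 1 "real (Suc n)" j "- (real (Suc n) * a $ j)"] by (simp add: algebra_simps)
    have 2: "C_k k (\<lambda>x::real^'n. flat 1 (real (Suc n) * (b $ j - x $ j)))" for j
      using C_k_flat[of k 1 "- real (Suc n)" j "real (Suc n) * b $ j"] by (simp add: algebra_simps)
    show ?thesis unfolding box_bump_def[abs_def] by (intro C_k_prod C_k_mult 1 2) simp
  qed
  moreover have "{x. box_bump n a b x \<noteq> 0} = box a b" using box_bump_support by blast
  moreover have "compact (closure (box a b))" by (simp add: compact_closure bounded_box)
  ultimately show ?thesis by (simp add: test_fun_def)
qed

lemma box_bump_tendsto:
  fixes a b :: "real^'n"
  shows "(\<lambda>n. box_bump n a b x) \<longlonglongrightarrow> indicator (box a b) x"
proof (cases "x \<in> box a b")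
  case True
  have lim: "(\<lambda>n. flat 1 (real (Suc n) * t)) \<longlonglongrightarrow> 1" if "0 < t" for t
  proof -
    have "(\<lambda>n. exp (- (1 / real (Suc n) * (1 / t)))) \<longlonglongrightarrow> exp (- (0 * (1 / t)))"
      by (intro tendsto_intros LIMSEQ_inverse_real_of_nat[unfolded inverse_eq_divide])
    then show ?thesis using that by (simp add: flat_def)
  qed
  have "(\<lambda>n. box_bump n a b x) \<longlonglongrightarrow> (\<Prod>j\<in>(UNIV::'n set). 1 * 1)"
    unfolding box_bump_def using True by (intro tendsto_prod tendsto_mult lim) (auto simp: mem_box_cart)
  then show ?thesis using True by simp
next
  case False
  then have "box_bump n a b x = 0" for n using box_bump_support by blast
  then show ?thesis using False by simp
qed

text \<open>The positive and the negative part of \<open>f\<close> are densities of two measures that agree on boxes.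
  Boxes generate the Borel sets, so the measures coincide, and so do their densities.\<close>

lemma AE_zero_if_box_integrals_zero:
  fixes f :: "'a::euclidean_space \<Rightarrow> real"
  assumes meas: "f \<in> borel_measurable lebesgue"
    and int: "\<And>a b. set_integrable lebesgue (box a b) f"
    and zero: "\<And>a b. (LINT x:box a b|lebesgue. f x) = 0"
  shows "AE x in lebesgue. f x = 0"
proof -
  obtain f' where [measurable]: "f' \<in> borel_measurable lborel" and ae: "AE x in lborel. f x = f' x"
    using completion_ex_borel_measurable_real[OF meas] by auto
  have ae': "AE x in lebesgue. f x = f' x" by (rule AE_completion[OF ae])
  have [measurable]: "f' \<in> borel_measurable lebesgue" by (rule measurable_completion) simp
  note [measurable] = meas
  have [measurable]: "box a b \<in> sets lebesgue" for a b :: 'a by simp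
  have h: "integrable lborel (\<lambda>x. indicator (box a b) x * f' x) \<and> (LINT x|lborel. indicator (box a b) x * f' x) = 0" for a b :: 'a
  proof -
    have "integrable lebesgue (\<lambda>x. indicator (box a b) x * f x)"
      using int[of a b] by (simp add: set_integrable_def)
    then have 1: "integrable lebesgue (\<lambda>x. indicator (box a b) x * f' x)"
      by (rule integrable_cong_AE_imp) (use ae' in \<open>auto elim!: eventually_mono\<close>)
    have "(LINT x|lebesgue. indicator (box a b) x * f' x) = (LINT x|lebesgue. indicator (box a b) x * f x)"
      by (rule integral_cong_AE) (use ae' in \<open>auto elim!: eventually_mono\<close>)
    also have "\<dots> = 0" using zero[of a b] by (simp add: set_lebesgue_integral_def)
    finally have 2: "(LINT x|lebesgue. indicator (box a b) x * f' x) = 0" .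
    have m: "(\<lambda>x. indicator (box a b) x * f' x) \<in> borel_measurable lborel" by measurable
    show ?thesis using 1 2 by (simp add: integrable_completion[OF m] integral_completion[OF m])
  qed
  have fin: "(\<integral>\<^sup>+x. ennreal (indicator (box a b) x * f' x) \<partial>lborel) = (\<integral>\<^sup>+x. ennreal (- (indicator (box a b) x * f' x)) \<partial>lborel)
      \<and> (\<integral>\<^sup>+x. ennreal (indicator (box a b) x * f' x) \<partial>lborel) \<noteq> \<infinity>" for a b :: 'a
  proof -
    let ?p = "\<integral>\<^sup>+x. ennreal (indicator (box a b) x * f' x) \<partial>lborel"
    let ?n = "\<integral>\<^sup>+x. ennreal (- (indicator (box a b) x * f' x)) \<partial>lborel"
    have "?p \<noteq> \<infinity>" "?n \<noteq> \<infinity>" using h[of a b] by (auto simp: real_integrable_def)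
    moreover have "p = n" if "p \<noteq> \<infinity>" "n \<noteq> \<infinity>" "enn2real p - enn2real n = 0" for p n :: ennreal
      using that by (cases p; cases n) auto
    moreover have "enn2real ?p - enn2real ?n = 0"
      using h[of a b] real_lebesgue_integral_def[of lborel "\<lambda>x. indicator (box a b) x * f' x"] by simp
    ultimately show ?thesis by (intro conjI)
  qed
  \<comment> \<open>The coercion of reals to extended nonnegative reals cuts off negative values, so these are
    the densities of the positive and negative parts.\<close>
  have em: "emeasure (density lborel (\<lambda>x. ennreal (h x))) (box a b) = (\<integral>\<^sup>+x. ennreal (indicator (box a b) x * h x) \<partial>lborel)"
    if [measurable]: "h \<in> borel_measurable lborel" for a b and h :: "'a \<Rightarrow> real"
    by (subst emeasure_density) (auto intro!: nn_integral_cong simp: indicator_def)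
  have em1: "emeasure (density lborel (\<lambda>x. ennreal (f' x))) (box a b) = (\<integral>\<^sup>+x. ennreal (indicator (box a b) x * f' x) \<partial>lborel)" for a b
    by (rule em) simp
  have em2: "emeasure (density lborel (\<lambda>x. ennreal (- f' x))) (box a b) = (\<integral>\<^sup>+x. ennreal (- (indicator (box a b) x * f' x)) \<partial>lborel)" for a b
    by (subst em) simp_all
  have "density lborel (\<lambda>x. ennreal (f' x)) = density lborel (\<lambda>x. ennreal (- f' x))"
  proof (rule measure_eqI_generator_eq)
    let ?E = "range (\<lambda>(a, b). box a b::'a set)"
    show "Int_stable ?E" by (auto simp: Int_stable_def box_Int_box)
    show "?E \<subseteq> Pow UNIV" "sets (density lborel (\<lambda>x. ennreal (f' x))) = sigma_sets UNIV ?E"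
      "sets (density lborel (\<lambda>x. ennreal (- f' x))) = sigma_sets UNIV ?E"
      by (simp_all add: borel_eq_box)
    let ?A = "\<lambda>n::nat. box (- (real n *\<^sub>R One)) (real n *\<^sub>R One) :: 'a set"
    show "range ?A \<subseteq> ?E" "(\<Union>i. ?A i) = UNIV"
      unfolding UN_box_eq_UNIV by auto
    show "emeasure (density lborel (\<lambda>x. ennreal (f' x))) (?A i) \<noteq> \<infinity>" for i
      unfolding em1 by (rule conjunct2[OF fin])
    show "emeasure (density lborel (\<lambda>x. ennreal (f' x))) X = emeasure (density lborel (\<lambda>x. ennreal (- f' x))) X"
      if XE: "X \<in> ?E" for X
    proof -
      obtain a b where X: "X = box a b" using XE by (auto simp: image_iff)
      show ?thesis unfolding X em1 em2 by (rule conjunct1[OF fin])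
    qed
  qed
  then have "AE x in lborel. ennreal (f' x) = ennreal (- f' x)"
    by (intro sigma_finite_measure.density_unique[OF sigma_finite_lborel]) auto
  then have "AE x in lborel. f' x = 0"
  proof eventually_elim
    case (elim x)
    then show ?case by (cases "f' x > 0"; cases "f' x < 0") (auto simp: ennreal_neg ennreal_eq_0_iff dest: sym)
  qed
  then have "AE x in lebesgue. f' x = 0" by (rule AE_completion)
  with ae' show ?thesis by eventually_elim simp
qed

lemma test_fun_zero: "(\<lambda>x. 0) \<in> test_fun \<Omega>"
  by (auto simp: test_fun_def intro: C_k_const)

text \<open>Bumps converge boundedly to indicators of boxes, so all integrals of \<open>G\<close> over boxes vanish.\<close>

lemma AE_zero_if_test_field_integrals_zero:
  fixes G :: "real^'n \<Rightarrow> real^'n"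
  assumes G: "G \<in> L1_loc" and zero: "\<And>\<Phi>. \<Phi> \<in> test_field UNIV \<Longrightarrow> (LINT x|lebesgue. G x \<bullet> \<Phi> x) = 0"
  shows "AE x in lebesgue. G x = 0"
proof -
  have [measurable]: "G \<in> borel_measurable lebesgue" using G by (simp add: L1_loc_def)
  have "AE x in lebesgue. G x $ j = 0" for j
  proof (rule AE_zero_if_box_integrals_zero)
    have "(\<lambda>x. G x \<bullet> axis j 1) \<in> borel_measurable lebesgue" by measurable
    then show m[measurable]: "(\<lambda>x. G x $ j) \<in> borel_measurable lebesgue" by (simp add: inner_axis)
    have cI: "integrable lebesgue (\<lambda>x. indicator (cbox a b) x * \<bar>G x $ j\<bar>)" for a b :: "real^'n"
    proof -
      have "integrable lebesgue (\<lambda>x. indicator (cbox a b) x *\<^sub>R G x)"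
        using G by (auto simp: L1_loc_def set_integrable_def)
      then have "integrable lebesgue (\<lambda>x. norm (indicator (cbox a b) x *\<^sub>R G x))" by (rule integrable_norm)
      moreover have "(\<lambda>x. indicator (cbox a b) x * \<bar>G x $ j\<bar>) \<in> borel_measurable lebesgue"
        by (intro borel_measurable_times borel_measurable_abs m borel_measurable_indicator) simp
      ultimately show ?thesis
        by (rule Bochner_Integration.integrable_bound)
          (auto simp: abs_mult intro!: AE_I2 mult_left_mono component_le_norm_cart)
    qed
    fix a b :: "real^'n"
    have bc: "indicator (box a b) x \<le> (indicator (cbox a b) x :: real)" for x
      using box_subset_cbox[of a b] by (auto simp: indicator_def)
    have mi: "(\<lambda>x. indicator (box a b) x * G x $ j) \<in> borel_measurable lebesgue"
      by (intro borel_measurable_times m borel_measurable_indicator) simp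
    show "set_integrable lebesgue (box a b) (\<lambda>x. G x $ j)"
      unfolding set_integrable_def
      by (rule Bochner_Integration.integrable_bound[OF cI[of a b]])
        (use mi bc in \<open>auto simp: abs_mult intro!: AE_I2 mult_right_mono\<close>)
    have "(\<lambda>n. LINT x|lebesgue. box_bump n a b x * G x $ j) \<longlonglongrightarrow> (LINT x|lebesgue. indicator (box a b) x * G x $ j)"
    proof (rule integral_dominated_convergence[OF _ _ cI[of a b]])
      show "AE x in lebesgue. (\<lambda>n. box_bump n a b x * G x $ j) \<longlonglongrightarrow> indicator (box a b) x * G x $ j"
        by (intro AE_I2 tendsto_mult box_bump_tendsto tendsto_const)
      fix n
      have "continuous_on UNIV (box_bump n a b)"
        using box_bump_test_fun[of n a b] C_k_continuous[of 0] by (auto simp: test_fun_def simp del: C_k.simps)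
      then have [measurable]: "box_bump n a b \<in> borel_measurable lborel"
        by (simp add: borel_measurable_continuous_onI)
      then have [measurable]: "box_bump n a b \<in> borel_measurable lebesgue" by (rule measurable_completion)
      show "(\<lambda>x. box_bump n a b x * G x $ j) \<in> borel_measurable lebesgue"
        by (intro borel_measurable_times m) simp
      have "box_bump n a b x \<le> indicator (cbox a b) x" for x
        using box_bump_bounds[of n a b x] box_bump_support[of n a b x] bc[of x] by (auto simp: indicator_def split: if_splits)
      then show "AE x in lebesgue. norm (box_bump n a b x * G x $ j) \<le> indicator (cbox a b) x * \<bar>G x $ j\<bar>"
        by (auto simp: abs_mult box_bump_bounds intro!: AE_I2 mult_right_mono)
    qed (rule mi)
    moreover have "(LINT x|lebesgue. box_bump n a b x * G x $ j) = 0" for n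
    proof -
      have "(\<lambda>x. box_bump n a b x *\<^sub>R axis j 1) \<in> test_field UNIV"
        using box_bump_test_fun[of n a b] test_fun_zero by (auto simp: test_field_def axis_def)
      from zero[OF this] show ?thesis by (simp add: inner_axis)
    qed
    ultimately have "(\<lambda>n. 0::real) \<longlonglongrightarrow> (LINT x|lebesgue. indicator (box a b) x * G x $ j)" by simp
    then have "(LINT x|lebesgue. indicator (box a b) x * G x $ j) = 0" by (rule LIMSEQ_unique[OF tendsto_const, symmetric])
    then show "(LINT x:box a b|lebesgue. G x $ j) = 0" by (simp add: set_lebesgue_integral_def)
  qed
  then have "AE x in lebesgue. \<forall>j. G x $ j = 0" by (subst AE_all_countable) auto
  then show ?thesis by eventually_elim (simp add: vec_eq_iff)
qed

section \<open>Integrability of powers of the norm\<close>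

lemma nn_integral_even_finite:
  fixes h :: "real \<Rightarrow> real"
  assumes [measurable]: "h \<in> borel_measurable borel" and even: "\<And>t. h (- t) = h t"
    and fin: "(\<integral>\<^sup>+t. ennreal (h t) * indicator {0..} t \<partial>lborel) < \<infinity>"
  shows "(\<integral>\<^sup>+t. ennreal (h t) \<partial>lborel) < \<infinity>"
proof -
  have "(\<integral>\<^sup>+t. ennreal (h t) \<partial>lborel)
      \<le> (\<integral>\<^sup>+t. ennreal (h t) * indicator {0..} t + ennreal (h t) * indicator {..0} t \<partial>lborel)"
    by (intro nn_integral_mono) (auto simp: indicator_def)
  also have "\<dots> = (\<integral>\<^sup>+t. ennreal (h t) * indicator {0..} t \<partial>lborel) + (\<integral>\<^sup>+t. ennreal (h t) * indicator {..0} t \<partial>lborel)"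
    by (rule nn_integral_add) simp_all
  also have "(\<integral>\<^sup>+t. ennreal (h t) * indicator {..0} t \<partial>lborel) = (\<integral>\<^sup>+t. ennreal (h t) * indicator {0..} t \<partial>lborel)"
    by (subst nn_integral_real_affine[where c="-1" and t=0])
      (auto simp: even indicator_def intro!: nn_integral_cong)
  finally show ?thesis using fin by (auto intro: le_less_trans simp: ennreal_add_less_top)
qed

text \<open>Product functions reduce the integrability of radial powers to dimension one: \<open>|x|\<close> dominates each
  coordinate, hence \<open>|x|\<^sup>d\<close> the product of the coordinates.\<close>

lemma integrable_prod_Basis:
  fixes h :: "real \<Rightarrow> real"
  assumes [measurable]: "h \<in> borel_measurable borel" and nn: "\<And>t. 0 \<le> h t"
    and fin: "(\<integral>\<^sup>+t. ennreal (h t) \<partial>lborel) < \<infinity>"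
  shows "integrable lborel (\<lambda>x::'a::euclidean_space. \<Prod>b\<in>Basis. h (x \<bullet> b))"
proof (rule integrableI_nonneg)
  have "(\<integral>\<^sup>+x. ennreal (\<Prod>b\<in>Basis. h (x \<bullet> b)) \<partial>(lborel::'a measure))
      = (\<integral>\<^sup>+x. (\<Prod>b\<in>Basis. ennreal (h (x \<bullet> b))) \<partial>(lborel::'a measure))"
    by (simp add: prod_ennreal nn)
  also have "\<dots> = (\<Prod>b\<in>(Basis::'a set). (\<integral>\<^sup>+t. ennreal (h t) \<partial>lborel))"
    by (rule nn_integral_lborel_prod) auto
  also have "\<dots> < \<infinity>" using fin by (simp add: power_less_top_ennreal)
  finally show "(\<integral>\<^sup>+x. ennreal (\<Prod>b\<in>Basis. h (x \<bullet> b)) \<partial>(lborel::'a measure)) < \<infinity>" .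
qed (auto intro: prod_nonneg nn)

lemma nn_integral_powr_infinity:
  assumes "1 < q"
  shows "(\<integral>\<^sup>+t. ennreal ((1 + \<bar>t\<bar>) powr (- q)) \<partial>lborel) < \<infinity>"
proof (rule nn_integral_even_finite)
  have "(\<integral>\<^sup>+t. ennreal ((1 + \<bar>t\<bar>) powr (- q)) * indicator {0..} t \<partial>lborel)
      = ennreal (0 - (- ((1 + 0) powr (1 - q) / (q - 1))))"
  proof (rule nn_integral_FTC_atLeast)
    fix t :: real assume t: "0 \<le> t"
    have "((\<lambda>t. (1 + t) powr (1 - q)) has_real_derivative (1 - q) * (1 + t) powr (1 - q - 1) * 1) (at t)"
      using t by (intro DERIV_chain2[OF has_real_derivative_powr]) (auto intro!: derivative_eq_intros)
    then have "((\<lambda>t. - ((1 + t) powr (1 - q) / (q - 1))) has_real_derivative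
        - ((1 - q) * (1 + t) powr (1 - q - 1) * 1 / (q - 1))) (at t)"
      by (intro DERIV_minus DERIV_cdivide)
    moreover have "(1 - q) * Y / (q - 1) = - Y" for Y using assms by (simp add: divide_eq_eq algebra_simps)
    then have "- ((1 - q) * (1 + t) powr (1 - q - 1) * 1 / (q - 1)) = (1 + \<bar>t\<bar>) powr (- q)"
      using t by simp
    ultimately show "DERIV (\<lambda>t. - ((1 + t) powr (1 - q) / (q - 1))) t :> (1 + \<bar>t\<bar>) powr (- q)" by simp
  next
    have "((\<lambda>t. (1 + t) powr (1 - q)) \<longlongrightarrow> 0) at_top"
      using assms by (intro tendsto_neg_powr filterlim_tendsto_add_at_top[OF tendsto_const filterlim_ident]) auto
    then have "((\<lambda>t. - ((1 + t) powr (1 - q) / (q - 1))) \<longlongrightarrow> - (0 / (q - 1))) at_top"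
      using assms by (intro tendsto_intros) auto
    then show "((\<lambda>t. - ((1 + t) powr (1 - q) / (q - 1))) \<longlongrightarrow> 0) at_top" by simp
  qed auto
  then show "(\<integral>\<^sup>+t. ennreal ((1 + \<bar>t\<bar>) powr (- q)) * indicator {0..} t \<partial>lborel) < \<infinity>" by simp
qed auto

lemma nn_integral_powr_zero:
  fixes a R :: real
  assumes "a < 1" "0 \<le> R"
  shows "(\<integral>\<^sup>+t. ennreal (indicator {-R..R} t * \<bar>t\<bar> powr (- a)) \<partial>lborel) < \<infinity>"
proof (rule nn_integral_even_finite)
  have "((\<lambda>t. t powr (- a)) has_integral (R powr (- a + 1) / (- a + 1))) {0..R}"
    by (rule has_integral_powr_from_0) (use assms in auto)
  then have "((\<lambda>t. if t \<in> {0..R} then t powr (- a) else 0) has_integral (R powr (- a + 1) / (- a + 1))) UNIV"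
    by (simp only: has_integral_restrict_UNIV)
  then have I: "(\<integral>\<^sup>+t. ennreal (if t \<in> {0..R} then t powr (- a) else 0) \<partial>lborel) = ennreal (R powr (- a + 1) / (- a + 1))"
    by (intro nn_integral_has_integral_lborel) auto
  have "(\<integral>\<^sup>+t. ennreal (indicator {-R..R} t * \<bar>t\<bar> powr (- a)) * indicator {0..} t \<partial>lborel)
      = (\<integral>\<^sup>+t. ennreal (if t \<in> {0..R} then t powr (- a) else 0) \<partial>lborel)"
    using assms(2) by (intro nn_integral_cong) (auto simp: indicator_def)
  then show "(\<integral>\<^sup>+t. ennreal (indicator {-R..R} t * \<bar>t\<bar> powr (- a)) * indicator {0..} t \<partial>lborel) < \<infinity>"
    unfolding I by simp
qed (auto simp: indicator_def)

lemma AE_inner_Basis_nonzero: "AE x in lborel. \<forall>b\<in>Basis. (x::'a::euclidean_space) \<bullet> b \<noteq> 0"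
proof -
  have "AE x in lborel. (x::'a) \<bullet> b \<noteq> 0" if "b \<in> Basis" for b
  proof -
    have "negligible {x::'a. b \<bullet> x = 0}" by (rule negligible_hyperplane) (use that in auto)
    then have "{x::'a. b \<bullet> x = 0} \<in> null_sets lebesgue" by (simp add: negligible_iff_null_sets)
    then have "AE x in lebesgue. x \<notin> {x::'a. b \<bullet> x = 0}" by (rule AE_not_in)
    then show ?thesis by (simp add: AE_completion_iff inner_commute)
  qed
  then show ?thesis by (intro AE_finite_allI) auto
qed

text \<open>Distribute the exponent over the coordinates: \<open>|z|\<^sup>-\<^sup>a \<le> \<Prod> |z\<^sub>b|\<^sup>-\<^sup>a\<^sup>/\<^sup>d\<close>, with \<open>a / d < 1\<close>. Since
  \<open>0 powr _ = 0\<close>, this holds off the coordinate hyperplanes only.\<close>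

lemma integrable_norm_powr_cball:
  fixes a R :: real
  assumes a: "0 \<le> a" "a < DIM('a::euclidean_space)" and R: "0 \<le> R"
  shows "integrable lborel (\<lambda>z::'a. indicator (cball 0 R) z * norm z powr (- a))"
proof -
  let ?d = "real DIM('a)"
  let ?h = "\<lambda>t. indicator {-R..R} t * \<bar>t\<bar> powr (- (a / ?d)) :: real"
  have d: "0 < ?d" by simp
  have "integrable lborel (\<lambda>x::'a. \<Prod>b\<in>Basis. ?h (x \<bullet> b))"
    by (rule integrable_prod_Basis) (use a R nn_integral_powr_zero[of "a / ?d" R] in auto)
  then show ?thesis
  proof (rule Bochner_Integration.integrable_bound)
    show "AE z::'a in lborel. norm (indicator (cball 0 R) z * norm z powr (- a)) \<le> norm (\<Prod>b\<in>Basis. ?h (z \<bullet> b))"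
      using AE_inner_Basis_nonzero
    proof eventually_elim
      fix z :: 'a assume nz: "\<forall>b\<in>Basis. z \<bullet> b \<noteq> 0"
      show "norm (indicator (cball 0 R) z * norm z powr (- a)) \<le> norm (\<Prod>b\<in>Basis. ?h (z \<bullet> b))"
      proof (cases "norm z \<le> R")
        case True
        have z: "0 < norm z" using nz by (metis inner_zero_left nonempty_Basis ex_in_conv zero_less_norm_iff)
        have "norm z powr (- a) = (\<Prod>b\<in>(Basis::'a set). norm z powr (- (a / ?d)))"
          using z by (simp add: powr_realpow[symmetric] powr_powr)
        also have "\<dots> \<le> (\<Prod>b\<in>Basis. ?h (z \<bullet> b))"
        proof (rule prod_mono, intro conjI)
          fix b :: 'a assume b: "b \<in> Basis"
          have le: "\<bar>z \<bullet> b\<bar> \<le> norm z" by (rule Basis_le_norm[OF b])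
          then have "norm z powr (- (a / ?d)) \<le> \<bar>z \<bullet> b\<bar> powr (- (a / ?d))"
            using nz b a by (intro powr_mono2') auto
          then show "norm z powr (- (a / ?d)) \<le> ?h (z \<bullet> b)" using le True by (auto simp: indicator_def)
        qed auto
        finally show ?thesis using True by simp
      qed (simp add: indicator_def)
    qed
  qed (intro borel_measurable_times borel_measurable_indicator powr_real_measurable borel_measurable_const, auto)
qed

text \<open>Bounded and \<open>O(|x|\<^sup>-\<^sup>d)\<close> at infinity. This rate is what the Riesz transform of a test function has,
  and it just suffices for integrability of all powers greater than \<open>1\<close>.\<close>

definition bounded_decay :: "(real^'n \<Rightarrow> real) \<Rightarrow> bool" where
  "bounded_decay g \<longleftrightarrow> g \<in> borel_measurable borel \<and>
     (\<exists>C. \<forall>x. \<bar>g x\<bar> \<le> C \<and> \<bar>g x\<bar> * norm x ^ CARD('n) \<le> C)"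

lemma bounded_decayI:
  assumes "g \<in> borel_measurable borel" "\<And>x. \<bar>g x\<bar> \<le> B"
    "\<And>x. R \<le> norm x \<Longrightarrow> \<bar>g x\<bar> * norm x ^ CARD('n) \<le> D"
  shows "bounded_decay (g :: real^'n \<Rightarrow> real)"
  unfolding bounded_decay_def
proof (intro conjI exI allI)
  have B: "0 \<le> B" using assms(2)[of 0] by linarith
  let ?C = "max (max B D) (B * \<bar>R\<bar> ^ CARD('n))"
  fix x
  show "\<bar>g x\<bar> \<le> ?C" using assms(2)[of x] by linarith
  show "\<bar>g x\<bar> * norm x ^ CARD('n) \<le> ?C"
  proof (cases "R \<le> norm x")
    case True then show ?thesis using assms(3)[of x] by linarith
  next
    case False
    have "\<bar>g x\<bar> * norm x ^ CARD('n) \<le> B * \<bar>R\<bar> ^ CARD('n)"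
      using False assms(2)[of x] B by (intro mult_mono power_mono) auto
    then show ?thesis by linarith
  qed
qed fact

lemma bounded_decay_cmult:
  assumes "bounded_decay g"
  shows "bounded_decay (\<lambda>x. c * g x)"
proof -
  obtain C where C: "g \<in> borel_measurable borel" "\<And>x. \<bar>g x\<bar> \<le> C" "\<And>x. \<bar>g x\<bar> * norm x ^ CARD('a) \<le> C"
    using assms by (auto simp: bounded_decay_def)
  show ?thesis
  proof (rule bounded_decayI[where B="\<bar>c\<bar> * C" and D="\<bar>c\<bar> * C"])
    show "(\<lambda>x. c * g x) \<in> borel_measurable borel" using C(1) by simp
    show "\<bar>c * g x\<bar> \<le> \<bar>c\<bar> * C" for x using C(2) by (simp add: abs_mult mult_left_mono)
    show "\<bar>c * g x\<bar> * norm x ^ CARD('a) \<le> \<bar>c\<bar> * C" for x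
      using mult_left_mono[OF C(3)[of x], of "\<bar>c\<bar>"] by (simp add: abs_mult mult.assoc)
  qed
qed

text \<open>The bounds combine to \<open>|g x| \<le> C / \<Prod> (1 + |x\<^sub>b|)\<close>, whose \<open>q\<close>-th power is a product of integrable
  functions of one variable.\<close>

lemma bounded_decay_integrable_powr:
  fixes g :: "real^'n \<Rightarrow> real"
  assumes g: "bounded_decay g" and q: "1 < q"
  shows "integrable lborel (\<lambda>x. \<bar>g x\<bar> powr q)"
proof -
  obtain C where C: "g \<in> borel_measurable borel" "\<And>x. \<bar>g x\<bar> \<le> C" "\<And>x. \<bar>g x\<bar> * norm x ^ CARD('n) \<le> C"
    using g by (auto simp: bounded_decay_def)
  have C0: "0 \<le> C" using C(2)[of 0] by linarith
  let ?P = "\<lambda>x::real^'n. \<Prod>b\<in>Basis. (1 + \<bar>x \<bullet> b\<bar>)"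
  have P: "0 < ?P x" for x by (intro prod_pos) (auto intro: add_pos_nonneg)
  have key: "\<bar>g x\<bar> * ?P x \<le> 2 ^ CARD('n) * (2 * C)" for x
  proof -
    have "?P x \<le> (\<Prod>b\<in>(Basis::(real^'n) set). 1 + norm x)"
      by (intro prod_mono) (auto simp: Basis_le_norm)
    also have "\<dots> = (1 + norm x) ^ CARD('n)" by simp
    also have "\<dots> \<le> (2 * max 1 (norm x)) ^ CARD('n)" by (intro power_mono) auto
    also have "\<dots> = 2 ^ CARD('n) * max 1 (norm x) ^ CARD('n)" by (simp add: power_mult_distrib)
    also have "max 1 (norm x) ^ CARD('n) \<le> 1 + norm x ^ CARD('n)" by (auto simp: max_def)
    finally have "?P x \<le> 2 ^ CARD('n) * (1 + norm x ^ CARD('n))" by simp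
    then have "\<bar>g x\<bar> * ?P x \<le> \<bar>g x\<bar> * (2 ^ CARD('n) * (1 + norm x ^ CARD('n)))"
      by (intro mult_left_mono) auto
    also have "\<dots> = 2 ^ CARD('n) * (\<bar>g x\<bar> + \<bar>g x\<bar> * norm x ^ CARD('n))" by (simp add: algebra_simps)
    also have "\<dots> \<le> 2 ^ CARD('n) * (2 * C)" using C(2,3)[of x] by (intro mult_left_mono) auto
    finally show ?thesis .
  qed
  let ?D = "2 ^ CARD('n) * (2 * C)"
  have "integrable lborel (\<lambda>x::real^'n. \<Prod>b\<in>Basis. (1 + \<bar>x \<bullet> b\<bar>) powr (- q))"
    by (rule integrable_prod_Basis) (use nn_integral_powr_infinity[OF q] in auto)
  then have "integrable lborel (\<lambda>x::real^'n. ?D powr q * (\<Prod>b\<in>Basis. (1 + \<bar>x \<bullet> b\<bar>) powr (- q)))"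
    by (rule integrable_mult_right)
  then show ?thesis
  proof (rule Bochner_Integration.integrable_bound)
    show "(\<lambda>x. \<bar>g x\<bar> powr q) \<in> borel_measurable lborel" using C(1) by simp
    show "AE x in lborel. norm (\<bar>g x\<bar> powr q) \<le> norm (?D powr q * (\<Prod>b\<in>Basis. (1 + \<bar>x \<bullet> b\<bar>) powr (- q)))"
    proof (rule AE_I2)
      fix x
      have "\<bar>g x\<bar> \<le> ?D / ?P x" using key[of x] P[of x] by (simp add: pos_le_divide_eq)
      then have "\<bar>g x\<bar> powr q \<le> (?D / ?P x) powr q" using q by (intro powr_mono2) auto
      also have "\<dots> = ?D powr q * ?P x powr (- q)" by (simp add: powr_divide powr_minus_divide)
      also have "?P x powr (- q) = (\<Prod>b\<in>Basis. (1 + \<bar>x \<bullet> b\<bar>) powr (- q))" by (rule prod_powr_distrib)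
      finally show "norm (\<bar>g x\<bar> powr q) \<le> norm (?D powr q * (\<Prod>b\<in>Basis. (1 + \<bar>x \<bullet> b\<bar>) powr (- q)))"
        by (simp add: abs_mult prod_nonneg)
    qed
  qed
qed

section \<open>Test functions have bounded derivatives\<close>

lemma test_funD:
  assumes "\<phi> \<in> test_fun \<Omega>"
  shows "\<phi> differentiable (at x)" "continuous_on UNIV \<phi>" "\<phi> \<in> borel_measurable borel"
proof -
  have C: "C_k k \<phi>" for k using assms by (simp add: test_fun_def)
  show "\<phi> differentiable (at x)" using C[of 1] by simp
  show c: "continuous_on UNIV \<phi>" using C[of 0] by simp
  then show "\<phi> \<in> borel_measurable borel" by (rule borel_measurable_continuous_onI)
qed

lemma gradient_nonzero_in_support:
  assumes "gradient f x \<noteq> 0"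
  shows "x \<in> closure {y. f y \<noteq> 0}"
proof (rule ccontr)
  assume x: "x \<notin> closure {y. f y \<noteq> 0}"
  have "((\<lambda>_. 0::real) has_derivative (\<lambda>_. 0)) (at x)" by (rule has_derivative_const)
  then have "(f has_derivative (\<lambda>_. 0)) (at x)"
    by (rule has_derivative_transform_within_open[where s="- closure {y. f y \<noteq> 0}"])
      (use x closure_subset[of "{y. f y \<noteq> 0}"] in auto)
  then have "gradient f x = 0" by (simp add: vec_eq_iff gradient_nth)
  then show False using assms by simp
qed

lemma test_fun_gradient:
  assumes "\<phi> \<in> test_fun \<Omega>"
  shows "(\<lambda>x. gradient \<phi> x $ j) \<in> test_fun \<Omega>"
proof -
  have C: "C_k (Suc k) \<phi>" for k using assms unfolding test_fun_def by blast
  have "C_k k (\<lambda>x. gradient \<phi> x $ j)" for k using C[of k] by simp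
  moreover have sub: "closure {x. gradient \<phi> x $ j \<noteq> 0} \<subseteq> closure {x. \<phi> x \<noteq> 0}"
    by (intro closure_minimal subsetI closed_closure gradient_nonzero_in_support) auto
  moreover have "compact (closure {x. gradient \<phi> x $ j \<noteq> 0})"
    using compact_Int_closed[of "closure {x. \<phi> x \<noteq> 0}" "closure {x. gradient \<phi> x $ j \<noteq> 0}"] sub assms
    by (simp add: test_fun_def Int_absorb1)
  ultimately show ?thesis using assms by (auto simp: test_fun_def)
qed

lemma test_fun_bounded:
  assumes "\<phi> \<in> test_fun \<Omega>"
  obtains R B where "0 < R" "0 \<le> B" "\<And>x. R < norm x \<Longrightarrow> \<phi> x = 0" "\<And>x. \<bar>\<phi> x\<bar> \<le> B"
proof -
  let ?S = "closure {x. \<phi> x \<noteq> 0}"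
  have S: "compact ?S" using assms by (simp add: test_fun_def)
  obtain R where R: "0 < R" "\<And>x. x \<in> ?S \<Longrightarrow> norm x \<le> R"
    using compact_imp_bounded[OF S] by (auto simp: bounded_pos)
  have "compact (\<phi> ` ?S)"
    using S test_funD(2)[OF assms] by (intro compact_continuous_image) (auto intro: continuous_on_subset)
  then have "bounded (\<phi> ` ?S)" by (rule compact_imp_bounded)
  then obtain B where B: "0 < B" "\<And>y. y \<in> \<phi> ` ?S \<Longrightarrow> norm y \<le> B"
    unfolding bounded_pos by blast
  have in_S: "x \<in> ?S" if "\<phi> x \<noteq> 0" for x using that closure_subset[of "{x. \<phi> x \<noteq> 0}"] by auto
  show ?thesis
  proof (rule that[OF R(1), of B])
    show "\<phi> x = 0" if "R < norm x" for x using in_S[of x] R(2)[of x] that by linarith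
    show "\<bar>\<phi> x\<bar> \<le> B" for x using in_S[of x] B by (cases "\<phi> x = 0") auto
  qed (use B in auto)
qed

lemma test_fun_gradient_bounded:
  assumes "\<phi> \<in> test_fun \<Omega>"
  obtains L where "0 \<le> L" "\<And>x. norm (gradient \<phi> x) \<le> L"
proof -
  have "\<exists>B. 0 \<le> B \<and> (\<forall>x. \<bar>gradient \<phi> x $ j\<bar> \<le> B)" for j
    by (rule test_fun_bounded[OF test_fun_gradient[OF assms, of j]]) blast
  then obtain B where B: "\<And>j. 0 \<le> B j" "\<And>j x. \<bar>gradient \<phi> x $ j\<bar> \<le> B j" by metis
  show ?thesis
  proof (rule that[of "sum B UNIV"])
    show "norm (gradient \<phi> x) \<le> sum B UNIV" for x
      by (rule order_trans[OF norm_le_l1_cart sum_mono]) (rule B)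
  qed (auto intro: sum_nonneg B)
qed

lemma test_fun_lipschitz:
  assumes "\<phi> \<in> test_fun \<Omega>"
  obtains L where "0 \<le> L" "\<And>x y. \<bar>\<phi> x - \<phi> y\<bar> \<le> L * norm (x - y)"
proof -
  obtain L where L: "0 \<le> L" "\<And>x. norm (gradient \<phi> x) \<le> L"
    using test_fun_gradient_bounded[OF assms] by blast
  have "norm (\<phi> x - \<phi> y) \<le> L * norm (x - y)" for x y
  proof (rule differentiable_bound[where S=UNIV and f'="\<lambda>x h. gradient \<phi> x \<bullet> h"])
    show "onorm (\<lambda>h. gradient \<phi> x \<bullet> h) \<le> L" for x
    proof (rule onorm_le)
      fix h
      have "\<bar>gradient \<phi> x \<bullet> h\<bar> \<le> norm (gradient \<phi> x) * norm h" by (rule Cauchy_Schwarz_ineq2)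
      also have "\<dots> \<le> L * norm h" by (intro mult_right_mono L) simp
      finally show "norm (gradient \<phi> x \<bullet> h) \<le> L * norm h" by simp
    qed
  qed (auto intro: has_derivative_gradient test_funD[OF assms])
  then show ?thesis using that L(1) by simp
qed

text \<open>The gradient is Lipschitz because its components are test functions again.\<close>

lemma test_fun_taylor:
  assumes "\<phi> \<in> test_fun \<Omega>"
  obtains M where "0 \<le> M" "\<And>x h. \<bar>\<phi> (x + h) - \<phi> x - gradient \<phi> x \<bullet> h\<bar> \<le> M * (norm h)\<^sup>2"
proof -
  have "\<exists>L. 0 \<le> L \<and> (\<forall>x y. \<bar>gradient \<phi> x $ j - gradient \<phi> y $ j\<bar> \<le> L * norm (x - y))" for j
    by (rule test_fun_lipschitz[OF test_fun_gradient[OF assms, of j]]) blast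
  then obtain L where L: "\<And>j. 0 \<le> L j" "\<And>j x y. \<bar>gradient \<phi> x $ j - gradient \<phi> y $ j\<bar> \<le> L j * norm (x - y)" by metis
  let ?M = "sum L UNIV"
  have M0: "0 \<le> ?M" by (intro sum_nonneg L)
  have G: "norm (gradient \<phi> x - gradient \<phi> y) \<le> ?M * norm (x - y)" for x y
  proof -
    have "norm (gradient \<phi> x - gradient \<phi> y) \<le> (\<Sum>j\<in>UNIV. \<bar>(gradient \<phi> x - gradient \<phi> y) $ j\<bar>)"
      by (rule norm_le_l1_cart)
    also have "\<dots> \<le> (\<Sum>j\<in>UNIV. L j * norm (x - y))" by (intro sum_mono) (simp add: L)
    finally show ?thesis by (simp add: sum_distrib_right)
  qed
  show ?thesis
  proof (rule that[OF M0])
    fix x h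
    let ?g = "\<lambda>w. \<phi> w - gradient \<phi> x \<bullet> w"
    have "norm (?g (x + h) - ?g x) \<le> (?M * norm h) * norm ((x + h) - x)"
    proof (rule differentiable_bound[where S="cball x (norm h)" and f'="\<lambda>w k. (gradient \<phi> w - gradient \<phi> x) \<bullet> k"])
      fix w assume w: "w \<in> cball x (norm h)"
      have "(\<phi> has_derivative (\<lambda>k. gradient \<phi> w \<bullet> k)) (at w within cball x (norm h))"
        by (rule has_derivative_at_withinI[OF has_derivative_gradient[OF test_funD(1)[OF assms]]])
      then show "(?g has_derivative (\<lambda>k. (gradient \<phi> w - gradient \<phi> x) \<bullet> k)) (at w within cball x (norm h))"
        by (auto intro!: derivative_eq_intros simp: inner_diff_left)
      show "onorm (\<lambda>k. (gradient \<phi> w - gradient \<phi> x) \<bullet> k) \<le> ?M * norm h"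
      proof (rule onorm_le)
        fix k
        have "\<bar>(gradient \<phi> w - gradient \<phi> x) \<bullet> k\<bar> \<le> norm (gradient \<phi> w - gradient \<phi> x) * norm k"
          by (rule Cauchy_Schwarz_ineq2)
        also have "norm (gradient \<phi> w - gradient \<phi> x) \<le> ?M * norm (w - x)" by (rule G)
        also have "?M * norm (w - x) \<le> ?M * norm h"
          using w M0 by (intro mult_left_mono) (auto simp: dist_norm norm_minus_commute)
        finally show "norm ((gradient \<phi> w - gradient \<phi> x) \<bullet> k) \<le> ?M * norm h * norm k"
          by (simp add: mult_right_mono)
      qed
    qed (auto simp: dist_norm)
    then show "\<bar>\<phi> (x + h) - \<phi> x - gradient \<phi> x \<bullet> h\<bar> \<le> ?M * (norm h)\<^sup>2"
      by (simp add: inner_add_right power2_eq_square algebra_simps)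
  qed
qed

lemma test_fun_bounded_decay:
  assumes "\<phi> \<in> test_fun \<Omega>"
  shows "bounded_decay \<phi>"
proof -
  obtain R B where RB: "0 < R" "0 \<le> B" "\<And>x. R < norm x \<Longrightarrow> \<phi> x = 0" "\<And>x. \<bar>\<phi> x\<bar> \<le> B"
    using test_fun_bounded[OF assms] by blast
  show ?thesis
    by (rule bounded_decayI[where B=B and R="R + 1" and D=0]) (use RB test_funD(3)[OF assms] in auto)
qed

lemma test_fun_integrable:
  assumes "\<phi> \<in> test_fun \<Omega>"
  shows "integrable lborel \<phi>"
proof -
  obtain R B where RB: "0 < R" "0 \<le> B" "\<And>x. R < norm x \<Longrightarrow> \<phi> x = 0" "\<And>x. \<bar>\<phi> x\<bar> \<le> B"
    using test_fun_bounded[OF assms] by blast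
  have "integrable lborel (\<lambda>x. indicator (cball 0 R) x * B)"
    using emeasure_bounded_finite[OF bounded_cball, of 0 R]
    by (intro integrable_mult_left integrable_real_indicator) simp_all
  then show ?thesis
  proof (rule Bochner_Integration.integrable_bound)
    show "AE x in lborel. norm (\<phi> x) \<le> norm (indicator (cball 0 R) x * B)"
      using RB(2,3,4) by (intro AE_I2) (auto simp: indicator_def not_le)
  qed (use test_funD(3)[OF assms] in simp)
qed

section \<open>Convolution with a locally integrable kernel\<close>

lemma distr_lborel_reflect: "distr lborel borel (\<lambda>z::'a::euclidean_space. x - z) = lborel"
  using lborel_affine[of "-1" x] by (simp add: density_1)

lemma lborel_integral_reflect:
  fixes f :: "'a::euclidean_space \<Rightarrow> real"
  assumes [measurable]: "f \<in> borel_measurable borel"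
  shows "(LINT z|lborel. f (x - z)) = (LINT y|lborel. f y)"
proof -
  have "(LINT y|lborel. f y) = (LINT y|distr lborel borel (\<lambda>z::'a. x - z). f y)"
    by (simp only: distr_lborel_reflect)
  also have "\<dots> = (LINT z|lborel. f (x - z))" by (rule integral_distr) auto
  finally show ?thesis by simp
qed

lemma lborel_integrable_reflect:
  fixes f :: "'a::euclidean_space \<Rightarrow> real"
  assumes f: "integrable lborel f"
  shows "integrable lborel (\<lambda>z. f (x - z))"
proof -
  have "integrable (distr lborel borel (\<lambda>z::'a. x - z)) f" using f by (simp only: distr_lborel_reflect)
  then show ?thesis by (subst (asm) integrable_distr_eq) (use f in auto)
qed

definition locally_integrable :: "(real^'n \<Rightarrow> real) \<Rightarrow> bool" where
  "locally_integrable K \<longleftrightarrow> K \<in> borel_measurable borel \<and>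
     (\<forall>R\<ge>0. integrable lborel (\<lambda>z. indicator (cball 0 R) z * K z))"

text \<open>Convolution with all derivatives falling on \<open>\<phi>\<close>; only local integrability of the kernel is needed
  when \<open>\<phi>\<close> has compact support.\<close>

definition conv :: "(real^'n \<Rightarrow> real) \<Rightarrow> (real^'n \<Rightarrow> real) \<Rightarrow> real^'n \<Rightarrow> real" where
  "conv K \<phi> x = (LINT z|lborel. K z * \<phi> (x - z))"

lemma conv_alt:
  assumes [measurable]: "K \<in> borel_measurable borel" "\<phi> \<in> borel_measurable borel"
  shows "conv K \<phi> x = (LINT y|lborel. \<phi> y * K (x - y))"
  using lborel_integral_reflect[of "\<lambda>y. \<phi> y * K (x - y)" x] by (simp add: conv_def mult.commute)

lemma locally_integrable_mult:
  assumes K: "locally_integrable K" and \<phi>: "\<phi> \<in> borel_measurable borel" "\<And>z. \<bar>\<phi> z\<bar> \<le> B" "\<And>z. R < norm z \<Longrightarrow> \<phi> z = 0"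
  shows "integrable lborel (\<lambda>z. K z * \<phi> z)"
proof -
  have "integrable lborel (\<lambda>z. B * (indicator (cball 0 \<bar>R\<bar>) z * K z))"
    using K by (intro integrable_mult_right) (simp add: locally_integrable_def)
  then show ?thesis
  proof (rule Bochner_Integration.integrable_bound)
    show "AE z in lborel. norm (K z * \<phi> z) \<le> norm (B * (indicator (cball 0 \<bar>R\<bar>) z * K z))"
    proof (rule AE_I2)
      fix z
      have "0 \<le> B" using \<phi>(2)[of 0] by linarith
      then show "norm (K z * \<phi> z) \<le> norm (B * (indicator (cball 0 \<bar>R\<bar>) z * K z))"
        using \<phi>(2)[of z] \<phi>(3)[of z] by (cases "R < norm z") (auto simp: abs_mult mult.commute[of "\<bar>K z\<bar>"] indicator_def intro: mult_right_mono)
    qed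
  next
    have [measurable]: "K \<in> borel_measurable borel" using K by (simp add: locally_integrable_def)
    note [measurable] = \<phi>(1)
    show "(\<lambda>z. K z * \<phi> z) \<in> borel_measurable lborel" by measurable
  qed
qed

lemma conv_integrable:
  assumes K: "locally_integrable K" and \<phi>: "\<phi> \<in> test_fun \<Omega>"
  shows "integrable lborel (\<lambda>z. K z * \<phi> (x - z))"
proof -
  obtain R B where RB: "0 < R" "0 \<le> B" "\<And>x. R < norm x \<Longrightarrow> \<phi> x = 0" "\<And>x. \<bar>\<phi> x\<bar> \<le> B"
    using test_fun_bounded[OF \<phi>] by blast
  note [measurable] = test_funD(3)[OF \<phi>]
  show ?thesis
  proof (rule locally_integrable_mult[OF K])
    show "\<phi> (x - z) = 0" if "R + norm x < norm z" for z
      using that norm_triangle_ineq2[of z x] by (intro RB) (simp add: norm_minus_commute)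
    show "\<bar>\<phi> (x - z)\<bar> \<le> B" for z by (rule RB)
  qed measurable
qed

lemma conv_measurable:
  assumes [measurable]: "K \<in> borel_measurable borel" "\<phi> \<in> borel_measurable borel"
  shows "conv K \<phi> \<in> borel_measurable borel"
proof -
  have "(\<lambda>x. LINT z|lborel. K z * \<phi> (x - z)) \<in> borel_measurable lborel"
    by (rule lborel.borel_measurable_lebesgue_integral) measurable
  then show ?thesis by (simp add: conv_def[abs_def])
qed

text \<open>Near the origin \<open>\<phi>\<close> is bounded and \<open>K\<close> integrable; elsewhere \<open>K\<close> is bounded and \<open>\<phi>\<close> integrable.\<close>

lemma conv_bounded:
  assumes K: "locally_integrable K" "\<And>z. 1 < norm z \<Longrightarrow> \<bar>K z\<bar> \<le> 1" and \<phi>: "\<phi> \<in> test_fun \<Omega>"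
  obtains C where "\<And>x. \<bar>conv K \<phi> x\<bar> \<le> C"
proof -
  obtain R B where RB: "0 < R" "0 \<le> B" "\<And>x. R < norm x \<Longrightarrow> \<phi> x = 0" "\<And>x. \<bar>\<phi> x\<bar> \<le> B"
    using test_fun_bounded[OF \<phi>] by blast
  have iK: "integrable lborel (\<lambda>z. indicator (cball 0 1) z * \<bar>K z\<bar>)"
    using integrable_norm[of lborel "\<lambda>z. indicator (cball 0 1) z * K z"] K(1) by (simp add: locally_integrable_def abs_mult)
  have i\<phi>: "integrable lborel (\<lambda>z. \<bar>\<phi> (x - z)\<bar>)" for x
    using lborel_integrable_reflect[OF integrable_norm[OF test_fun_integrable[OF \<phi>]]] by simp
  show ?thesis
  proof (rule that)
    fix x
    have "\<bar>conv K \<phi> x\<bar> \<le> (LINT z|lborel. \<bar>K z * \<phi> (x - z)\<bar>)"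
      unfolding conv_def by simp
    also have "\<dots> \<le> (LINT z|lborel. B * (indicator (cball 0 1) z * \<bar>K z\<bar>) + \<bar>\<phi> (x - z)\<bar>)"
    proof (rule integral_mono)
      show "integrable lborel (\<lambda>z. \<bar>K z * \<phi> (x - z)\<bar>)"
        using integrable_norm[OF conv_integrable[OF K(1) \<phi>]] by simp
      show "integrable lborel (\<lambda>z. B * (indicator (cball 0 1) z * \<bar>K z\<bar>) + \<bar>\<phi> (x - z)\<bar>)"
        by (intro Bochner_Integration.integrable_add integrable_mult_right iK i\<phi>)
      fix z
      show "\<bar>K z * \<phi> (x - z)\<bar> \<le> B * (indicator (cball 0 1) z * \<bar>K z\<bar>) + \<bar>\<phi> (x - z)\<bar>"
      proof (cases "norm z \<le> 1")
        case True
        have "\<bar>K z\<bar> * \<bar>\<phi> (x - z)\<bar> \<le> \<bar>K z\<bar> * B" by (intro mult_left_mono RB) simp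
        then show ?thesis using True by (simp add: abs_mult mult.commute)
      next
        case False
        then have "\<bar>K z\<bar> * \<bar>\<phi> (x - z)\<bar> \<le> 1 * \<bar>\<phi> (x - z)\<bar>" using K(2)[of z] by (intro mult_right_mono) auto
        then show ?thesis using False by (simp add: abs_mult)
      qed
    qed
    also have "\<dots> = B * (LINT z|lborel. indicator (cball 0 1) z * \<bar>K z\<bar>) + (LINT z|lborel. \<bar>\<phi> (x - z)\<bar>)"
      using iK i\<phi> by simp
    also have "(LINT z|lborel. \<bar>\<phi> (x - z)\<bar>) = (LINT z|lborel. \<bar>\<phi> z\<bar>)"
      by (rule lborel_integral_reflect) (use test_funD(3)[OF \<phi>] in simp)
    finally show "\<bar>conv K \<phi> x\<bar> \<le> B * (LINT z|lborel. indicator (cball 0 1) z * \<bar>K z\<bar>) + (LINT z|lborel. \<bar>\<phi> z\<bar>)" .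
  qed
qed

text \<open>The Taylor remainder of \<open>\<phi>\<close> is quadratic in \<open>h\<close>, uniformly, and vanishes outside a ball that does
  not depend on \<open>h\<close> for \<open>|h| \<le> 1\<close>. Integrating it against \<open>K\<close> gives a quadratic remainder for the
  convolution.\<close>

lemma conv_has_derivative:
  assumes K: "locally_integrable K" and \<phi>: "\<phi> \<in> test_fun \<Omega>"
  shows "(conv K \<phi> has_derivative (\<lambda>h. (\<chi> j. conv K (\<lambda>y. gradient \<phi> y $ j) x) \<bullet> h)) (at x)"
proof -
  obtain R B where RB: "0 < R" "0 \<le> B" "\<And>x. R < norm x \<Longrightarrow> \<phi> x = 0" "\<And>x. \<bar>\<phi> x\<bar> \<le> B"
    using test_fun_bounded[OF \<phi>] by blast
  obtain M where M: "0 \<le> M" "\<And>x h. \<bar>\<phi> (x + h) - \<phi> x - gradient \<phi> x \<bullet> h\<bar> \<le> M * (norm h)\<^sup>2"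
    using test_fun_taylor[OF \<phi>] by blast
  let ?G = "\<chi> j. conv K (\<lambda>y. gradient \<phi> y $ j) x"
  \<comment> \<open>Outside this ball neither \<open>x - z\<close> nor \<open>x + h - z\<close> meets the support if \<open>|h| \<le> 1\<close>.\<close>
  let ?R = "R + norm x + 1"
  have R0: "0 \<le> ?R" using RB(1) by simp
  have grad0: "gradient \<phi> y = 0" if "R < norm y" for y
  proof (rule ccontr)
    assume "gradient \<phi> y \<noteq> 0"
    then have "y \<in> closure {y. \<phi> y \<noteq> 0}" by (rule gradient_nonzero_in_support)
    moreover have "closure {y. \<phi> y \<noteq> 0} \<subseteq> cball 0 R"
    proof (intro closure_minimal subsetI)
      fix y assume "y \<in> {y. \<phi> y \<noteq> 0}"
      then have "\<not> R < norm y" using RB(3) by blast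
      then show "y \<in> cball 0 R" by simp
    qed simp
    ultimately show False using that by auto
  qed
  have iK: "integrable lborel (\<lambda>z. indicator (cball 0 ?R) z * \<bar>K z\<bar>)"
    using integrable_norm[of lborel "\<lambda>z. indicator (cball 0 ?R) z * K z"] K R0 by (simp add: locally_integrable_def abs_mult)
  define D where "D = (LINT z|lborel. indicator (cball 0 ?R) z * \<bar>K z\<bar>)"
  have rem: "\<bar>conv K \<phi> (x + h) - conv K \<phi> x - ?G \<bullet> h\<bar> \<le> M * D * (norm h)\<^sup>2" if h: "norm h \<le> 1" for h
  proof -
    let ?r = "\<lambda>z. \<phi> (x + h - z) - \<phi> (x - z) - gradient \<phi> (x - z) \<bullet> h"
    note i1 = conv_integrable[OF K \<phi>] and i2 = conv_integrable[OF K test_fun_gradient[OF \<phi>]]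
    have ij: "integrable lborel (\<lambda>z. K z * (gradient \<phi> (x - z) $ j * h $ j))" for j
      using integrable_mult_left[OF i2[of x j], of "h $ j"] by (simp add: mult.assoc)
    have split: "K z * ?r z = K z * \<phi> (x + h - z) - K z * \<phi> (x - z) - (\<Sum>j\<in>UNIV. K z * (gradient \<phi> (x - z) $ j * h $ j))" for z
      by (simp add: inner_vec_def sum_distrib_left right_diff_distrib)
    have G: "(\<Sum>j\<in>UNIV. LINT z|lborel. K z * (gradient \<phi> (x - z) $ j * h $ j)) = ?G \<bullet> h"
    proof -
      have "(LINT z|lborel. K z * (gradient \<phi> (x - z) $ j * h $ j)) = conv K (\<lambda>y. gradient \<phi> y $ j) x * h $ j" for j
        unfolding conv_def by (subst integral_mult_left_zero[symmetric]) (simp add: mult.assoc)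
      then show ?thesis by (simp add: inner_vec_def)
    qed
    have int: "integrable lborel (\<lambda>z. K z * ?r z)" unfolding split
      by (intro Bochner_Integration.integrable_diff Bochner_Integration.integrable_sum i1 ij)
    have "(LINT z|lborel. K z * ?r z) = (LINT z|lborel. K z * \<phi> (x + h - z)) - (LINT z|lborel. K z * \<phi> (x - z))
        - (\<Sum>j\<in>UNIV. LINT z|lborel. K z * (gradient \<phi> (x - z) $ j * h $ j))"
      unfolding split using i1 ij
      by (simp add: Bochner_Integration.integral_diff Bochner_Integration.integral_sum)
    then have eq: "conv K \<phi> (x + h) - conv K \<phi> x - ?G \<bullet> h = (LINT z|lborel. K z * ?r z)"
      unfolding G conv_def[of K \<phi>] by (rule sym)
    have "\<bar>LINT z|lborel. K z * ?r z\<bar> \<le> (LINT z|lborel. \<bar>K z * ?r z\<bar>)" by simp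
    also have "\<dots> \<le> (LINT z|lborel. M * (norm h)\<^sup>2 * (indicator (cball 0 ?R) z * \<bar>K z\<bar>))"
    proof (rule integral_mono)
      show "integrable lborel (\<lambda>z. \<bar>K z * ?r z\<bar>)" using integrable_norm[OF int] by simp
      show "integrable lborel (\<lambda>z. M * (norm h)\<^sup>2 * (indicator (cball 0 ?R) z * \<bar>K z\<bar>))"
        by (intro integrable_mult_right iK)
      fix z
      show "\<bar>K z * ?r z\<bar> \<le> M * (norm h)\<^sup>2 * (indicator (cball 0 ?R) z * \<bar>K z\<bar>)"
      proof (cases "norm z \<le> ?R")
        case True
        have "\<bar>?r z\<bar> \<le> M * (norm h)\<^sup>2" using M(2)[of "x - z" h] by (simp add: algebra_simps)
        then have "\<bar>K z\<bar> * \<bar>?r z\<bar> \<le> \<bar>K z\<bar> * (M * (norm h)\<^sup>2)" by (intro mult_left_mono) auto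
        then show ?thesis using True by (simp add: abs_mult mult.commute)
      next
        case False
        have "norm z - norm x \<le> norm (x - z)" using norm_triangle_ineq2[of z x] by (simp add: norm_minus_commute)
        moreover have "norm (x - z) - norm h \<le> norm (x + h - z)"
          using norm_triangle_ineq2[of "x - z" "-h"] by (simp add: algebra_simps)
        ultimately have "R < norm (x - z)" "R < norm (x + h - z)" using False h by linarith+
        then have "?r z = 0" using RB(3) grad0 by simp
        then show ?thesis using M(1) by simp
      qed
    qed
    also have "\<dots> = M * (norm h)\<^sup>2 * D" unfolding D_def by simp
    finally show ?thesis unfolding eq by (simp add: algebra_simps)
  qed
  show ?thesis
    unfolding has_derivative_iff_norm
  proof (intro conjI)
    show "bounded_linear ((\<bullet>) ?G)" by (rule bounded_linear_inner_right)
    have lim: "((\<lambda>y. M * D * norm (y - x)) \<longlongrightarrow> M * D * norm (x - x)) (at x)"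
      by (intro tendsto_intros)
    show "((\<lambda>y. norm (conv K \<phi> y - conv K \<phi> x - ?G \<bullet> (y - x)) / norm (y - x)) \<longlongrightarrow> 0) (at x)"
    proof (rule tendsto_sandwich[OF _ _ tendsto_const])
      show "((\<lambda>y. M * D * norm (y - x)) \<longlongrightarrow> 0) (at x)" using lim by simp
      show "\<forall>\<^sub>F y in at x. norm (conv K \<phi> y - conv K \<phi> x - ?G \<bullet> (y - x)) / norm (y - x) \<le> M * D * norm (y - x)"
      proof (rule eventually_at_ball'[OF zero_less_one, THEN eventually_mono])
        fix y assume "y \<in> ball x 1 \<and> y \<noteq> x \<and> y \<in> UNIV"
        then have "norm (y - x) \<le> 1" "0 < norm (y - x)" by (auto simp: dist_norm norm_minus_commute)
        with rem[of "y - x"] show "norm (conv K \<phi> y - conv K \<phi> x - ?G \<bullet> (y - x)) / norm (y - x) \<le> M * D * norm (y - x)"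
          by (simp add: pos_divide_le_eq power2_eq_square mult.assoc)
      qed
    qed auto
  qed
qed

lemma gradient_conv:
  assumes "locally_integrable K" "\<phi> \<in> test_fun \<Omega>"
  shows "gradient (\<lambda>x. c * conv K \<phi> x) x $ j = c * conv K (\<lambda>y. gradient \<phi> y $ j) x"
  using gradient_nth[OF has_derivative_mult_right[OF conv_has_derivative[OF assms]], of c x j]
  by (simp add: inner_axis)

section \<open>The Riesz potential\<close>

abbreviation riesz_kernel :: "real \<Rightarrow> real^'n \<Rightarrow> real" where
  "riesz_kernel a \<equiv> (\<lambda>z. norm z powr (- a))"

lemma riesz_kernel_locally_integrable:
  fixes a :: real
  assumes "0 \<le> a" "a < CARD('n)"
  shows "locally_integrable (riesz_kernel a :: real^'n \<Rightarrow> real)"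
  unfolding locally_integrable_def
proof (intro conjI allI impI)
  show "(riesz_kernel a :: real^'n \<Rightarrow> real) \<in> borel_measurable borel"
    by (intro powr_real_measurable borel_measurable_const borel_measurable_norm)
qed (use assms integrable_norm_powr_cball[where 'a="real^'n", of a] in simp)

lemma riesz_kernel_le_1:
  fixes a :: real
  assumes "0 \<le> a" "1 < norm z"
  shows "\<bar>riesz_kernel a z\<bar> \<le> 1"
  using powr_mono2'[of "-a" 1 "norm z"] assms by simp

lemma powr_minus_lipschitz:
  fixes a m s t :: real
  assumes "0 \<le> a" "0 < m" "m \<le> s" "m \<le> t"
  shows "\<bar>s powr (- a) - t powr (- a)\<bar> \<le> a * m powr (- a - 1) * \<bar>s - t\<bar>"
proof -
  have der: "((\<lambda>x. x powr (- a)) has_field_derivative - a * x powr (- a - 1)) (at x within {m..})"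
    if "x \<in> {m..}" for x
    using that assms(2) by (intro has_field_derivative_at_within[OF has_real_derivative_powr]) simp
  have bound: "norm (- a * x powr (- a - 1)) \<le> a * m powr (- a - 1)" if "x \<in> {m..}" for x
  proof -
    have "x powr (- a - 1) \<le> m powr (- a - 1)"
      by (rule powr_mono2') (use that assms in simp_all)
    then have "a * x powr (- a - 1) \<le> a * m powr (- a - 1)" using assms(1) by (rule mult_left_mono)
    then show ?thesis using assms(1) by (simp add: abs_mult)
  qed
  have "s \<in> {m..}" "t \<in> {m..}" using assms by simp_all
  from field_differentiable_bound[OF convex_real_interval(1) der bound this] show ?thesis by simp
qed

text \<open>Differentiating the kernel instead of \<open>\<phi>\<close> improves the decay by one power of \<open>|x|\<close>. It is enough
  to estimate difference quotients, for which the kernel need only be Lipschitz away from the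
  origin.\<close>

lemma conv_riesz_kernel_gradient_decay:
  fixes \<phi> :: "real^'n \<Rightarrow> real" and a :: real
  assumes a: "0 \<le> a" "a < CARD('n)" and \<phi>: "\<phi> \<in> test_fun \<Omega>"
    and R: "0 < R" "\<And>x. R < norm x \<Longrightarrow> \<phi> x = 0" and x: "2 * R + 2 \<le> norm x"
  shows "\<bar>conv (riesz_kernel a) (\<lambda>y. gradient \<phi> y $ j) x\<bar>
    \<le> a * (norm x / 4) powr (- a - 1) * (LINT y|lborel. \<bar>\<phi> y\<bar>)"
proof -
  let ?K = "riesz_kernel a :: real^'n \<Rightarrow> real" and ?L = "a * (norm x / 4) powr (- a - 1) * (LINT y|lborel. \<bar>\<phi> y\<bar>)"
  have K: "locally_integrable ?K" by (rule riesz_kernel_locally_integrable[OF a])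
  then have Km[measurable]: "?K \<in> borel_measurable borel" by (simp add: locally_integrable_def)
  note \<phi>m[measurable] = test_funD(3)[OF \<phi>]
  note c_alt = conv_alt[OF Km \<phi>m]
  have int: "integrable lborel (\<lambda>y. \<phi> y * ?K (x' - y))" for x'
    using lborel_integrable_reflect[OF conv_integrable[OF K \<phi>, of x'], of x'] by (simp add: mult.commute)
  have diff: "\<bar>conv ?K \<phi> (x + h) - conv ?K \<phi> x\<bar> \<le> ?L * norm h" if h: "norm h \<le> norm x / 4" for h
  proof -
    have "conv ?K \<phi> (x + h) - conv ?K \<phi> x = (LINT y|lborel. \<phi> y * (?K (x + h - y) - ?K (x - y)))"
      unfolding c_alt using int by (simp add: right_diff_distrib)
    also have "\<bar>\<dots>\<bar> \<le> (LINT y|lborel. \<bar>\<phi> y * (?K (x + h - y) - ?K (x - y))\<bar>)" by simp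
    also have "\<dots> \<le> (LINT y|lborel. a * (norm x / 4) powr (- a - 1) * norm h * \<bar>\<phi> y\<bar>)"
    proof (rule integral_mono)
      show "integrable lborel (\<lambda>y. \<bar>\<phi> y * (?K (x + h - y) - ?K (x - y))\<bar>)"
        using integrable_norm[OF Bochner_Integration.integrable_diff[OF int[of "x + h"] int[of x]]]
        by (simp add: right_diff_distrib)
      show "integrable lborel (\<lambda>y. a * (norm x / 4) powr (- a - 1) * norm h * \<bar>\<phi> y\<bar>)"
        using test_fun_integrable[OF \<phi>] by (intro integrable_mult_right integrable_abs)
      fix y
      show "\<bar>\<phi> y * (?K (x + h - y) - ?K (x - y))\<bar> \<le> a * (norm x / 4) powr (- a - 1) * norm h * \<bar>\<phi> y\<bar>"
      proof (cases "norm y \<le> R")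
        case True
        \<comment> \<open>The segment between the two arguments stays at distance \<open>|x| / 4\<close> from the singularity.\<close>
        have n1: "norm x / 2 \<le> norm (x - y)" using norm_triangle_ineq2[of x y] True x by linarith
        have n2: "norm x / 4 \<le> norm (x + h - y)"
          using norm_triangle_ineq2[of "x - y" "-h"] n1 h by (simp add: algebra_simps)
        have n3: "norm x / 4 \<le> norm (x - y)" using n1 norm_ge_zero[of x] by linarith
        have "\<bar>?K (x + h - y) - ?K (x - y)\<bar>
            \<le> a * (norm x / 4) powr (- a - 1) * \<bar>norm (x + h - y) - norm (x - y)\<bar>"
          by (rule powr_minus_lipschitz) (use a x R n2 n3 in auto)
        also have "\<dots> \<le> a * (norm x / 4) powr (- a - 1) * norm h"
          using a norm_triangle_ineq3[of "x + h - y" "x - y"] by (intro mult_left_mono) (auto simp: algebra_simps)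
        finally have "\<bar>\<phi> y\<bar> * \<bar>?K (x + h - y) - ?K (x - y)\<bar> \<le> \<bar>\<phi> y\<bar> * (a * (norm x / 4) powr (- a - 1) * norm h)"
          by (rule mult_left_mono) simp
        then show ?thesis by (simp only: abs_mult mult.commute)
      next
        case False then show ?thesis using R(2)[of y] by simp
      qed
    qed
    also have "\<dots> = ?L * norm h" by (simp add: mult.assoc mult.commute mult.left_commute)
    finally show ?thesis .
  qed
  have "((\<lambda>t. conv ?K \<phi> (x + t *\<^sub>R axis j 1)) has_real_derivative conv ?K (\<lambda>y. gradient \<phi> y $ j) x) (at 0)"
  proof -
    have 1: "((\<lambda>t. x + t *\<^sub>R axis j 1) has_derivative (\<lambda>t. t *\<^sub>R axis j 1)) (at 0)"
      by (auto intro!: derivative_eq_intros)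
    have 2: "(conv ?K \<phi> has_derivative (\<lambda>h. (\<chi> j. conv ?K (\<lambda>y. gradient \<phi> y $ j) x) \<bullet> h)) (at (x + 0 *\<^sub>R axis j 1))"
      using conv_has_derivative[OF K \<phi>, of x] by simp
    have "(\<lambda>t. (\<chi> j. conv ?K (\<lambda>y. gradient \<phi> y $ j) x) \<bullet> (t *\<^sub>R axis j 1)) = (*) (conv ?K (\<lambda>y. gradient \<phi> y $ j) x)"
      by (simp add: fun_eq_iff inner_axis)
    with has_derivative_compose[OF 1 2] show ?thesis by (simp only: has_field_derivative_def)
  qed
  then have "((\<lambda>t. (conv ?K \<phi> (x + t *\<^sub>R axis j 1) - conv ?K \<phi> x) / t) \<longlongrightarrow> conv ?K (\<lambda>y. gradient \<phi> y $ j) x) (at 0)"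
    by (simp add: DERIV_def)
  then have lim: "((\<lambda>t. \<bar>(conv ?K \<phi> (x + t *\<^sub>R axis j 1) - conv ?K \<phi> x) / t\<bar>) \<longlongrightarrow> \<bar>conv ?K (\<lambda>y. gradient \<phi> y $ j) x\<bar>) (at 0)"
    by (rule tendsto_rabs)
  show ?thesis
  proof (rule tendsto_upperbound[OF lim])
    have x4: "0 < norm x / 4" using x R by linarith
    show "\<forall>\<^sub>F t in at 0. \<bar>(conv ?K \<phi> (x + t *\<^sub>R axis j 1) - conv ?K \<phi> x) / t\<bar> \<le> ?L"
    proof (rule eventually_at_ball'[OF x4, THEN eventually_mono])
      fix t :: real assume t: "t \<in> ball 0 (norm x / 4) \<and> t \<noteq> 0 \<and> t \<in> UNIV"
      then have "norm (t *\<^sub>R axis j 1 :: real^'n) \<le> norm x / 4" by auto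
      from diff[OF this] t show "\<bar>(conv ?K \<phi> (x + t *\<^sub>R axis j 1) - conv ?K \<phi> x) / t\<bar> \<le> ?L"
        by (simp add: pos_divide_le_eq)
    qed
  qed simp
qed

text \<open>With \<open>0 powr _ = 0\<close> and division by zero yielding zero, the two forms of the kernel agree also
  at the origin.\<close>

lemma riesz_potential_conv:
  fixes \<phi> :: "real^'n \<Rightarrow> real"
  assumes \<phi>: "\<phi> \<in> test_fun \<Omega>"
  shows "riesz_potential r \<phi> x = riesz_const (real CARD('n)) (1 - r) / (real CARD('n) - r) *
    conv (riesz_kernel (real CARD('n) - r)) \<phi> x"
proof -
  note [measurable] = test_funD(3)[OF \<phi>]
  have K[measurable]: "(riesz_kernel (real CARD('n) - r) :: real^'n \<Rightarrow> real) \<in> borel_measurable borel"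
    by (intro powr_real_measurable borel_measurable_const borel_measurable_norm)
  have "(LINT y|lebesgue. \<phi> y / norm (x - y) powr (real CARD('n) - r))
      = (LINT y|lebesgue. \<phi> y * riesz_kernel (real CARD('n) - r) (x - y))"
    by (simp only: powr_minus divide_inverse)
  also have "\<dots> = (LINT y|lborel. \<phi> y * riesz_kernel (real CARD('n) - r) (x - y))"
    by (rule integral_completion) measurable
  also have "\<dots> = conv (riesz_kernel (real CARD('n) - r)) \<phi> x"
    by (rule conv_alt[symmetric]) (use K test_funD(3)[OF \<phi>] in auto)
  finally show ?thesis by (simp add: riesz_potential_def)
qed

text \<open>With \<open>a = d - r\<close> the decay rate \<open>a + 1 = d + (1 - r)\<close> is better than \<open>d\<close>.\<close>

lemma gradient_riesz_potential_bounded_decay: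
  fixes \<phi> :: "real^'n \<Rightarrow> real"
  assumes r: "0 < r" "r < 1" and \<phi>: "\<phi> \<in> test_fun \<Omega>"
  shows "bounded_decay (\<lambda>x. gradient (riesz_potential r \<phi>) x $ j)"
proof -
  let ?a = "real CARD('n) - r" and ?c = "riesz_const (real CARD('n)) (1 - r) / (real CARD('n) - r)"
  let ?K = "riesz_kernel ?a :: real^'n \<Rightarrow> real"
  have d: "1 \<le> real CARD('n)" by (simp add: Suc_leI)
  have a: "0 \<le> ?a" "?a < CARD('n)" using r d by linarith+
  have K: "locally_integrable ?K" by (rule riesz_kernel_locally_integrable[OF a])
  obtain R B where RB: "0 < R" "0 \<le> B" "\<And>x. R < norm x \<Longrightarrow> \<phi> x = 0" "\<And>x. \<bar>\<phi> x\<bar> \<le> B"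
    using test_fun_bounded[OF \<phi>] by blast
  obtain C where C: "\<And>x. \<bar>conv ?K (\<lambda>y. gradient \<phi> y $ j) x\<bar> \<le> C"
    using conv_bounded[OF K _ test_fun_gradient[OF \<phi>]] riesz_kernel_le_1[OF a(1)] by blast
  let ?I = "LINT y|lborel. \<bar>\<phi> y\<bar>"
  have "bounded_decay (conv ?K (\<lambda>y. gradient \<phi> y $ j))"
  proof (rule bounded_decayI[where B=C and R="2 * R + 2" and D="?a * 4 powr (?a + 1) * ?I"])
    show "conv ?K (\<lambda>y. gradient \<phi> y $ j) \<in> borel_measurable borel"
      using K test_funD(3)[OF test_fun_gradient[OF \<phi>]] by (intro conv_measurable) (auto simp: locally_integrable_def)
    fix x :: "real^'n" assume x: "2 * R + 2 \<le> norm x"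
    then have x1: "1 \<le> norm x" using RB(1) by linarith
    have "norm x ^ CARD('n) = norm x powr real CARD('n)" using x1 by (subst powr_realpow) auto
    also have "\<dots> \<le> norm x powr (?a + 1)" using x1 r by (intro powr_mono) auto
    finally have pw: "norm x ^ CARD('n) \<le> norm x powr (?a + 1)" .
    have I0: "0 \<le> ?I" by simp
    have "\<bar>conv ?K (\<lambda>y. gradient \<phi> y $ j) x\<bar> * norm x ^ CARD('n)
        \<le> (?a * (norm x / 4) powr (- ?a - 1) * ?I) * norm x powr (?a + 1)"
      using pw a I0 by (intro mult_mono conv_riesz_kernel_gradient_decay[OF a \<phi> RB(1,3) x]) auto
    also have "\<dots> = ?a * ?I * ((norm x / 4) powr (- ?a - 1) * norm x powr (?a + 1))" by (simp only: ac_simps)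
    also have "(norm x / 4) powr (- ?a - 1) * norm x powr (?a + 1) = 4 powr (?a + 1)"
    proof -
      have e: "- ?a - 1 = - (?a + 1)" by simp
      show ?thesis unfolding e powr_minus powr_divide using x1 by (auto simp: field_simps)
    qed
    finally show "\<bar>conv ?K (\<lambda>y. gradient \<phi> y $ j) x\<bar> * norm x ^ CARD('n) \<le> ?a * 4 powr (?a + 1) * ?I"
      by (simp only: ac_simps)
  qed (rule C)
  from bounded_decay_cmult[OF this, of ?c] show ?thesis
    unfolding riesz_potential_conv[OF \<phi>, abs_def] gradient_conv[OF K \<phi>] .
qed

section \<open>The Riesz transform\<close>

definition riesz_transform_kernel :: "'n \<Rightarrow> real^'n \<Rightarrow> real" where
  "riesz_transform_kernel j z = z $ j / norm z ^ (CARD('n) + 1)"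

text \<open>The kernel is odd, so only the odd part \<open>(\<phi> (x - z) - \<phi> (x + z)) / 2\<close> of \<open>\<phi> (x - z)\<close> in \<open>z\<close> contributes
  to the truncated singular integrals. It vanishes at the origin, which makes the singularity
  integrable. The factor \<open>1 / 2\<close> is left out here.\<close>

definition riesz_symmetrized :: "'n \<Rightarrow> (real^'n \<Rightarrow> real) \<Rightarrow> real^'n \<Rightarrow> real" where
  "riesz_symmetrized j \<phi> x = (LINT z|lborel. riesz_transform_kernel j z * (\<phi> (x - z) - \<phi> (x + z)))"

lemma riesz_transform_kernel_measurable[measurable]: "riesz_transform_kernel j \<in> borel_measurable borel"
  unfolding riesz_transform_kernel_def[abs_def] by (rule borel_measurable_divide) (auto intro!: borel_measurable_continuous_onI continuous_intros)

lemma riesz_transform_kernel_uminus: "riesz_transform_kernel j (- z) = - riesz_transform_kernel j z"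
  by (simp add: riesz_transform_kernel_def)

lemma abs_riesz_transform_kernel_le:
  fixes z :: "real^'n"
  shows "\<bar>riesz_transform_kernel j z\<bar> \<le> norm z powr (- real CARD('n))"
proof (cases "z = 0")
  case False
  have "\<bar>riesz_transform_kernel j z\<bar> = \<bar>z $ j\<bar> / norm z ^ (CARD('n) + 1)"
    by (simp add: riesz_transform_kernel_def)
  also have "\<dots> \<le> norm z / norm z ^ (CARD('n) + 1)"
    by (intro divide_right_mono component_le_norm_cart) simp
  also have "\<dots> = norm z powr (- real CARD('n))"
    using False by (simp add: powr_minus_divide powr_realpow)
  finally show ?thesis .
qed (simp add: riesz_transform_kernel_def)

context
  fixes \<phi> :: "real^'n \<Rightarrow> real" and \<Omega> :: "(real^'n) set" and j :: 'n
  assumes \<phi>: "\<phi> \<in> test_fun \<Omega>"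
begin

lemma \<phi>_measurable[measurable]: "\<phi> \<in> borel_measurable borel"
  by (rule test_funD(3)[OF \<phi>])

lemma shifted_integrable:
  "integrable lborel (\<lambda>z. \<bar>\<phi> (x - z)\<bar>)" "integrable lborel (\<lambda>z. \<bar>\<phi> (x + z)\<bar>)"
  "(LINT z|lborel. \<bar>\<phi> (x - z)\<bar>) = (LINT z|lborel. \<bar>\<phi> z\<bar>)" "(LINT z|lborel. \<bar>\<phi> (x + z)\<bar>) = (LINT z|lborel. \<bar>\<phi> z\<bar>)"
proof -
  show 1: "integrable lborel (\<lambda>z. \<bar>\<phi> (x - z)\<bar>)"
    using lborel_integrable_reflect[OF integrable_norm[OF test_fun_integrable[OF \<phi>]]] by simp
  show "integrable lborel (\<lambda>z. \<bar>\<phi> (x + z)\<bar>)" using lborel_integrable_reflect[OF 1, of 0] by simp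
  show 2: "(LINT z|lborel. \<bar>\<phi> (x - z)\<bar>) = (LINT z|lborel. \<bar>\<phi> z\<bar>)"
    by (rule lborel_integral_reflect) simp
  show "(LINT z|lborel. \<bar>\<phi> (x + z)\<bar>) = (LINT z|lborel. \<bar>\<phi> z\<bar>)"
    using lborel_integral_reflect[of "\<lambda>z. \<bar>\<phi> (x - z)\<bar>" 0] 2 by simp
qed

text \<open>Near the origin the Lipschitz continuity of \<open>\<phi>\<close> gains a factor \<open>|z|\<close> over the critical singularity
  \<open>|z|\<^sup>-\<^sup>d\<close>; away from it the kernel is bounded by \<open>1\<close>.\<close>

lemma symmetrized_dominated:
  obtains L where "0 \<le> L" "\<And>x z. \<bar>riesz_transform_kernel j z * (\<phi> (x - z) - \<phi> (x + z))\<bar>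
    \<le> L * (indicator (cball 0 1) z * norm z powr (- (real CARD('n) - 1))) + (\<bar>\<phi> (x - z)\<bar> + \<bar>\<phi> (x + z)\<bar>)"
proof -
  obtain L where L: "0 \<le> L" "\<And>x y. \<bar>\<phi> x - \<phi> y\<bar> \<le> L * norm (x - y)"
    using test_fun_lipschitz[OF \<phi>] by blast
  let ?d = "real CARD('n)"
  show ?thesis
  proof (rule that[of "2 * L"])
    fix x z
    have k: "\<bar>riesz_transform_kernel j z\<bar> \<le> norm z powr (- ?d)" by (rule abs_riesz_transform_kernel_le)
    show "\<bar>riesz_transform_kernel j z * (\<phi> (x - z) - \<phi> (x + z))\<bar>
      \<le> 2 * L * (indicator (cball 0 1) z * norm z powr (- (?d - 1))) + (\<bar>\<phi> (x - z)\<bar> + \<bar>\<phi> (x + z)\<bar>)"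
    proof (cases "norm z \<le> 1")
      case True
      have "norm ((x - z) - (x + z)) = 2 * norm z"
        using norm_scaleR[of "-2" z] by (simp add: scaleR_2[symmetric] algebra_simps)
      then have "\<bar>\<phi> (x - z) - \<phi> (x + z)\<bar> \<le> L * (2 * norm z)" using L(2)[of "x - z" "x + z"] by simp
      then have "\<bar>riesz_transform_kernel j z\<bar> * \<bar>\<phi> (x - z) - \<phi> (x + z)\<bar> \<le> norm z powr (- ?d) * (L * (2 * norm z))"
        using k by (intro mult_mono) auto
      also have "\<dots> = 2 * L * (norm z * norm z powr (- ?d))" by simp
      also have "norm z * norm z powr (- ?d) = norm z powr (- (?d - 1))"
        by (subst powr_mult_base) simp_all
      finally show ?thesis using True by (simp add: abs_mult add_increasing2)
    next
      case False
      have "norm z powr (- ?d) \<le> 1" using False powr_mono2'[of "- ?d" 1 "norm z"] by simp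
      then have "\<bar>riesz_transform_kernel j z\<bar> * \<bar>\<phi> (x - z) - \<phi> (x + z)\<bar> \<le> 1 * \<bar>\<phi> (x - z) - \<phi> (x + z)\<bar>"
        using k by (intro mult_right_mono) auto
      then show ?thesis using False by (simp add: abs_mult)
    qed
  qed (use L(1) in simp)
qed

lemma dominating_integrable:
  "integrable lborel (\<lambda>z::real^'n. L * (indicator (cball 0 1) z * norm z powr (- (real CARD('n) - 1))) + (\<bar>\<phi> (x - z)\<bar> + \<bar>\<phi> (x + z)\<bar>))"
proof -
  have d: "1 \<le> real CARD('n)" by (simp add: Suc_leI)
  have "integrable lborel (\<lambda>z::real^'n. indicator (cball 0 1) z * norm z powr (- (real CARD('n) - 1)))"
    by (rule integrable_norm_powr_cball) (use d in simp_all)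
  then show ?thesis by (intro Bochner_Integration.integrable_add integrable_mult_right shifted_integrable)
qed

lemma symmetrized_integrable:
  "integrable lborel (\<lambda>z. riesz_transform_kernel j z * (\<phi> (x - z) - \<phi> (x + z)))"
proof -
  obtain L where L: "0 \<le> L" "\<And>x z. \<bar>riesz_transform_kernel j z * (\<phi> (x - z) - \<phi> (x + z))\<bar>
    \<le> L * (indicator (cball 0 1) z * norm z powr (- (real CARD('n) - 1))) + (\<bar>\<phi> (x - z)\<bar> + \<bar>\<phi> (x + z)\<bar>)"
    using symmetrized_dominated by blast
  show ?thesis
  proof (rule Bochner_Integration.integrable_bound[OF dominating_integrable[of L x]])
    show "AE z in lborel. norm (riesz_transform_kernel j z * (\<phi> (x - z) - \<phi> (x + z)))
      \<le> norm (L * (indicator (cball 0 1) z * norm z powr (- (real CARD('n) - 1))) + (\<bar>\<phi> (x - z)\<bar> + \<bar>\<phi> (x + z)\<bar>))"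
      unfolding real_norm_def by (intro AE_I2 order_trans[OF L(2)] abs_ge_self)
  qed measurable
qed

lemma truncated_eq_symmetrized:
  assumes "0 < \<epsilon>"
  shows "(LINT y:{y. norm (x - y) > \<epsilon>}|lebesgue. (x $ j - y $ j) / norm (x - y) ^ (CARD('n) + 1) * \<phi> y)
    = (LINT z|lborel. indicator {z. \<epsilon> < norm z} z * (riesz_transform_kernel j z * (\<phi> (x - z) - \<phi> (x + z)))) / 2"
proof -
  define K where "K z = indicator {z. \<epsilon> < norm z} z * riesz_transform_kernel j z" for z :: "real^'n"
  have S[measurable]: "{z::real^'n. \<epsilon> < norm z} \<in> sets borel" by (intro borel_open open_Collect_less continuous_intros)
  have Km[measurable]: "K \<in> borel_measurable borel" unfolding K_def[abs_def] by measurable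
  have Kle: "\<bar>K z\<bar> \<le> \<epsilon> powr (- real CARD('n))" for z
  proof (cases "\<epsilon> < norm z")
    case True
    have "\<bar>K z\<bar> \<le> norm z powr (- real CARD('n))" using True abs_riesz_transform_kernel_le[of j z] by (simp add: K_def)
    also have "\<dots> \<le> \<epsilon> powr (- real CARD('n))" using True assms by (intro powr_mono2') auto
    finally show ?thesis .
  qed (simp add: K_def)
  have K: "locally_integrable K" unfolding locally_integrable_def
  proof (intro conjI allI impI Km)
    fix R :: real
    have "integrable lborel (\<lambda>z::real^'n. indicator (cball 0 R) z * \<epsilon> powr (- real CARD('n)))"
      using emeasure_bounded_finite[OF bounded_cball, of 0 R]
      by (intro integrable_mult_left integrable_real_indicator) simp_all
    then show "integrable lborel (\<lambda>z. indicator (cball 0 R) z * K z)"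
    proof (rule Bochner_Integration.integrable_bound)
      show "(\<lambda>z. indicator (cball 0 R) z * K z) \<in> borel_measurable lborel"
        using Km by (intro borel_measurable_times borel_measurable_indicator) simp_all
    qed (use Kle in \<open>auto simp: abs_mult intro!: AE_I2 mult_left_mono\<close>)
  qed
  have i1: "integrable lborel (\<lambda>z. K z * \<phi> (x - z))" by (rule conv_integrable[OF K \<phi>])
  have Kminus: "K (- z) = - K z" for z by (simp add: K_def riesz_transform_kernel_uminus indicator_def)
  have i2: "integrable lborel (\<lambda>z. K z * \<phi> (x + z))"
    using lborel_integrable_reflect[OF i1, of 0] Kminus by simp
  have odd: "(LINT z|lborel. K z * \<phi> (x + z)) = - (LINT z|lborel. K z * \<phi> (x - z))"
    using lborel_integral_reflect[of "\<lambda>z. K z * \<phi> (x - z)" 0] Kminus by simp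
  have "(LINT y:{y. norm (x - y) > \<epsilon>}|lebesgue. (x $ j - y $ j) / norm (x - y) ^ (CARD('n) + 1) * \<phi> y)
      = (LINT y|lebesgue. \<phi> y * K (x - y))"
    unfolding set_lebesgue_integral_def K_def riesz_transform_kernel_def
    by (intro Bochner_Integration.integral_cong refl) (simp add: indicator_def)
  also have "\<dots> = (LINT y|lborel. \<phi> y * K (x - y))" by (rule integral_completion) measurable
  also have "\<dots> = (LINT z|lborel. K z * \<phi> (x - z))"
    using conv_alt[OF Km \<phi>_measurable, of x] by (simp add: conv_def)
  also have "\<dots> = ((LINT z|lborel. K z * \<phi> (x - z)) - (LINT z|lborel. K z * \<phi> (x + z))) / 2"
    unfolding odd by simp
  also have "(LINT z|lborel. K z * \<phi> (x - z)) - (LINT z|lborel. K z * \<phi> (x + z)) = (LINT z|lborel. K z * \<phi> (x - z) - K z * \<phi> (x + z))"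
    by (rule Bochner_Integration.integral_diff[OF i1 i2, symmetric])
  also have "\<dots> = (LINT z|lborel. indicator {z. \<epsilon> < norm z} z * (riesz_transform_kernel j z * (\<phi> (x - z) - \<phi> (x + z))))"
    by (simp add: K_def algebra_simps)
  finally show ?thesis .
qed

lemma riesz_transform_eq_symmetrized:
  "riesz_transform \<phi> x $ j = Gamma ((real CARD('n) + 1) / 2) / pi powr ((real CARD('n) + 1) / 2) * (riesz_symmetrized j \<phi> x / 2)"
proof -
  let ?I = "\<lambda>\<epsilon>. LINT y:{y. norm (x - y) > \<epsilon>}|lebesgue. (x $ j - y $ j) / norm (x - y) ^ (CARD('n) + 1) * \<phi> y"
  let ?f = "\<lambda>z. riesz_transform_kernel j z * (\<phi> (x - z) - \<phi> (x + z))"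
  have fm: "?f \<in> borel_measurable lborel" by (rule borel_measurable_integrable[OF symmetrized_integrable])
  have "(?I \<longlongrightarrow> riesz_symmetrized j \<phi> x / 2) (at_right 0)"
  proof (rule tendsto_at_right_sequentially[OF zero_less_one])
    fix S :: "nat \<Rightarrow> real" assume S: "\<And>n. 0 < S n" "S \<longlonglongrightarrow> 0"
    have "(\<lambda>n. LINT z|lborel. indicator {z. S n < norm z} z * ?f z) \<longlonglongrightarrow> (LINT z|lborel. ?f z)"
    proof (rule integral_dominated_convergence[OF fm _ integrable_norm[OF symmetrized_integrable[of x]]])
      fix n
      have "{z::real^'n. S n < norm z} \<in> sets lborel"
        unfolding sets_lborel by (intro borel_open open_Collect_less continuous_intros)
      then show "(\<lambda>z. indicator {z. S n < norm z} z * ?f z) \<in> borel_measurable lborel"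
        by (intro borel_measurable_times borel_measurable_indicator fm)
      show "AE z in lborel. norm (indicator {z. S n < norm z} z * ?f z) \<le> norm (?f z)"
        by (intro AE_I2) (simp add: indicator_def)
    next
      show "AE z in lborel. (\<lambda>n. indicator {z. S n < norm z} z * ?f z) \<longlonglongrightarrow> ?f z"
      proof (rule AE_I2)
        fix z
        show "(\<lambda>n. indicator {z. S n < norm z} z * ?f z) \<longlonglongrightarrow> ?f z"
        proof (cases "z = 0")
          case True then show ?thesis by (simp add: riesz_transform_kernel_def)
        next
          case False
          then have "\<forall>\<^sub>F n in sequentially. S n < norm z" using order_tendstoD(2)[OF S(2), of "norm z"] by simp
          then have "\<forall>\<^sub>F n in sequentially. indicator {z. S n < norm z} z * ?f z = ?f z"
            by eventually_elim (simp add: indicator_def)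
          then show ?thesis by (rule tendsto_eventually)
        qed
      qed
    qed
    then have "(\<lambda>n. (LINT z|lborel. indicator {z. S n < norm z} z * ?f z) / 2) \<longlonglongrightarrow> riesz_symmetrized j \<phi> x / 2"
      unfolding riesz_symmetrized_def by (intro tendsto_divide tendsto_const) simp_all
    then show "(\<lambda>n. ?I (S n)) \<longlonglongrightarrow> riesz_symmetrized j \<phi> x / 2"
      by (simp only: truncated_eq_symmetrized[OF S(1)])
  qed
  then have "Lim (at_right 0) ?I = riesz_symmetrized j \<phi> x / 2"
    by (intro tendsto_Lim) (simp_all add: trivial_limit_at_right_real)
  then show ?thesis unfolding riesz_transform_def by (simp only: vec_lambda_beta)
qed

text \<open>If \<open>|x|\<close> is large compared with the support of \<open>\<phi>\<close>, only points with \<open>|z| \<ge> |x| / 2\<close> contribute, where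
  the kernel is at most \<open>(|x| / 2)\<^sup>-\<^sup>d\<close>.\<close>

lemma riesz_symmetrized_bounded_decay: "bounded_decay (riesz_symmetrized j \<phi>)"
proof -
  let ?d = "real CARD('n)" and ?k = "riesz_transform_kernel j :: real^'n \<Rightarrow> real"
  obtain R B where RB: "0 < R" "0 \<le> B" "\<And>x. R < norm x \<Longrightarrow> \<phi> x = 0" "\<And>x. \<bar>\<phi> x\<bar> \<le> B"
    using test_fun_bounded[OF \<phi>] by blast
  obtain L where L: "0 \<le> L" "\<And>x z. \<bar>?k z * (\<phi> (x - z) - \<phi> (x + z))\<bar>
    \<le> L * (indicator (cball 0 1) z * norm z powr (- (?d - 1))) + (\<bar>\<phi> (x - z)\<bar> + \<bar>\<phi> (x + z)\<bar>)"
    using symmetrized_dominated by blast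
  let ?I = "LINT z|lborel. \<bar>\<phi> z\<bar>"
  have abs_le: "\<bar>riesz_symmetrized j \<phi> x\<bar> \<le> (LINT z|lborel. \<bar>?k z * (\<phi> (x - z) - \<phi> (x + z))\<bar>)" for x
    unfolding riesz_symmetrized_def by simp
  have absint: "integrable lborel (\<lambda>z. \<bar>?k z * (\<phi> (x - z) - \<phi> (x + z))\<bar>)" for x
    using integrable_norm[OF symmetrized_integrable[of x]] by simp
  show ?thesis
  proof (rule bounded_decayI)
    have "(\<lambda>x. LINT z|lborel. ?k z * (\<phi> (x - z) - \<phi> (x + z))) \<in> borel_measurable lborel"
      by (rule lborel.borel_measurable_lebesgue_integral) measurable
    then show "riesz_symmetrized j \<phi> \<in> borel_measurable borel" by (simp add: riesz_symmetrized_def[abs_def])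
  next
    fix x
    have d: "1 \<le> ?d" by (simp add: Suc_leI)
    have i0: "integrable lborel (\<lambda>z::real^'n. indicator (cball 0 1) z * norm z powr (- (?d - 1)))"
      by (rule integrable_norm_powr_cball) (use d in simp_all)
    have "(LINT z|lborel. \<bar>?k z * (\<phi> (x - z) - \<phi> (x + z))\<bar>)
      \<le> (LINT z|lborel. L * (indicator (cball 0 1) z * norm z powr (- (?d - 1))) + (\<bar>\<phi> (x - z)\<bar> + \<bar>\<phi> (x + z)\<bar>))"
      by (intro integral_mono absint dominating_integrable L(2))
    also have "\<dots> = L * (LINT z|lborel. indicator (cball 0 1 :: (real^'n) set) z * norm z powr (- (?d - 1))) + (?I + ?I)"
      using i0 shifted_integrable by simp
    finally show "\<bar>riesz_symmetrized j \<phi> x\<bar>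
        \<le> L * (LINT z|lborel. indicator (cball 0 1 :: (real^'n) set) z * norm z powr (- (?d - 1))) + (?I + ?I)"
      using abs_le[of x] by linarith
  next
    fix x :: "real^'n" assume x: "2 * R + 1 \<le> norm x"
    have x0: "0 < norm x" using x RB(1) by linarith
    have "(LINT z|lborel. \<bar>?k z * (\<phi> (x - z) - \<phi> (x + z))\<bar>)
      \<le> (LINT z|lborel. (norm x / 2) powr (- ?d) * (\<bar>\<phi> (x - z)\<bar> + \<bar>\<phi> (x + z)\<bar>))"
    proof (intro integral_mono absint)
      show "integrable lborel (\<lambda>z. (norm x / 2) powr (- ?d) * (\<bar>\<phi> (x - z)\<bar> + \<bar>\<phi> (x + z)\<bar>))"
        by (intro integrable_mult_right Bochner_Integration.integrable_add shifted_integrable)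
      fix z
      show "\<bar>?k z * (\<phi> (x - z) - \<phi> (x + z))\<bar> \<le> (norm x / 2) powr (- ?d) * (\<bar>\<phi> (x - z)\<bar> + \<bar>\<phi> (x + z)\<bar>)"
      proof (cases "norm x / 2 \<le> norm z")
        case True
        have "\<bar>?k z\<bar> \<le> norm z powr (- ?d)" by (rule abs_riesz_transform_kernel_le)
        also have "\<dots> \<le> (norm x / 2) powr (- ?d)" using True x0 by (intro powr_mono2') auto
        finally show ?thesis unfolding abs_mult by (intro mult_mono) auto
      next
        case False
        have "norm x - norm z \<le> norm (x - z)" "norm x - norm z \<le> norm (x + z)"
          using norm_triangle_ineq2[of x z] norm_triangle_ineq2[of x "-z"] by simp_all
        then have "R < norm (x - z)" "R < norm (x + z)" using False x by linarith+
        then show ?thesis using RB(3) by simp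
      qed
    qed
    also have "\<dots> = (norm x / 2) powr (- ?d) * (?I + ?I)"
      using shifted_integrable by simp
    finally have "\<bar>riesz_symmetrized j \<phi> x\<bar> * norm x ^ CARD('n) \<le> ((norm x / 2) powr (- ?d) * (?I + ?I)) * norm x ^ CARD('n)"
      using abs_le[of x] by (intro mult_right_mono) auto
    also have "\<dots> = 2 ^ CARD('n) * (?I + ?I)"
    proof -
      have "(norm x / 2) powr (- ?d) = 1 / (norm x / 2) ^ CARD('n)"
        using x0 by (simp add: powr_minus_divide powr_realpow)
      then show ?thesis using x0 by (simp add: power_divide)
    qed
    finally show "\<bar>riesz_symmetrized j \<phi> x\<bar> * norm x ^ CARD('n) \<le> 2 ^ CARD('n) * (?I + ?I)" .
  qed
qed

lemma frac_gradient_bounded_decay: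
  assumes "0 \<le> s" "s \<le> 1"
  shows "bounded_decay (\<lambda>x. frac_gradient s \<phi> x $ j)"
proof -
  consider "s = 1" | "s = 0" | "0 < s" "s < 1" using assms by linarith
  then show ?thesis
  proof cases
    case 1
    then show ?thesis using test_fun_bounded_decay[OF test_fun_gradient[OF \<phi>]] by (simp add: frac_gradient_def)
  next
    case 2
    have eq: "(\<lambda>x. frac_gradient s \<phi> x $ j)
        = (\<lambda>x. - (Gamma ((real CARD('n) + 1) / 2) / pi powr ((real CARD('n) + 1) / 2) / 2) * riesz_symmetrized j \<phi> x)"
      using 2 by (simp add: frac_gradient_def riesz_transform_eq_symmetrized)
    show ?thesis unfolding eq by (rule bounded_decay_cmult[OF riesz_symmetrized_bounded_decay])
  next
    case 3
    then show ?thesis using gradient_riesz_potential_bounded_decay[OF _ _ \<phi>, of "1 - s" j] by (simp add: frac_gradient_def)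
  qed
qed

end

section \<open>The weak fractional gradient\<close>

lemma Lp_space_sum:
  assumes "0 \<le> p" "finite I" "\<And>i. i \<in> I \<Longrightarrow> f i \<in> Lp_space p"
  shows "(\<lambda>x. \<Sum>i\<in>I. f i x) \<in> Lp_space p"
  using assms(2,3) by (induction I rule: finite_induct) (auto intro: Lp_space_add Lp_space_zero assms(1))

lemma bounded_decay_Lp:
  assumes "bounded_decay g" "1 < q"
  shows "g \<in> Lp_space q"
proof -
  have [measurable]: "g \<in> borel_measurable borel" using assms(1) by (simp add: bounded_decay_def)
  have "g \<in> borel_measurable lebesgue" by (rule measurable_completion) simp
  moreover have "integrable lebesgue (\<lambda>x. \<bar>g x\<bar> powr q)"
    by (subst integrable_completion) (use bounded_decay_integrable_powr[OF assms] in simp_all)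
  ultimately show ?thesis by (simp add: Lp_space_def)
qed

lemma frac_div_Lp:
  assumes "0 \<le> s" "s \<le> 1" "\<Phi> \<in> test_field \<Omega>" "1 < q"
  shows "frac_div s \<Phi> \<in> Lp_space q"
  unfolding frac_div_def[abs_def] using assms
  by (intro Lp_space_sum bounded_decay_Lp frac_gradient_bounded_decay[of _ \<Omega>]) (auto simp: test_field_def)

lemma Lp_space_scaleR_vector:
  assumes "(g :: real^'n \<Rightarrow> real) \<in> Lp_space p"
  shows "(\<lambda>x. g x *\<^sub>R (v::'b::euclidean_space)) \<in> Lp_space p"
proof -
  note [measurable] = Lp_spaceD(1)[OF assms]
  show ?thesis
  proof (rule Lp_spaceI)
    show "integrable lebesgue (\<lambda>x. norm v powr p * norm (g x) powr p)"
      by (rule integrable_mult_right[OF Lp_spaceD(2)[OF assms]])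
    show "AE x in lebesgue. norm (g x *\<^sub>R v) powr p \<le> norm v powr p * norm (g x) powr p"
      by (intro AE_I2) (simp add: powr_mult mult.commute)
  qed measurable
qed

lemma test_field_Lp:
  assumes "\<Phi> \<in> test_field \<Omega>" "1 < q"
  shows "\<Phi> \<in> Lp_space q"
proof -
  have "(\<lambda>x. \<Sum>j\<in>UNIV. \<Phi> x $ j *\<^sub>R axis j (1::real)) \<in> Lp_space q"
    using assms by (intro Lp_space_sum Lp_space_scaleR_vector bounded_decay_Lp test_fun_bounded_decay[of _ \<Omega>])
      (auto simp: test_field_def)
  moreover have "(\<Sum>j\<in>UNIV. \<Phi> x $ j *\<^sub>R axis j (1::real)) = \<Phi> x" for x
    using basis_expansion[of "\<Phi> x"] by (simp add: scalar_mult_eq_scaleR)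
  ultimately show ?thesis by simp
qed

lemma integrable_mult_frac_div:
  assumes s: "0 \<le> s" "s \<le> 1" and p: "1 < p" and u: "u \<in> Lp_space p" and \<Phi>: "\<Phi> \<in> test_field \<Omega>"
  shows "integrable lebesgue (\<lambda>x. u x * frac_div s \<Phi> x)"
proof -
  have "1 < p / (p - 1)" using p by (simp add: field_simps)
  from integrable_inner_Lp[OF p frac_div_Lp[OF s \<Phi> this] u] show ?thesis by (simp add: mult.commute)
qed

lemma Lp_space_subset_L1_loc:
  assumes G: "G \<in> Lp_space p" and p: "1 \<le> p"
  shows "G \<in> L1_loc"
  unfolding L1_loc_def
proof (intro CollectI conjI allI impI)
  show m[measurable]: "G \<in> borel_measurable lebesgue" by (rule Lp_spaceD(1)[OF G])
  fix C :: "(real^'a) set" assume C: "compact C"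
  have CS: "C \<in> sets lebesgue" using C by (simp add: compact_imp_closed)
  have "integrable lebesgue (indicator C :: real^'a \<Rightarrow> real)"
    using CS emeasure_bounded_finite[OF compact_imp_bounded[OF C]] by (intro integrable_real_indicator) (simp_all add: C compact_imp_closed)
  then have "integrable lebesgue (\<lambda>x. indicator C x + norm (G x) powr p)"
    by (intro Bochner_Integration.integrable_add Lp_spaceD(2)[OF G])
  then have "integrable lebesgue (\<lambda>x. indicator C x *\<^sub>R G x)"
  proof (rule Bochner_Integration.integrable_bound)
    show "(\<lambda>x. indicator C x *\<^sub>R G x) \<in> borel_measurable lebesgue"
      by (intro borel_measurable_scaleR borel_measurable_indicator CS m)
    have "norm (G x) \<le> 1 + norm (G x) powr p" for x
    proof (cases "norm (G x) \<le> 1")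
      case False
      then have "norm (G x) powr 1 \<le> norm (G x) powr p" using p by (intro powr_mono) auto
      then show ?thesis by simp
    qed (simp add: add_increasing2)
    then show "AE x in lebesgue. norm (indicator C x *\<^sub>R G x) \<le> norm (indicator C x + norm (G x) powr p)"
      by (intro AE_I2) (simp add: indicator_def)
  qed
  then show "set_integrable lebesgue C G" by (simp add: set_integrable_def)
qed

lemma L1_loc_lincomb:
  assumes "G \<in> L1_loc" "H \<in> L1_loc"
  shows "(\<lambda>x. a *\<^sub>R G x + b *\<^sub>R H x) \<in> L1_loc"
proof -
  have [measurable]: "G \<in> borel_measurable lebesgue" "H \<in> borel_measurable lebesgue" using assms by (auto simp: L1_loc_def)
  have "set_integrable lebesgue C (\<lambda>x. a *\<^sub>R G x + b *\<^sub>R H x)" if C: "compact C" for C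
  proof -
    have "integrable lebesgue (\<lambda>x. indicator C x *\<^sub>R G x)" "integrable lebesgue (\<lambda>x. indicator C x *\<^sub>R H x)"
      using assms C by (auto simp: L1_loc_def set_integrable_def)
    then have "integrable lebesgue (\<lambda>x. a *\<^sub>R (indicator C x *\<^sub>R G x) + b *\<^sub>R (indicator C x *\<^sub>R H x))"
      by (intro Bochner_Integration.integrable_add integrable_scaleR_right)
    then show ?thesis by (simp add: set_integrable_def scaleR_add_right mult.commute)
  qed
  then show ?thesis by (simp add: L1_loc_def)
qed

lemma L1_loc_integrable_test_field:
  assumes G: "G \<in> L1_loc" and \<Phi>: "\<Phi> \<in> test_field \<Omega>"
  shows "integrable lebesgue (\<lambda>x. G x \<bullet> \<Phi> x)"
proof -
  have [measurable]: "G \<in> borel_measurable lebesgue" using G by (auto simp: L1_loc_def)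
  note [measurable] = Lp_spaceD(1)[OF test_field_Lp[OF \<Phi>, of 2]]
  have \<Phi>j: "(\<lambda>x. \<Phi> x $ j) \<in> test_fun \<Omega>" for j using \<Phi> by (simp add: test_field_def)
  have "\<exists>R B. 0 < R \<and> 0 \<le> B \<and> (\<forall>x. R < norm x \<longrightarrow> \<Phi> x $ j = 0) \<and> (\<forall>x. \<bar>\<Phi> x $ j\<bar> \<le> B)" for j
    by (rule test_fun_bounded[OF \<Phi>j[of j]]) blast
  then have "\<exists>R B. \<forall>j. 0 < R j \<and> 0 \<le> B j \<and> (\<forall>x. R j < norm x \<longrightarrow> \<Phi> x $ j = 0) \<and> (\<forall>x. \<bar>\<Phi> x $ j\<bar> \<le> B j)"
    by metis
  then obtain R B where RB: "\<And>j. 0 < R j" "\<And>j. 0 \<le> B j" "\<And>j x. R j < norm x \<Longrightarrow> \<Phi> x $ j = 0"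
      "\<And>j x. \<bar>\<Phi> x $ j\<bar> \<le> B j"
    by blast
  have B: "norm (\<Phi> x) \<le> sum B UNIV" for x
    by (rule order_trans[OF norm_le_l1_cart sum_mono]) (rule RB)
  have 0: "\<Phi> x = 0" if "sum R UNIV < norm x" for x
  proof -
    have "R j < norm x" for j
      using member_le_sum[of j UNIV R] less_imp_le[OF RB(1)] that by simp
    then show ?thesis using RB(3) by (simp add: vec_eq_iff)
  qed
  have "integrable lebesgue (\<lambda>x. indicator (cball 0 (sum R UNIV)) x *\<^sub>R G x)"
    using G by (auto simp: L1_loc_def set_integrable_def)
  then have "integrable lebesgue (\<lambda>x. sum B UNIV *\<^sub>R (indicator (cball 0 (sum R UNIV)) x *\<^sub>R G x))"
    by (rule integrable_scaleR_right)
  then show ?thesis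
  proof (rule Bochner_Integration.integrable_bound)
    show "AE x in lebesgue. norm (G x \<bullet> \<Phi> x) \<le> norm (sum B UNIV *\<^sub>R (indicator (cball 0 (sum R UNIV)) x *\<^sub>R G x))"
    proof (rule AE_I2)
      fix x
      show "norm (G x \<bullet> \<Phi> x) \<le> norm (sum B UNIV *\<^sub>R (indicator (cball 0 (sum R UNIV)) x *\<^sub>R G x))"
      proof (cases "sum R UNIV < norm x")
        case False
        have "\<bar>G x \<bullet> \<Phi> x\<bar> \<le> norm (G x) * norm (\<Phi> x)" by (rule Cauchy_Schwarz_ineq2)
        also have "\<dots> \<le> norm (G x) * sum B UNIV" by (intro mult_left_mono B) simp
        finally show ?thesis using False RB(2) by (simp add: sum_nonneg mult.commute)
      qed (simp add: 0)
    qed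
  qed measurable
qed

text \<open>Linearity needs the integrability of \<open>u * frac_div s \<Phi>\<close>, since a Bochner integral that does not
  exist is \<open>0\<close>.\<close>

lemma is_weak_frac_gradient_lincomb:
  assumes s: "0 \<le> s" "s \<le> 1" and p: "1 < p" and uv: "u \<in> Lp_space p" "v \<in> Lp_space p"
    and G: "is_weak_frac_gradient s u G" "is_weak_frac_gradient s v H"
  shows "is_weak_frac_gradient s (\<lambda>x. a * u x + b * v x) (\<lambda>x. a *\<^sub>R G x + b *\<^sub>R H x)"
  unfolding is_weak_frac_gradient_def
proof (intro conjI ballI)
  have GH: "G \<in> L1_loc" "H \<in> L1_loc" using G by (auto simp: is_weak_frac_gradient_def)
  then show "(\<lambda>x. a *\<^sub>R G x + b *\<^sub>R H x) \<in> L1_loc" by (rule L1_loc_lincomb)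
  fix \<Phi> :: "real^'a \<Rightarrow> real^'a" assume \<Phi>: "\<Phi> \<in> test_field UNIV"
  note i = integrable_mult_frac_div[OF s p uv(1) \<Phi>] integrable_mult_frac_div[OF s p uv(2) \<Phi>]
    L1_loc_integrable_test_field[OF GH(1) \<Phi>] L1_loc_integrable_test_field[OF GH(2) \<Phi>]
  have "(LINT x|lebesgue. (a * u x + b * v x) * frac_div s \<Phi> x)
      = (LINT x|lebesgue. a * (u x * frac_div s \<Phi> x) + b * (v x * frac_div s \<Phi> x))"
    by (simp add: algebra_simps)
  also have "\<dots> = a * (LINT x|lebesgue. u x * frac_div s \<Phi> x) + b * (LINT x|lebesgue. v x * frac_div s \<Phi> x)"
    using i(1,2) by simp
  also have "\<dots> = a * - (LINT x|lebesgue. G x \<bullet> \<Phi> x) + b * - (LINT x|lebesgue. H x \<bullet> \<Phi> x)"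
    using G \<Phi> by (simp add: is_weak_frac_gradient_def)
  also have "\<dots> = - (LINT x|lebesgue. (a *\<^sub>R G x + b *\<^sub>R H x) \<bullet> \<Phi> x)"
    using i(3,4) by (simp add: inner_add_left)
  finally show "(LINT x|lebesgue. (a * u x + b * v x) * frac_div s \<Phi> x) = - (LINT x|lebesgue. (a *\<^sub>R G x + b *\<^sub>R H x) \<bullet> \<Phi> x)" .
qed

lemma is_weak_frac_gradient_diff:
  assumes "0 \<le> s" "s \<le> 1" "1 < p" "u \<in> Lp_space p" "v \<in> Lp_space p"
    and "is_weak_frac_gradient s u G" "is_weak_frac_gradient s v H"
  shows "is_weak_frac_gradient s (\<lambda>x. u x - v x) (\<lambda>x. G x - H x)"
  using is_weak_frac_gradient_lincomb[OF assms, of 1 "-1"] by simp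

lemma is_weak_frac_gradient_unique:
  assumes G: "is_weak_frac_gradient s u G" "is_weak_frac_gradient s u H"
  shows "AE x in lebesgue. G x = H x"
proof -
  have GH: "G \<in> L1_loc" "H \<in> L1_loc" using G by (auto simp: is_weak_frac_gradient_def)
  \<comment> \<open>The difference of the two gradients annihilates all test fields.\<close>
  have "AE x in lebesgue. 1 *\<^sub>R G x + (-1) *\<^sub>R H x = 0"
  proof (rule AE_zero_if_test_field_integrals_zero)
    show "(\<lambda>x. 1 *\<^sub>R G x + (-1) *\<^sub>R H x) \<in> L1_loc" by (rule L1_loc_lincomb[OF GH])
    fix \<Phi> :: "real^'a \<Rightarrow> real^'a" assume \<Phi>: "\<Phi> \<in> test_field UNIV"
    have "(LINT x|lebesgue. G x \<bullet> \<Phi> x) = (LINT x|lebesgue. H x \<bullet> \<Phi> x)"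
      using G \<Phi> by (simp add: is_weak_frac_gradient_def)
    then show "(LINT x|lebesgue. (1 *\<^sub>R G x + (-1) *\<^sub>R H x) \<bullet> \<Phi> x) = 0"
      using L1_loc_integrable_test_field[OF GH(1) \<Phi>] L1_loc_integrable_test_field[OF GH(2) \<Phi>]
      by (simp add: inner_diff_left)
  qed
  then show ?thesis by eventually_elim simp
qed

lemma weak_frac_gradient_AE_eq:
  assumes "is_weak_frac_gradient s u G"
  shows "is_weak_frac_gradient s u (weak_frac_gradient s u)" "AE x in lebesgue. weak_frac_gradient s u x = G x"
proof -
  show 1: "is_weak_frac_gradient s u (weak_frac_gradient s u)"
    unfolding weak_frac_gradient_def by (rule someI[of "is_weak_frac_gradient s u", OF assms])
  show "AE x in lebesgue. weak_frac_gradient s u x = G x" by (rule is_weak_frac_gradient_unique[OF 1 assms])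
qed

lemma weak_frac_gradient_measurable:
  assumes "is_weak_frac_gradient s u G"
  shows "weak_frac_gradient s u \<in> borel_measurable lebesgue"
  using weak_frac_gradient_AE_eq(1)[OF assms] by (simp add: is_weak_frac_gradient_def L1_loc_def)

lemma Lp_space_cong_AE:
  assumes "G \<in> Lp_space p" "H \<in> borel_measurable lebesgue" "AE x in lebesgue. H x = G x"
  shows "H \<in> Lp_space p" "Lp_mod p H = Lp_mod p G"
proof -
  note [measurable] = assms(2) Lp_spaceD(1)[OF assms(1)]
  show "H \<in> Lp_space p"
    by (rule Lp_spaceI[OF assms(2) Lp_spaceD(2)[OF assms(1)]]) (use assms(3) in eventually_elim, simp)
  show "Lp_mod p H = Lp_mod p G"
    unfolding Lp_mod_def by (rule integral_cong_AE) (measurable, use assms(3) in eventually_elim, simp)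
qed

text \<open>The weak gradient picked by Hilbert's choice operator inherits integrability from any other one by
  uniqueness.\<close>

lemma LambdaD:
  assumes "u \<in> Lambda s p"
  shows "u \<in> Lp_space p" "is_weak_frac_gradient s u (weak_frac_gradient s u)" "weak_frac_gradient s u \<in> Lp_space p"
proof -
  obtain G where G: "u \<in> Lp_space p" "is_weak_frac_gradient s u G" "G \<in> Lp_space p"
    using assms by (auto simp: Lambda_def)
  show "u \<in> Lp_space p" by fact
  show "is_weak_frac_gradient s u (weak_frac_gradient s u)" by (rule weak_frac_gradient_AE_eq[OF G(2)])
  show "weak_frac_gradient s u \<in> Lp_space p"
    by (rule Lp_space_cong_AE(1)[OF G(3) weak_frac_gradient_measurable[OF G(2)] weak_frac_gradient_AE_eq(2)[OF G(2)]])
qed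

lemma is_weak_frac_gradient_limit:
  assumes s: "0 \<le> s" "s \<le> 1" and p: "1 < p"
    and u: "\<And>n. u n \<in> Lp_space p" "v \<in> Lp_space p" "(\<lambda>n. Lp_mod p (\<lambda>x. u n x - v x)) \<longlonglongrightarrow> 0"
    and G: "\<And>n. G n \<in> Lp_space p" "H \<in> Lp_space p" "(\<lambda>n. Lp_mod p (\<lambda>x. G n x - H x)) \<longlonglongrightarrow> 0"
    and weak: "\<And>n. is_weak_frac_gradient s (u n) (G n)"
  shows "is_weak_frac_gradient s v H"
  unfolding is_weak_frac_gradient_def
proof (intro conjI ballI)
  have q: "1 < p / (p - 1)" using p by (simp add: field_simps)
  show "H \<in> L1_loc" using Lp_space_subset_L1_loc[OF G(2)] p by simp
  fix \<Phi> :: "real^'a \<Rightarrow> real^'a" assume \<Phi>: "\<Phi> \<in> test_field UNIV"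
  have 1: "(\<lambda>n. LINT x|lebesgue. frac_div s \<Phi> x \<bullet> u n x) \<longlonglongrightarrow> (LINT x|lebesgue. frac_div s \<Phi> x \<bullet> v x)"
    by (rule tendsto_integral_inner_Lp[OF p frac_div_Lp[OF s \<Phi> q] u])
  have 2: "(\<lambda>n. LINT x|lebesgue. \<Phi> x \<bullet> G n x) \<longlonglongrightarrow> (LINT x|lebesgue. \<Phi> x \<bullet> H x)"
    by (rule tendsto_integral_inner_Lp[OF p test_field_Lp[OF \<Phi> q] G])
  have "(LINT x|lebesgue. frac_div s \<Phi> x \<bullet> u n x) = - (LINT x|lebesgue. \<Phi> x \<bullet> G n x)" for n
    using weak[of n] \<Phi> by (simp add: is_weak_frac_gradient_def inner_commute mult.commute)
  then have "(\<lambda>n. LINT x|lebesgue. frac_div s \<Phi> x \<bullet> u n x) \<longlonglongrightarrow> - (LINT x|lebesgue. \<Phi> x \<bullet> H x)"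
    using tendsto_minus[OF 2] by simp
  from LIMSEQ_unique[OF 1 this]
  show "(LINT x|lebesgue. v x * frac_div s \<Phi> x) = - (LINT x|lebesgue. H x \<bullet> \<Phi> x)"
    by (simp add: inner_commute mult.commute)
qed

lemma Lp_norm_powr: "0 < p \<Longrightarrow> Lp_norm p f powr p = Lp_mod p f"
  by (simp add: Lp_norm_def Lp_mod_def powr_powr)

lemma Lambda_norm_eq:
  assumes "0 < p" "is_weak_frac_gradient s u G" "G \<in> Lp_space p"
  shows "Lambda_norm s p u = (Lp_mod p u + Lp_mod p G) powr (1 / p)"
  using Lp_space_cong_AE(2)[OF assms(3) weak_frac_gradient_measurable[OF assms(2)] weak_frac_gradient_AE_eq(2)[OF assms(2)]]
  by (simp add: Lambda_norm_def Lp_norm_powr assms(1))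

lemma Lp_mod_le_Lambda_norm:
  assumes "0 < p"
  shows "Lp_mod p u \<le> Lambda_norm s p u powr p"
  using assms Lp_mod_nonneg[of p "weak_frac_gradient s u"] Lp_mod_nonneg[of p u]
  by (simp add: Lambda_norm_def Lp_norm_powr powr_powr)

text \<open>Test functions supported in \<open>\<Omega>\<close> approximate \<open>u\<close>, so the integral of \<open>|u|\<^sup>p\<close> over the complement is
  arbitrarily small.\<close>

lemma Lambda0_AE_zero_outside:
  assumes p: "1 < p" and \<Omega>: "open \<Omega>" and u: "u \<in> Lambda0 s p \<Omega>"
  shows "AE x in lebesgue. x \<notin> \<Omega> \<longrightarrow> u x = 0"
proof -
  have uL: "u \<in> Lp_space p"
    using u LambdaD(1) by (auto simp: Lambda0_def Lambda_closure_def)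
  note um[measurable] = Lp_spaceD(1)[OF uL]
  have \<Omega>S: "- \<Omega> \<in> sets lebesgue" using \<Omega> by (simp add: borel_closed sets_completionI_sets)
  have m: "(\<lambda>x. indicator (- \<Omega>) x * norm (u x) powr p) \<in> borel_measurable lebesgue"
    by (intro borel_measurable_times borel_measurable_indicator \<Omega>S) measurable
  have int: "integrable lebesgue (\<lambda>x. indicator (- \<Omega>) x * norm (u x) powr p)"
    by (rule Bochner_Integration.integrable_bound[OF Lp_spaceD(2)[OF uL] m]) (simp add: indicator_def)
  let ?I = "LINT x|lebesgue. indicator (- \<Omega>) x * norm (u x) powr p"
  have le: "?I \<le> e powr p" if e: "0 < e" for e
  proof -
    obtain \<phi> where \<phi>: "\<phi> \<in> test_fun \<Omega>" "Lambda_norm s p (\<lambda>x. u x - \<phi> x) < e"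
      using u e by (auto simp: Lambda0_def Lambda_closure_def)
    have \<phi>L: "\<phi> \<in> Lp_space p" by (rule bounded_decay_Lp[OF test_fun_bounded_decay[OF \<phi>(1)] p])
    have \<phi>0: "\<phi> x = 0" if "x \<notin> \<Omega>" for x
      using that \<phi>(1) closure_subset[of "{x. \<phi> x \<noteq> 0}"] by (auto simp: test_fun_def)
    have "?I \<le> Lp_mod p (\<lambda>x. u x - \<phi> x)"
      unfolding Lp_mod_def
    proof (rule integral_mono[OF int])
      show "integrable lebesgue (\<lambda>x. norm (u x - \<phi> x) powr p)"
        using p by (intro Lp_spaceD(2) Lp_space_diff uL \<phi>L) simp
      show "indicator (- \<Omega>) x * norm (u x) powr p \<le> norm (u x - \<phi> x) powr p" for x
        by (cases "x \<in> \<Omega>") (simp_all add: \<phi>0)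
    qed
    also have "\<dots> \<le> Lambda_norm s p (\<lambda>x. u x - \<phi> x) powr p" using p by (intro Lp_mod_le_Lambda_norm) simp
    also have "\<dots> \<le> e powr p" using \<phi>(2) p by (intro powr_mono2) (auto simp: Lambda_norm_def)
    finally show ?thesis .
  qed
  have "?I \<le> 0"
  proof (rule field_le_epsilon)
    fix e :: real assume "0 < e"
    then show "?I \<le> 0 + e" using le[of "e powr (1 / p)"] p by (simp add: powr_powr)
  qed
  moreover have "0 \<le> ?I" by (intro integral_nonneg_AE AE_I2) simp
  ultimately have "?I = 0" by (rule antisym)
  then have "AE x in lebesgue. indicator (- \<Omega>) x * norm (u x) powr p = 0"
    using integral_nonneg_eq_0_iff_AE[OF int] by simp
  then show ?thesis by eventually_elim (auto simp: indicator_def)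
qed

section \<open>Superposition with Caratheodory functions\<close>

text \<open>For simple functions \<open>w\<close> the composition is a finite sum of measurable pieces; the general case is a
  pointwise limit off the null set where continuity fails. The altered values on that null set do
  not matter because the Lebesgue measure is complete.\<close>

lemma caratheodory_measurable:
  fixes f :: "real^'n \<Rightarrow> 'b::euclidean_space \<Rightarrow> 'c::euclidean_space"
  assumes f: "caratheodory f" and w: "w \<in> borel_measurable lebesgue"
  shows "(\<lambda>x. f x (w x)) \<in> borel_measurable lebesgue"
proof -
  have fm[measurable]: "(\<lambda>x. f x \<xi>) \<in> borel_measurable lebesgue" for \<xi> using f by (simp add: caratheodory_def)
  have cont: "AE x in lebesgue. continuous_on UNIV (f x)" using f by (simp add: caratheodory_def)
  obtain W where W: "\<And>i. simple_function lebesgue (W i)" "\<And>x. (\<lambda>i. W i x) \<longlonglongrightarrow> w x"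
    using borel_measurable_implies_sequence_metric[OF w, of 0] by auto
  have Wm: "(\<lambda>x. f x (W i x)) \<in> borel_measurable lebesgue" for i
  proof -
    have fin: "finite (range (W i))" using W(1)[of i] by (simp add: simple_function_def)
    have S: "{x. W i x = \<xi>} \<in> sets lebesgue" for \<xi>
    proof -
      have "W i -` {\<xi>} \<inter> space lebesgue \<in> sets lebesgue" by (rule simple_functionD(2)[OF W(1)])
      then show ?thesis by (simp add: vimage_def)
    qed
    have "(\<lambda>x. \<Sum>\<xi>\<in>range (W i). indicator {x. W i x = \<xi>} x *\<^sub>R f x \<xi>) \<in> borel_measurable lebesgue"
      by (intro borel_measurable_sum borel_measurable_scaleR borel_measurable_indicator S fm)
    moreover have "(\<Sum>\<xi>\<in>range (W i). indicator {x. W i x = \<xi>} x *\<^sub>R f x \<xi>) = f x (W i x)" for x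
    proof -
      have "(\<Sum>\<xi>\<in>range (W i). indicator {x. W i x = \<xi>} x *\<^sub>R f x \<xi>) = (\<Sum>\<xi>\<in>{W i x}. indicator {x. W i x = \<xi>} x *\<^sub>R f x \<xi>)"
        by (rule sum.mono_neutral_right[OF fin]) auto
      then show ?thesis by simp
    qed
    ultimately show ?thesis by simp
  qed
  obtain N where N: "N \<in> null_sets lebesgue" "\<And>x. x \<notin> N \<Longrightarrow> continuous_on UNIV (f x)"
    using cont unfolding completion.AE_iff_null_sets by auto
  have NS: "- N \<in> sets lebesgue" using N(1) by (auto simp: null_sets_def Compl_eq_Diff_UNIV intro: sets.Diff)
  have "(\<lambda>x. indicator (- N) x *\<^sub>R f x (w x)) \<in> borel_measurable lebesgue"
  proof (rule borel_measurable_LIMSEQ_metric)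
    show "(\<lambda>x. indicator (- N) x *\<^sub>R f x (W i x)) \<in> borel_measurable lebesgue" for i
      by (intro borel_measurable_scaleR borel_measurable_indicator NS Wm)
    fix x
    show "(\<lambda>i. indicator (- N) x *\<^sub>R f x (W i x)) \<longlonglongrightarrow> indicator (- N) x *\<^sub>R f x (w x)"
    proof (cases "x \<in> N")
      case False
      then have "isCont (f x) (w x)" using N(2) by (simp add: continuous_on_eq_continuous_at)
      from isCont_tendsto_compose[OF this W(2)] show ?thesis by (intro tendsto_scaleR tendsto_const)
    qed simp
  qed
  then show ?thesis
  proof (rule borel_measurable_AE)
    have "AE x in lebesgue. x \<notin> N" by (rule AE_not_in[OF N(1)])
    then show "AE x in lebesgue. indicator (- N) x *\<^sub>R f x (w x) = f x (w x)" by eventually_elim simp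
  qed
qed

section \<open>The graph of the weak fractional gradient over a convex set\<close>

lemma Lp_space_Pair:
  fixes f :: "real^'n \<Rightarrow> 'a::euclidean_space" and g :: "real^'n \<Rightarrow> 'b::euclidean_space"
  assumes "f \<in> Lp_space p" "g \<in> Lp_space p" "0 \<le> p"
  shows "(\<lambda>x. (f x, g x)) \<in> Lp_space p"
proof -
  note [measurable] = Lp_spaceD(1)[OF assms(1)] Lp_spaceD(1)[OF assms(2)]
  show ?thesis
  proof (rule Lp_spaceI)
    show "(\<lambda>x. (f x, g x)) \<in> borel_measurable lebesgue" by (rule borel_measurable_Pair) measurable
    show "integrable lebesgue (\<lambda>x. 2 powr p * (norm (f x) powr p + norm (g x) powr p))"
      by (intro integrable_mult_right Bochner_Integration.integrable_add Lp_spaceD assms)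
    show "AE x in lebesgue. norm (f x, g x) powr p \<le> 2 powr p * (norm (f x) powr p + norm (g x) powr p)"
      using norm_add_powr_le[OF assms(3), of "(f x, 0)" "(0, g x)" for x] by (intro AE_I2) simp
  qed
qed

lemma Lp_space_dominated:
  assumes "f \<in> Lp_space p" "0 \<le> p" "g \<in> borel_measurable lebesgue" "AE x in lebesgue. norm (g x) \<le> norm (f x)"
  shows "g \<in> Lp_space p" "Lp_mod p g \<le> Lp_mod p f"
proof -
  have le: "AE x in lebesgue. norm (g x) powr p \<le> norm (f x) powr p"
    using assms(4) by eventually_elim (use assms(2) in \<open>auto intro: powr_mono2\<close>)
  show g: "g \<in> Lp_space p" by (rule Lp_spaceI[OF assms(3) Lp_spaceD(2)[OF assms(1)] le])
  show "Lp_mod p g \<le> Lp_mod p f"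
    unfolding Lp_mod_def by (rule integral_mono_AE[OF Lp_spaceD(2)[OF g] Lp_spaceD(2)[OF assms(1)] le])
qed

lemma norm_fst_le_norm: "norm (fst z) \<le> norm z" and norm_snd_le_norm: "norm (snd z) \<le> norm z"
  by (auto simp: norm_prod_def intro: real_le_rsqrt)

lemma Lp_space_fst_snd:
  fixes w :: "real^'n \<Rightarrow> 'a::euclidean_space \<times> 'b::euclidean_space"
  assumes "w \<in> Lp_space p" "0 \<le> p"
  shows "(\<lambda>x. fst (w x)) \<in> Lp_space p" "Lp_mod p (\<lambda>x. fst (w x)) \<le> Lp_mod p w"
    "(\<lambda>x. snd (w x)) \<in> Lp_space p" "Lp_mod p (\<lambda>x. snd (w x)) \<le> Lp_mod p w"
proof -
  have m: "(\<lambda>x. fst (w x)) \<in> borel_measurable lebesgue" "(\<lambda>x. snd (w x)) \<in> borel_measurable lebesgue"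
    using Lp_spaceD(1)[OF assms(1)]
    by (auto intro: borel_measurable_continuous_on[OF continuous_on_fst[OF continuous_on_id]]
        borel_measurable_continuous_on[OF continuous_on_snd[OF continuous_on_id]])
  show "(\<lambda>x. fst (w x)) \<in> Lp_space p" "Lp_mod p (\<lambda>x. fst (w x)) \<le> Lp_mod p w"
    by (rule Lp_space_dominated[OF assms m(1)], intro AE_I2 norm_fst_le_norm)+
  show "(\<lambda>x. snd (w x)) \<in> Lp_space p" "Lp_mod p (\<lambda>x. snd (w x)) \<le> Lp_mod p w"
    by (rule Lp_space_dominated[OF assms m(2)], intro AE_I2 norm_snd_le_norm)+
qed

text \<open>Any weak gradient is admitted as second component, not only the chosen one: this makes the graph
  exactly convex and closed, rather than up to null sets.\<close>

definition gradient_graph :: "real \<Rightarrow> real \<Rightarrow> (real^'n \<Rightarrow> real) set \<Rightarrow> (real^'n \<Rightarrow> real \<times> (real^'n)) set" where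
  "gradient_graph s p K = {w \<in> Lp_space p. (\<lambda>x. fst (w x)) \<in> K \<and>
     is_weak_frac_gradient s (\<lambda>x. fst (w x)) (\<lambda>x. snd (w x))}"

lemma Pair_mem_gradient_graph:
  assumes "1 < p" "K \<subseteq> Lambda s p" "u \<in> K"
  shows "(\<lambda>x. (u x, weak_frac_gradient s u x)) \<in> gradient_graph s p K"
proof -
  have u: "u \<in> Lambda s p" using assms by auto
  have "(\<lambda>x. (u x, weak_frac_gradient s u x)) \<in> Lp_space p"
    using assms(1) by (intro Lp_space_Pair LambdaD[OF u]) simp
  then show ?thesis using assms(3) LambdaD(2)[OF u] by (simp add: gradient_graph_def)
qed

lemma gradient_graph_convex:
  assumes s: "0 \<le> s" "s \<le> 1" and p: "1 < p" and K: "convex_funs K"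
  shows "convex_on_maps (gradient_graph s p K)"
  unfolding convex_on_maps_def
proof (intro ballI)
  fix w z and t :: real
  assume w: "w \<in> gradient_graph s p K" and z: "z \<in> gradient_graph s p K" and t: "t \<in> {0..1}"
  have L: "w \<in> Lp_space p" "z \<in> Lp_space p" using w z by (auto simp: gradient_graph_def)
  have p0: "0 \<le> p" using p by simp
  have "(\<lambda>x. (1 - t) * fst (w x) + t * fst (z x)) \<in> K"
    using K w z t by (auto simp: convex_funs_def gradient_graph_def)
  moreover have "is_weak_frac_gradient s (\<lambda>x. (1 - t) * fst (w x) + t * fst (z x)) (\<lambda>x. (1 - t) *\<^sub>R snd (w x) + t *\<^sub>R snd (z x))"
    using w z by (intro is_weak_frac_gradient_lincomb[OF s p] Lp_space_fst_snd(1) L p0) (auto simp: gradient_graph_def)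
  ultimately show "(\<lambda>x. (1 - t) *\<^sub>R w x + t *\<^sub>R z x) \<in> gradient_graph s p K"
    using Lp_space_convex_comb[OF L p0, of t] by (simp add: gradient_graph_def)
qed

text \<open>The limit has the limit of the gradients as weak gradient, so the first components converge in
  the norm of \<open>\<Lambda>\<^sup>s\<^sup>,\<^sup>p\<close>, and \<open>K\<close> is closed there.\<close>

lemma gradient_graph_closed:
  assumes s: "0 \<le> s" "s \<le> 1" and p: "1 < p" and K: "Lambda_closed s p K"
  shows "Lp_closed p (gradient_graph s p K)"
  unfolding Lp_closed_def
proof (intro allI impI)
  fix w :: "nat \<Rightarrow> real^'a \<Rightarrow> real \<times> (real^'a)" and v
  assume w: "\<forall>n. w n \<in> gradient_graph s p K" and v: "v \<in> Lp_space p"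
    and lim: "(\<lambda>n. Lp_mod p (\<lambda>x. w n x - v x)) \<longlonglongrightarrow> 0"
  have p0: "0 \<le> p" "0 < p" using p by auto
  have wL: "w n \<in> Lp_space p" for n using w by (auto simp: gradient_graph_def)
  have wK: "(\<lambda>x. fst (w n x)) \<in> K" "is_weak_frac_gradient s (\<lambda>x. fst (w n x)) (\<lambda>x. snd (w n x))" for n
    using w by (auto simp: gradient_graph_def)
  have dL: "(\<lambda>x. w n x - v x) \<in> Lp_space p" for n by (intro Lp_space_diff wL v p0)
  have fst0: "(\<lambda>n. Lp_mod p (\<lambda>x. fst (w n x) - fst (v x))) \<longlonglongrightarrow> 0"
    by (rule tendsto_sandwich[OF always_eventually always_eventually tendsto_const lim])
      (use Lp_mod_nonneg Lp_space_fst_snd(2)[OF dL p0(1)] in auto)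
  have snd0: "(\<lambda>n. Lp_mod p (\<lambda>x. snd (w n x) - snd (v x))) \<longlonglongrightarrow> 0"
    by (rule tendsto_sandwich[OF always_eventually always_eventually tendsto_const lim])
      (use Lp_mod_nonneg Lp_space_fst_snd(4)[OF dL p0(1)] in auto)
  have weak: "is_weak_frac_gradient s (\<lambda>x. fst (v x)) (\<lambda>x. snd (v x))"
    by (rule is_weak_frac_gradient_limit[OF s p Lp_space_fst_snd(1)[OF wL p0(1)] Lp_space_fst_snd(1)[OF v p0(1)] fst0
          Lp_space_fst_snd(3)[OF wL p0(1)] Lp_space_fst_snd(3)[OF v p0(1)] snd0 wK(2)])
  have "(\<lambda>x. fst (v x)) \<in> Lambda_closure s p K"
    unfolding Lambda_closure_def
  proof (intro CollectI conjI allI impI)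
    show "(\<lambda>x. fst (v x)) \<in> Lambda s p"
      using weak Lp_space_fst_snd(1,3)[OF v p0(1)] by (auto simp: Lambda_def)
    fix e :: real assume e: "0 < e"
    have "(\<lambda>n. Lp_mod p (\<lambda>x. fst (w n x) - fst (v x)) + Lp_mod p (\<lambda>x. snd (w n x) - snd (v x))) \<longlonglongrightarrow> 0 + 0"
      by (rule tendsto_add[OF fst0 snd0])
    then have "\<forall>\<^sub>F n in sequentially. Lp_mod p (\<lambda>x. fst (w n x) - fst (v x)) + Lp_mod p (\<lambda>x. snd (w n x) - snd (v x)) < e powr p"
      by (rule order_tendstoD) (use e in simp)
    then obtain n where n: "Lp_mod p (\<lambda>x. fst (w n x) - fst (v x)) + Lp_mod p (\<lambda>x. snd (w n x) - snd (v x)) < e powr p"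
      by (auto simp: eventually_sequentially)
    have "Lambda_norm s p (\<lambda>x. fst (v x) - fst (w n x))
        = (Lp_mod p (\<lambda>x. fst (v x) - fst (w n x)) + Lp_mod p (\<lambda>x. snd (v x) - snd (w n x))) powr (1 / p)"
      by (intro Lambda_norm_eq p0 is_weak_frac_gradient_diff[OF s p] Lp_space_diff Lp_space_fst_snd weak wK v wL)
    also have "\<dots> < (e powr p) powr (1 / p)"
      using n p0 by (intro powr_less_mono2) (auto simp: Lp_mod_minus_commute[of p "\<lambda>x. fst (v x)"]
          Lp_mod_minus_commute[of p "\<lambda>x. snd (v x)"] intro: add_nonneg_nonneg Lp_mod_nonneg)
    also have "\<dots> = e" using e p0 by (simp add: powr_powr)
    finally show "\<exists>u\<in>K. Lambda_norm s p (\<lambda>x. fst (v x) - u x) < e"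
      by (rule bexI[where x="\<lambda>x. fst (w n x)", OF _ wK(1)])
  qed
  then have "(\<lambda>x. fst (v x)) \<in> K" using K by (auto simp: Lambda_closed_def)
  then show "v \<in> gradient_graph s p K" using v weak by (simp add: gradient_graph_def)
qed

section \<open>The operator of the variational inequality\<close>

text \<open>Growth and coercivity of \<open>a\<close> and \<open>b\<close> carry over to the pair; the factor \<open>2 powr p\<close> compares
  \<open>|(r, \<xi>)|\<^sup>p\<close> with \<open>|r|\<^sup>p + |\<xi>|\<^sup>p\<close>.\<close>

lemma monotone_Lp_operator_Pair:
  fixes a :: "real^'n \<Rightarrow> real^'n \<Rightarrow> real^'n" and b :: "real^'n \<Rightarrow> real \<Rightarrow> real"
  assumes p: "1 < p" and car: "caratheodory a" "caratheodory b"
    and mono: "AE x in lebesgue. \<forall>\<xi> \<eta>. (a x \<xi> - a x \<eta>) \<bullet> (\<xi> - \<eta>) \<ge> 0"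
      "AE x in lebesgue. \<forall>r \<rho>. (b x r - b x \<rho>) * (r - \<rho>) \<ge> 0"
    and const: "C1 > 0" "C2 > 0" "\<alpha> > 0" "\<beta> > 0"
    and \<gamma>: "\<gamma>1 \<in> Lp_space (p / (p - 1))" "\<gamma>2 \<in> Lp_space (p / (p - 1))" and k: "k \<in> Lp_space 1"
    and growth: "AE x in lebesgue. \<forall>\<xi>. norm (a x \<xi>) \<le> \<gamma>1 x + C1 * norm \<xi> powr (p - 1)"
      "AE x in lebesgue. \<forall>r. \<bar>b x r\<bar> \<le> \<gamma>2 x + C2 * \<bar>r\<bar> powr (p - 1)"
    and coercive: "AE x in lebesgue. \<forall>\<xi> r. a x \<xi> \<bullet> \<xi> + b x r * r \<ge> \<alpha> * norm \<xi> powr p + \<beta> * \<bar>r\<bar> powr p - k x"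
  shows "monotone_Lp_operator p (C1 + C2) (min \<alpha> \<beta> / 2 powr p) (\<lambda>x z. (b x (fst z), a x (snd z))) (\<lambda>x. \<gamma>1 x + \<gamma>2 x) k"
proof
  show "1 < p" "0 < C1 + C2" "0 < min \<alpha> \<beta> / 2 powr p" using p const by auto
  show "(\<lambda>x. \<gamma>1 x + \<gamma>2 x) \<in> Lp_space (p / (p - 1))" using \<gamma> p by (intro Lp_space_add) auto
  show "integrable lebesgue k"
  proof (rule Bochner_Integration.integrable_bound)
    show "integrable lebesgue (\<lambda>x. norm (k x) powr 1)" by (rule Lp_spaceD(2)[OF k])
  qed (use Lp_spaceD(1)[OF k] in auto)
  show "(\<lambda>x. (b x (fst (w x)), a x (snd (w x)))) \<in> borel_measurable lebesgue" if w: "w \<in> borel_measurable lebesgue" for w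
  proof (rule borel_measurable_Pair)
    show "(\<lambda>x. b x (fst (w x))) \<in> borel_measurable lebesgue"
      by (rule caratheodory_measurable[OF car(2) borel_measurable_continuous_on[OF continuous_on_fst[OF continuous_on_id] w]])
    show "(\<lambda>x. a x (snd (w x))) \<in> borel_measurable lebesgue"
      by (rule caratheodory_measurable[OF car(1) borel_measurable_continuous_on[OF continuous_on_snd[OF continuous_on_id] w]])
  qed
  have "AE x in lebesgue. continuous_on UNIV (a x)" "AE x in lebesgue. continuous_on UNIV (b x)"
    using car by (auto simp: caratheodory_def)
  then show "AE x in lebesgue. continuous_on UNIV (\<lambda>z. (b x (fst z), a x (snd z)))"
  proof eventually_elim
    case (elim x)
    show ?case
      by (intro continuous_on_Pair continuous_on_compose2[OF elim(1)] continuous_on_compose2[OF elim(2)] continuous_intros) auto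
  qed
  show "AE x in lebesgue. \<forall>\<xi> \<eta>. 0 \<le> ((b x (fst \<xi>), a x (snd \<xi>)) - (b x (fst \<eta>), a x (snd \<eta>))) \<bullet> (\<xi> - \<eta>)"
    using mono
  proof eventually_elim
    case (elim x)
    show ?case
    proof (intro allI)
      fix \<xi> \<eta> :: "real \<times> (real^'n)"
      have "0 \<le> (a x (snd \<xi>) - a x (snd \<eta>)) \<bullet> (snd \<xi> - snd \<eta>)" "0 \<le> (b x (fst \<xi>) - b x (fst \<eta>)) * (fst \<xi> - fst \<eta>)"
        using elim by blast+
      then show "0 \<le> ((b x (fst \<xi>), a x (snd \<xi>)) - (b x (fst \<eta>), a x (snd \<eta>))) \<bullet> (\<xi> - \<eta>)"
        by (simp add: inner_prod_def)
    qed
  qed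
  show "AE x in lebesgue. \<forall>z. norm (b x (fst z), a x (snd z)) \<le> \<gamma>1 x + \<gamma>2 x + (C1 + C2) * norm z powr (p - 1)"
    using growth
  proof eventually_elim
    case (elim x)
    show ?case
    proof
      fix z :: "real \<times> (real^'n)"
      have "norm (snd z) powr (p - 1) \<le> norm z powr (p - 1)" "\<bar>fst z\<bar> powr (p - 1) \<le> norm z powr (p - 1)"
        using p norm_fst_le_norm[of z] by (auto intro!: powr_mono2 norm_snd_le_norm)
      then have "C1 * norm (snd z) powr (p - 1) \<le> C1 * norm z powr (p - 1)" "C2 * \<bar>fst z\<bar> powr (p - 1) \<le> C2 * norm z powr (p - 1)"
        using const by simp_all
      moreover have "norm (a x (snd z)) \<le> \<gamma>1 x + C1 * norm (snd z) powr (p - 1)" "\<bar>b x (fst z)\<bar> \<le> \<gamma>2 x + C2 * \<bar>fst z\<bar> powr (p - 1)"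
        using elim by blast+
      moreover have "norm (b x (fst z), a x (snd z)) \<le> \<bar>b x (fst z)\<bar> + norm (a x (snd z))"
        using norm_Pair_le[of "b x (fst z)" "a x (snd z)"] by simp
      ultimately show "norm (b x (fst z), a x (snd z)) \<le> \<gamma>1 x + \<gamma>2 x + (C1 + C2) * norm z powr (p - 1)"
        by (simp add: distrib_right)
    qed
  qed
  show "AE x in lebesgue. \<forall>z. min \<alpha> \<beta> / 2 powr p * norm z powr p - k x \<le> (b x (fst z), a x (snd z)) \<bullet> z"
    using coercive
  proof eventually_elim
    case (elim x)
    show ?case
    proof
      fix z :: "real \<times> (real^'n)"
      have "norm z powr p \<le> 2 powr p * (\<bar>fst z\<bar> powr p + norm (snd z) powr p)"
        using norm_add_powr_le[of p "(fst z, 0)" "(0, snd z)"] p by simp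
      then have "min \<alpha> \<beta> / 2 powr p * norm z powr p \<le> min \<alpha> \<beta> / 2 powr p * (2 powr p * (\<bar>fst z\<bar> powr p + norm (snd z) powr p))"
        using const by (intro mult_left_mono) auto
      also have "\<dots> = min \<alpha> \<beta> * \<bar>fst z\<bar> powr p + min \<alpha> \<beta> * norm (snd z) powr p" by (simp add: distrib_left)
      also have "\<dots> \<le> \<beta> * \<bar>fst z\<bar> powr p + \<alpha> * norm (snd z) powr p"
        by (intro add_mono mult_right_mono) auto
      finally have "min \<alpha> \<beta> / 2 powr p * norm z powr p - k x \<le> \<alpha> * norm (snd z) powr p + \<beta> * \<bar>fst z\<bar> powr p - k x" by simp
      also have "\<dots> \<le> a x (snd z) \<bullet> snd z + b x (fst z) * fst z" using elim by blast
      also have "\<dots> = (b x (fst z), a x (snd z)) \<bullet> z" by (simp add: inner_prod_def)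
      finally show "min \<alpha> \<beta> / 2 powr p * norm z powr p - k x \<le> (b x (fst z), a x (snd z)) \<bullet> z" .
    qed
  qed
qed

theorem theorem3p3:
  fixes \<Omega> :: "(real^'n) set"
    and s p p' C1 C2 \<alpha> \<beta> :: real
    and K :: "(real^'n \<Rightarrow> real) set"
    and a :: "real^'n \<Rightarrow> real^'n \<Rightarrow> real^'n"
    and b :: "real^'n \<Rightarrow> real \<Rightarrow> real"
    and \<gamma>1 \<gamma>2 k :: "real^'n \<Rightarrow> real"
  assumes "open \<Omega>"
    and "0 \<le> s" "s \<le> 1"
    and "1 < p" "p' = p / (p - 1)"
    and "K \<subseteq> Lambda0 s p \<Omega>" "K \<noteq> {}" "Lambda_closed s p K" "convex_funs K"
    and "caratheodory a" "caratheodory b"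
    and "AE x in lebesgue. \<forall>\<xi> \<eta>. (a x \<xi> - a x \<eta>) \<bullet> (\<xi> - \<eta>) \<ge> 0"
    and "AE x in lebesgue. \<forall>r \<rho>. (b x r - b x \<rho>) * (r - \<rho>) \<ge> 0"
    and "C1 > 0" "C2 > 0" "\<alpha> > 0" "\<beta> > 0"
    and "\<gamma>1 \<in> Lp_space p'" "\<gamma>2 \<in> Lp_space p'" "k \<in> Lp_space 1"
    and "AE x in lebesgue. \<forall>\<xi>. norm (a x \<xi>) \<le> \<gamma>1 x + C1 * norm \<xi> powr (p - 1)"
    and "AE x in lebesgue. \<forall>r. \<bar>b x r\<bar> \<le> \<gamma>2 x + C2 * \<bar>r\<bar> powr (p - 1)"
    and "AE x in lebesgue. \<forall>\<xi> r.
           a x \<xi> \<bullet> \<xi> + b x r * r \<ge> \<alpha> * norm \<xi> powr p + \<beta> * \<bar>r\<bar> powr p - k x"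
  shows "\<exists>u\<in>K. \<forall>v\<in>K.
           (LINT x|lebesgue.
              a x (weak_frac_gradient s u x) \<bullet> weak_frac_gradient s (\<lambda>y. v y - u y) x)
           + (LINT x:\<Omega>|lebesgue. b x (u x) * (v x - u x)) \<ge> 0"
proof -
  have s: "0 \<le> s" "s \<le> 1" and p: "1 < p" and p0: "0 \<le> p" and K: "K \<noteq> {}" "Lambda_closed s p K" "convex_funs K"
    using assms(2,3,4,7,8,9) by auto
  have car: "caratheodory a" "caratheodory b" by fact+
  have KL: "K \<subseteq> Lambda s p" using assms(6) by (auto simp: Lambda0_def Lambda_closure_def)
  let ?F = "\<lambda>x z. (b x (fst z), a x (snd z))"
  interpret F: monotone_Lp_operator p "C1 + C2" "min \<alpha> \<beta> / 2 powr p" ?F "\<lambda>x. \<gamma>1 x + \<gamma>2 x" k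
    by (rule monotone_Lp_operator_Pair) (use assms in simp_all)
  have "gradient_graph s p K \<noteq> {}" using Pair_mem_gradient_graph[OF p KL] K(1) by blast
  then obtain w where w: "w \<in> gradient_graph s p K"
    and vi: "\<And>z. z \<in> gradient_graph s p K \<Longrightarrow> 0 \<le> (LINT x|lebesgue. ?F x (w x) \<bullet> (z x - w x))"
    using F.variational_inequality[OF _ gradient_graph_convex[OF s p K(3)] gradient_graph_closed[OF s p K(2)]]
    by (auto simp: gradient_graph_def)
  define u where "u = (\<lambda>x. fst (w x))"
  define G where "G = (\<lambda>x. snd (w x))"
  have wL: "w \<in> Lp_space p" and uK: "u \<in> K" and uG: "is_weak_frac_gradient s u G"
    using w by (auto simp: gradient_graph_def u_def G_def)
  have FL: "(\<lambda>x. ?F x (w x)) \<in> Lp_space (p / (p - 1))" by (rule F.F_Lp[OF wL])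
  have q0: "0 \<le> p / (p - 1)" using p by simp
  have um: "u \<in> borel_measurable lebesgue" and Gm: "G \<in> borel_measurable lebesgue"
    using Lp_space_fst_snd(1,3)[OF wL p0] by (auto simp: u_def G_def dest: Lp_spaceD(1))
  have bm: "(\<lambda>x. b x (u x)) \<in> borel_measurable lebesgue" by (rule caratheodory_measurable[OF car(2) um])
  have am: "(\<lambda>x. a x (H x)) \<in> borel_measurable lebesgue" if "H \<in> borel_measurable lebesgue" for H
    by (rule caratheodory_measurable[OF car(1) that])
  have bL: "(\<lambda>x. b x (u x)) \<in> Lp_space (p / (p - 1))" and aL: "(\<lambda>x. a x (G x)) \<in> Lp_space (p / (p - 1))"
    using Lp_space_fst_snd(1,3)[OF FL q0] by (simp_all add: u_def G_def)
  have vanish: "AE x in lebesgue. x \<notin> \<Omega> \<longrightarrow> v x = 0" if "v \<in> K" for v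
    using that assms(6) by (intro Lambda0_AE_zero_outside[OF p assms(1)]) auto
  show ?thesis
  proof (intro bexI[OF _ uK] ballI)
    fix v assume v: "v \<in> K"
    let ?H = "weak_frac_gradient s v"
    have vL: "v \<in> Lp_space p" and HL: "?H \<in> Lp_space p" and vH: "is_weak_frac_gradient s v ?H"
      using LambdaD[of v s p] v KL by auto
    have uL: "u \<in> Lp_space p" and GL: "G \<in> Lp_space p" using Lp_space_fst_snd(1,3)[OF wL p0] by (simp_all add: u_def G_def)
    have dG: "is_weak_frac_gradient s (\<lambda>x. v x - u x) (\<lambda>x. ?H x - G x)"
      by (rule is_weak_frac_gradient_diff[OF s p vL uL vH uG])
    have dL: "(\<lambda>x. v x - u x) \<in> Lp_space p" "(\<lambda>x. ?H x - G x) \<in> Lp_space p"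
      by (intro Lp_space_diff vL uL HL GL p0)+
    have "0 \<le> (LINT x|lebesgue. ?F x (w x) \<bullet> ((v x, ?H x) - w x))"
      by (rule vi[OF Pair_mem_gradient_graph[OF p KL v]])
    also have "\<dots> = (LINT x|lebesgue. a x (G x) \<bullet> (?H x - G x) + b x (u x) \<bullet> (v x - u x))"
      by (intro Bochner_Integration.integral_cong refl) (simp add: inner_prod_def u_def G_def)
    also have "\<dots> = (LINT x|lebesgue. a x (G x) \<bullet> (?H x - G x)) + (LINT x|lebesgue. b x (u x) \<bullet> (v x - u x))"
      by (intro Bochner_Integration.integral_add integrable_inner_Lp[OF p aL dL(2)] integrable_inner_Lp[OF p bL dL(1)])
    also have "(LINT x|lebesgue. a x (G x) \<bullet> (?H x - G x))
        = (LINT x|lebesgue. a x (weak_frac_gradient s u x) \<bullet> weak_frac_gradient s (\<lambda>y. v y - u y) x)"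
    proof (rule integral_cong_AE)
      show "(\<lambda>x. a x (G x) \<bullet> (?H x - G x)) \<in> borel_measurable lebesgue"
        by (intro borel_measurable_inner am Gm Lp_spaceD(1)[OF dL(2)])
      show "(\<lambda>x. a x (weak_frac_gradient s u x) \<bullet> weak_frac_gradient s (\<lambda>y. v y - u y) x) \<in> borel_measurable lebesgue"
        by (intro borel_measurable_inner am weak_frac_gradient_measurable[OF uG] weak_frac_gradient_measurable[OF dG])
      show "AE x in lebesgue. a x (G x) \<bullet> (?H x - G x) = a x (weak_frac_gradient s u x) \<bullet> weak_frac_gradient s (\<lambda>y. v y - u y) x"
        using weak_frac_gradient_AE_eq(2)[OF uG] weak_frac_gradient_AE_eq(2)[OF dG] by eventually_elim simp
    qed
    also have "(LINT x|lebesgue. b x (u x) \<bullet> (v x - u x)) = (LINT x:\<Omega>|lebesgue. b x (u x) * (v x - u x))"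
      unfolding set_lebesgue_integral_def
    proof (rule integral_cong_AE)
      have m: "(\<lambda>x. b x (u x) \<bullet> (v x - u x)) \<in> borel_measurable lebesgue"
        by (intro borel_measurable_inner bm Lp_spaceD(1)[OF dL(1)])
      then show "(\<lambda>x. b x (u x) \<bullet> (v x - u x)) \<in> borel_measurable lebesgue" .
      have "\<Omega> \<in> sets lebesgue" using assms(1) by simp
      with m show "(\<lambda>x. indicator \<Omega> x *\<^sub>R (b x (u x) * (v x - u x))) \<in> borel_measurable lebesgue"
        by (intro borel_measurable_scaleR borel_measurable_indicator) simp_all
      show "AE x in lebesgue. b x (u x) \<bullet> (v x - u x) = indicator \<Omega> x *\<^sub>R (b x (u x) * (v x - u x))"
        using vanish[OF v] vanish[OF uK] by eventually_elim (auto simp: indicator_def)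
    qed
    finally show "0 \<le> (LINT x|lebesgue.
              a x (weak_frac_gradient s u x) \<bullet> weak_frac_gradient s (\<lambda>y. v y - u y) x)
           + (LINT x:\<Omega>|lebesgue. b x (u x) * (v x - u x))" .
  qed
qed

end
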